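(* Let $\mathbf k$ be an algebraically closed field, $\mathcal C$ a finite tensor category over $\mathbf k$ with simple objects $X_r$ ($r\in J$), $\mathcal M$ an indecomposable semisimple left $\mathcal C$-module category with simple objects $M_i$ ($i\in I$), and $a$ a pivotal structure on $\mathcal C$ matched to $\mathcal M$. Let $H$ be the weak Hopf algebra attached to $(\mathcal C,\mathcal M)$, so that $S^2(x)=g_axg_a^{-1}$ with pivotal element $g_a=yS(y)^{-1}$ for some invertible $y\in A_s\cong A=\bigoplus_{i\in I}\mathbf k$, and let $m_i\in\mathbf k$ be the projection of $y$ to the $i$-th summand of $A$. Then the characteristic polynomial of $S^2:H\to H$ is $$\chi(z)=\prod_{i,j,k,l\in I}(z-\lambda_{ijkl})^{n_{ijkl}},$$ where $$\lambda_{ijkl}=\frac{m_jm_l}{m_im_k},\qquad n_{ijkl}=\sum_{q,r\in J}N_{qi}^jC_{qr}N_{rl}^k,$$ $N_{ri}^j=\dim\mathrm{Hom}(X_r\otimes M_i,M_j)$, and $C=(C_{qr})$ is the Cartan matrix of $\mathcal C$.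
   Context: The weak Hopf algebra $H$: $\mathcal M=A\text{-mod}$, $\mathrm{End}(\mathcal M)=A\text{-bimod}$; the action of $\mathcal C$ on $\mathcal M$ is a tensor functor $F:\mathcal C\to A\text{-bimod}$, $F(X)=\bigoplus_{i,j}\mathrm{Hom}(M_j,X\otimes M_i)$; $\overline F$ is its composition with the forgetful functor to vector spaces; $H:=\mathrm{End}(\overline F)$ with its canonical structure of a (biconnected regular) weak Hopf algebra with $\mathrm{Rep}\,H=\mathcal C$ (coproduct from evaluation on $F(X\otimes Y)=F(X)\otimes_AF(Y)$ realized in $F(X)\otimes F(Y)$ by the separability idempotent, antipode $S$ from duality). Its bases $A_s,A_t$ are isomorphic to $A$; if $e_i\in A_s$ are the primitive idempotents, then $S(e_i)$ are the primitive idempotents of $A_t$, and $e_jS(e_i)$ acts on $F(X)$ as the projection to $\mathrm{Hom}(M_j,X\otimes M_i)$. A pivotal structure is a tensor isomorphism $a:\mathrm{Id}\to **$. Its pivotal element $g_a\in H$ is the grouplike element given by $F(X)\xrightarrow{F(a_X)}F(X^{**})\cong F(X)^{**}\cong F(X)$; it satisfies $S^2(x)=g_axg_a^{-1}$. Matched: for $V\in\mathrm{End}\,\mathcal M$ identify $V^{**}$ with $V$ naturally (double dual of bimodules); then $F(X^{**})\cong F(X)$, i.e. $X^{**}\otimes M=X\otimes M$ canonically, and $a\otimes1:X\otimes M\to X^{**}\otimes M=X\otimes M$ is a $\mathcal C$-module functor structure on the identity functor of $\mathcal M$. This is an invertible object $\chi(a,\mathcal M)$ of $\mathcal C^*_{\mathcal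 M}=\mathrm{Fun}_{\mathcal C}(\mathcal M,\mathcal M)$, and $a$ is matched to $\mathcal M$ if $\chi(a,\mathcal M)=\mathbf 1$; equivalently $g_a=yS(y)^{-1}$ for an invertible $y\in A_s$. The Cartan matrix is $C_{qr}=\dim\mathrm{Hom}(P_q,P_r)$, where $P_r$ is the projective cover of $X_r$. *)

theory Defs
  imports
    Complex_Main
    "HOL-Library.Function_Algebras"
    "HOL-Computational_Algebra.Polynomial"
    "Jordan_Normal_Form.Char_Poly"
begin

section \<open>Linear algebra in subspaces\<close>

definition finite_dim :: "('k::field \<Rightarrow> 'v::ab_group_add \<Rightarrow> 'v) \<Rightarrow> 'v set \<Rightarrow> bool" where
  "finite_dim sc V \<longleftrightarrow> (\<exists>B. finite B \<and> V \<subseteq> Modules.module.span sc B)"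

definition endo_on :: "('k::field \<Rightarrow> 'v::ab_group_add \<Rightarrow> 'v) \<Rightarrow> 'v set \<Rightarrow> ('v \<Rightarrow> 'v) \<Rightarrow> bool" where
  "endo_on sc V T \<longleftrightarrow>
     (\<forall>v\<in>V. T v \<in> V) \<and>
     (\<forall>v\<in>V. \<forall>w\<in>V. T (v + w) = T v + T w) \<and>
     (\<forall>c. \<forall>v\<in>V. T (sc c v) = sc c (T v))"

definition ordered_basis :: "('k::field \<Rightarrow> 'v::ab_group_add \<Rightarrow> 'v) \<Rightarrow> 'v set \<Rightarrow> 'v list \<Rightarrow> bool" where
  "ordered_basis sc V bs \<longleftrightarrow>
     distinct bs \<and> \<not> Modules.module.dependent sc (set bs) \<and> Modules.module.span sc (set bs) = V"

definition matrix_on ::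
  "('k::field \<Rightarrow> 'v::ab_group_add \<Rightarrow> 'v) \<Rightarrow> 'v list \<Rightarrow> ('v \<Rightarrow> 'v) \<Rightarrow> 'k mat" where
  "matrix_on sc bs T = mat (length bs) (length bs)
     (\<lambda>(r, c). Modules.module.representation sc (set bs) (T (bs ! c)) (bs ! r))"

text \<open>The library has characteristic polynomials of matrices only. Finite dimensionality is part of
  the definition, so that the quantification over bases is not vacuous.\<close>

definition has_char_poly ::
  "('k::field \<Rightarrow> 'v::ab_group_add \<Rightarrow> 'v) \<Rightarrow> 'v set \<Rightarrow> ('v \<Rightarrow> 'v) \<Rightarrow> 'k poly \<Rightarrow> bool" where
  "has_char_poly sc V T p \<longleftrightarrow>
     Modules.module.subspace sc V \<and> finite_dim sc V \<and> endo_on sc V T \<and>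
     (\<forall>bs. ordered_basis sc V bs \<longrightarrow> char_poly (matrix_on sc bs T) = p)"


section \<open>Linear and abelian categories\<close>

text \<open>The objects of a category form a type, and all its morphisms live in one vector space, of
  which the spaces \<^term>\<open>Hom C X Y\<close> are subspaces. Every small linear category has this form: take
  the direct sum of all its Hom spaces and extend composition (and, below, the tensor product of
  morphisms) bilinearly. The Hom subspaces are not required to be independent, so a morphism does
  not determine its source and target; these are passed as arguments wherever they matter.\<close>

record ('k, 'o, 'm) lincat =
  Hom :: "'o \<Rightarrow> 'o \<Rightarrow> 'm set"
  Comp :: "'m \<Rightarrow> 'm \<Rightarrow> 'm" (infixr "\<cdot>\<index>" 70)
  Id :: "'o \<Rightarrow> 'm"
  Scale :: "'k \<Rightarrow> 'm \<Rightarrow> 'm"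

locale linear_category =
  fixes C :: "('k::field, 'o, 'm::ab_group_add, 'z) lincat_scheme" (structure)
  assumes vector_space_Scale: "vector_space (Scale C)"
    and subspace_Hom: "Modules.module.subspace (Scale C) (Hom C X Y)"
    and Id_in_Hom: "Id C X \<in> Hom C X X"
    and Comp_in_Hom: "f \<in> Hom C X Y \<Longrightarrow> g \<in> Hom C Y Z \<Longrightarrow> g \<cdot> f \<in> Hom C X Z"
    and Comp_assoc: "f \<in> Hom C X Y \<Longrightarrow> g \<in> Hom C Y Z \<Longrightarrow> h \<in> Hom C Z W \<Longrightarrow> (h \<cdot> g) \<cdot> f = h \<cdot> (g \<cdot> f)"
    and Comp_Id_left: "f \<in> Hom C X Y \<Longrightarrow> Id C Y \<cdot> f = f"
    and Comp_Id_right: "f \<in> Hom C X Y \<Longrightarrow> f \<cdot> Id C X = f"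
    and Comp_add_left: "f \<in> Hom C X Y \<Longrightarrow> g \<in> Hom C Y Z \<Longrightarrow> g' \<in> Hom C Y Z \<Longrightarrow>
          (g + g') \<cdot> f = g \<cdot> f + g' \<cdot> f"
    and Comp_add_right: "f \<in> Hom C X Y \<Longrightarrow> f' \<in> Hom C X Y \<Longrightarrow> g \<in> Hom C Y Z \<Longrightarrow>
          g \<cdot> (f + f') = g \<cdot> f + g \<cdot> f'"
    and Comp_scale_left: "f \<in> Hom C X Y \<Longrightarrow> g \<in> Hom C Y Z \<Longrightarrow> Scale C c g \<cdot> f = Scale C c (g \<cdot> f)"
    and Comp_scale_right: "f \<in> Hom C X Y \<Longrightarrow> g \<in> Hom C Y Z \<Longrightarrow> g \<cdot> Scale C c f = Scale C c (g \<cdot> f)"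

definition hom_dim :: "('k::field, 'o, 'm::ab_group_add, 'z) lincat_scheme \<Rightarrow> 'o \<Rightarrow> 'o \<Rightarrow> nat" where
  "hom_dim C X Y = vector_space.dim (Scale C) (Hom C X Y)"

definition iso_mor :: "('k, 'o, 'm, 'z) lincat_scheme \<Rightarrow> 'o \<Rightarrow> 'o \<Rightarrow> 'm \<Rightarrow> bool" where
  "iso_mor C X Y f \<longleftrightarrow> f \<in> Hom C X Y \<and>
     (\<exists>g\<in>Hom C Y X. g \<cdot>\<^bsub>C\<^esub> f = Id C X \<and> f \<cdot>\<^bsub>C\<^esub> g = Id C Y)"

definition inv_mor :: "('k, 'o, 'm, 'z) lincat_scheme \<Rightarrow> 'o \<Rightarrow> 'o \<Rightarrow> 'm \<Rightarrow> 'm" where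
  "inv_mor C X Y f = (THE g. g \<in> Hom C Y X \<and> g \<cdot>\<^bsub>C\<^esub> f = Id C X \<and> f \<cdot>\<^bsub>C\<^esub> g = Id C Y)"

definition isomorphic :: "('k, 'o, 'm, 'z) lincat_scheme \<Rightarrow> 'o \<Rightarrow> 'o \<Rightarrow> bool" where
  "isomorphic C X Y \<longleftrightarrow> (\<exists>f. iso_mor C X Y f)"

definition mono_mor :: "('k, 'o, 'm, 'z) lincat_scheme \<Rightarrow> 'o \<Rightarrow> 'o \<Rightarrow> 'm \<Rightarrow> bool" where
  "mono_mor C X Y f \<longleftrightarrow> f \<in> Hom C X Y \<and>
     (\<forall>W. \<forall>g\<in>Hom C W X. \<forall>h\<in>Hom C W X. f \<cdot>\<^bsub>C\<^esub> g = f \<cdot>\<^bsub>C\<^esub> h \<longrightarrow> g = h)"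

definition epi_mor :: "('k, 'o, 'm, 'z) lincat_scheme \<Rightarrow> 'o \<Rightarrow> 'o \<Rightarrow> 'm \<Rightarrow> bool" where
  "epi_mor C X Y f \<longleftrightarrow> f \<in> Hom C X Y \<and>
     (\<forall>W. \<forall>g\<in>Hom C Y W. \<forall>h\<in>Hom C Y W. g \<cdot>\<^bsub>C\<^esub> f = h \<cdot>\<^bsub>C\<^esub> f \<longrightarrow> g = h)"

definition zero_object :: "('k, 'o, 'm::ab_group_add, 'z) lincat_scheme \<Rightarrow> 'o \<Rightarrow> bool" where
  "zero_object C Z \<longleftrightarrow> (\<forall>X. Hom C X Z = {0} \<and> Hom C Z X = {0})"

definition biproduct :: "('k, 'o, 'm::ab_group_add, 'z) lincat_scheme \<Rightarrow> 'o \<Rightarrow> 'o \<Rightarrow> 'o \<Rightarrow> bool" where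
  "biproduct C B X Y \<longleftrightarrow>
     (\<exists>i\<in>Hom C X B. \<exists>j\<in>Hom C Y B. \<exists>p\<in>Hom C B X. \<exists>q\<in>Hom C B Y.
        p \<cdot>\<^bsub>C\<^esub> i = Id C X \<and> q \<cdot>\<^bsub>C\<^esub> j = Id C Y \<and> p \<cdot>\<^bsub>C\<^esub> j = 0 \<and> q \<cdot>\<^bsub>C\<^esub> i = 0 \<and>
        i \<cdot>\<^bsub>C\<^esub> p + j \<cdot>\<^bsub>C\<^esub> q = Id C B)"

definition is_kernel ::
  "('k, 'o, 'm::ab_group_add, 'z) lincat_scheme \<Rightarrow> 'o \<Rightarrow> 'o \<Rightarrow> 'm \<Rightarrow> 'o \<Rightarrow> 'm \<Rightarrow> bool" where
  "is_kernel C X Y f K k \<longleftrightarrow> k \<in> Hom C K X \<and> f \<cdot>\<^bsub>C\<^esub> k = 0 \<and>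
     (\<forall>W. \<forall>h\<in>Hom C W X. f \<cdot>\<^bsub>C\<^esub> h = 0 \<longrightarrow> (\<exists>!u. u \<in> Hom C W K \<and> k \<cdot>\<^bsub>C\<^esub> u = h))"

definition is_cokernel ::
  "('k, 'o, 'm::ab_group_add, 'z) lincat_scheme \<Rightarrow> 'o \<Rightarrow> 'o \<Rightarrow> 'm \<Rightarrow> 'o \<Rightarrow> 'm \<Rightarrow> bool" where
  "is_cokernel C X Y f Q q \<longleftrightarrow> q \<in> Hom C Y Q \<and> q \<cdot>\<^bsub>C\<^esub> f = 0 \<and>
     (\<forall>W. \<forall>h\<in>Hom C Y W. h \<cdot>\<^bsub>C\<^esub> f = 0 \<longrightarrow> (\<exists>!u. u \<in> Hom C Q W \<and> u \<cdot>\<^bsub>C\<^esub> q = h))"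

definition short_exact ::
  "('k, 'o, 'm::ab_group_add, 'z) lincat_scheme \<Rightarrow> 'o \<Rightarrow> 'o \<Rightarrow> 'o \<Rightarrow> 'm \<Rightarrow> 'm \<Rightarrow> bool" where
  "short_exact C X Y Z f g \<longleftrightarrow> f \<in> Hom C X Y \<and> g \<in> Hom C Y Z \<and>
     is_kernel C Y Z g X f \<and> is_cokernel C X Y f Z g"

locale abelian_category = linear_category C
  for C :: "('k::field, 'o, 'm::ab_group_add, 'z) lincat_scheme" (structure) +
  assumes ex_zero_object: "\<exists>Z. zero_object C Z"
    and ex_biproduct: "\<exists>B. biproduct C B X Y"
    and ex_kernel: "f \<in> Hom C X Y \<Longrightarrow> \<exists>K k. is_kernel C X Y f K k"
    and ex_cokernel: "f \<in> Hom C X Y \<Longrightarrow> \<exists>Q q. is_cokernel C X Y f Q q"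
    and mono_normal: "mono_mor C X Y f \<Longrightarrow> \<exists>Z. \<exists>g\<in>Hom C Y Z. is_kernel C Y Z g X f"
    and epi_normal: "epi_mor C X Y f \<Longrightarrow> \<exists>Z. \<exists>g\<in>Hom C Z X. is_cokernel C Z X g Y f"

definition simple_object :: "('k, 'o, 'm::ab_group_add, 'z) lincat_scheme \<Rightarrow> 'o \<Rightarrow> bool" where
  "simple_object C X \<longleftrightarrow> \<not> zero_object C X \<and>
     (\<forall>Y f. mono_mor C Y X f \<longrightarrow> f = 0 \<or> iso_mor C Y X f)"

inductive finite_length :: "('k, 'o, 'm::ab_group_add, 'z) lincat_scheme \<Rightarrow> 'o \<Rightarrow> bool"
  for C where
  zero: "zero_object C X \<Longrightarrow> finite_length C X"
| extend: "finite_length C Y \<Longrightarrow> simple_object C S \<Longrightarrow> short_exact C Y X S f g \<Longrightarrow> finite_length C X"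

inductive semisimple_object :: "('k, 'o, 'm::ab_group_add, 'z) lincat_scheme \<Rightarrow> 'o \<Rightarrow> bool"
  for C where
  zero: "zero_object C X \<Longrightarrow> semisimple_object C X"
| add: "semisimple_object C Y \<Longrightarrow> simple_object C S \<Longrightarrow> biproduct C X Y S \<Longrightarrow> semisimple_object C X"

definition projective_object :: "('k, 'o, 'm, 'z) lincat_scheme \<Rightarrow> 'o \<Rightarrow> bool" where
  "projective_object C P \<longleftrightarrow>
     (\<forall>X Y g f. epi_mor C X Y g \<and> f \<in> Hom C P Y \<longrightarrow> (\<exists>h\<in>Hom C P X. g \<cdot>\<^bsub>C\<^esub> h = f))"

definition projective_cover :: "('k, 'o, 'm, 'z) lincat_scheme \<Rightarrow> 'o \<Rightarrow> 'o \<Rightarrow> bool" where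
  "projective_cover C X P \<longleftrightarrow> projective_object C P \<and>
     (\<exists>p. epi_mor C P X p \<and>
        (\<forall>Q. \<forall>h\<in>Hom C Q P. epi_mor C Q X (p \<cdot>\<^bsub>C\<^esub> h) \<longrightarrow> epi_mor C Q P h))"

definition representative_simples ::
  "('k, 'o, 'm::ab_group_add, 'z) lincat_scheme \<Rightarrow> ('i \<Rightarrow> 'o) \<Rightarrow> bool" where
  "representative_simples C S \<longleftrightarrow>
     (\<forall>i. simple_object C (S i)) \<and>
     (\<forall>i j. isomorphic C (S i) (S j) \<longrightarrow> i = j) \<and>
     (\<forall>X. simple_object C X \<longrightarrow> (\<exists>i. isomorphic C X (S i)))"

locale locally_finite_category = abelian_category C
  for C :: "('k::field, 'o, 'm::ab_group_add, 'z) lincat_scheme" (structure) +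
  assumes finite_dim_Hom: "finite_dim (Scale C) (Hom C X Y)"
    and finite_length: "finite_length C X"

locale finite_category = locally_finite_category C
  for C :: "('k::field, 'o, 'm::ab_group_add, 'z) lincat_scheme" (structure) +
  assumes ex_projective_cover: "simple_object C X \<Longrightarrow> \<exists>P. projective_cover C X P"
    and finitely_many_simples:
      "\<exists>R. finite R \<and> (\<forall>X. simple_object C X \<longrightarrow> (\<exists>Y\<in>R. isomorphic C X Y))"


section \<open>Finite tensor categories\<close>

text \<open>\<open>Dual\<close>, \<open>Ev\<close>, \<open>Coev\<close> is a choice of left duals, with
  \<open>Ev X : X\<^sup>* \<otimes> X \<rightarrow> 1\<close> and \<open>Coev X : 1 \<rightarrow> X \<otimes> X\<^sup>*\<close>.\<close>

record ('k, 'o, 'm) tencat = "('k, 'o, 'm) lincat" +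
  Tens :: "'o \<Rightarrow> 'o \<Rightarrow> 'o" (infixr "\<otimes>\<^sub>o\<index>" 75)
  TensM :: "'m \<Rightarrow> 'm \<Rightarrow> 'm" (infixr "\<otimes>\<^sub>m\<index>" 75)
  Unit :: "'o"
  Assoc :: "'o \<Rightarrow> 'o \<Rightarrow> 'o \<Rightarrow> 'm"
  LUnit :: "'o \<Rightarrow> 'm"
  RUnit :: "'o \<Rightarrow> 'm"
  Dual :: "'o \<Rightarrow> 'o"
  Ev :: "'o \<Rightarrow> 'm"
  Coev :: "'o \<Rightarrow> 'm"

definition Assoc_inv :: "('k, 'o, 'm, 'z) tencat_scheme \<Rightarrow> 'o \<Rightarrow> 'o \<Rightarrow> 'o \<Rightarrow> 'm" where
  "Assoc_inv C X Y Z =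
     inv_mor C ((X \<otimes>\<^sub>o\<^bsub>C\<^esub> Y) \<otimes>\<^sub>o\<^bsub>C\<^esub> Z) (X \<otimes>\<^sub>o\<^bsub>C\<^esub> (Y \<otimes>\<^sub>o\<^bsub>C\<^esub> Z)) (Assoc C X Y Z)"

definition LUnit_inv :: "('k, 'o, 'm, 'z) tencat_scheme \<Rightarrow> 'o \<Rightarrow> 'm" where
  "LUnit_inv C X = inv_mor C (Unit C \<otimes>\<^sub>o\<^bsub>C\<^esub> X) X (LUnit C X)"

definition RUnit_inv :: "('k, 'o, 'm, 'z) tencat_scheme \<Rightarrow> 'o \<Rightarrow> 'm" where
  "RUnit_inv C X = inv_mor C (X \<otimes>\<^sub>o\<^bsub>C\<^esub> Unit C) X (RUnit C X)"

definition left_dual :: "('k, 'o, 'm, 'z) tencat_scheme \<Rightarrow> 'o \<Rightarrow> 'o \<Rightarrow> 'm \<Rightarrow> 'm \<Rightarrow> bool" where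
  "left_dual C X D e c \<longleftrightarrow>
     e \<in> Hom C (D \<otimes>\<^sub>o\<^bsub>C\<^esub> X) (Unit C) \<and> c \<in> Hom C (Unit C) (X \<otimes>\<^sub>o\<^bsub>C\<^esub> D) \<and>
     RUnit C X \<cdot>\<^bsub>C\<^esub> (Id C X \<otimes>\<^sub>m\<^bsub>C\<^esub> e) \<cdot>\<^bsub>C\<^esub> Assoc C X D X \<cdot>\<^bsub>C\<^esub> (c \<otimes>\<^sub>m\<^bsub>C\<^esub> Id C X) \<cdot>\<^bsub>C\<^esub> LUnit_inv C X = Id C X \<and>
     LUnit C D \<cdot>\<^bsub>C\<^esub> (e \<otimes>\<^sub>m\<^bsub>C\<^esub> Id C D) \<cdot>\<^bsub>C\<^esub> Assoc_inv C D X D \<cdot>\<^bsub>C\<^esub> (Id C D \<otimes>\<^sub>m\<^bsub>C\<^esub> c) \<cdot>\<^bsub>C\<^esub> RUnit_inv C D = Id C D"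

locale finite_tensor_category = finite_category C
  for C :: "('k::field, 'o, 'm::ab_group_add, 'z) tencat_scheme" (structure) +
  assumes TensM_in_Hom: "f \<in> Hom C X X' \<Longrightarrow> g \<in> Hom C Y Y' \<Longrightarrow>
        f \<otimes>\<^sub>m g \<in> Hom C (X \<otimes>\<^sub>o Y) (X' \<otimes>\<^sub>o Y')"
    and TensM_Id: "Id C X \<otimes>\<^sub>m Id C Y = Id C (X \<otimes>\<^sub>o Y)"
    and TensM_Comp: "f \<in> Hom C X X' \<Longrightarrow> f' \<in> Hom C X' X'' \<Longrightarrow> g \<in> Hom C Y Y' \<Longrightarrow> g' \<in> Hom C Y' Y'' \<Longrightarrow>
        (f' \<cdot> f) \<otimes>\<^sub>m (g' \<cdot> g) = (f' \<otimes>\<^sub>m g') \<cdot> (f \<otimes>\<^sub>m g)"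
    and TensM_add_left: "f \<in> Hom C X X' \<Longrightarrow> f' \<in> Hom C X X' \<Longrightarrow> g \<in> Hom C Y Y' \<Longrightarrow>
        (f + f') \<otimes>\<^sub>m g = f \<otimes>\<^sub>m g + f' \<otimes>\<^sub>m g"
    and TensM_add_right: "f \<in> Hom C X X' \<Longrightarrow> g \<in> Hom C Y Y' \<Longrightarrow> g' \<in> Hom C Y Y' \<Longrightarrow>
        f \<otimes>\<^sub>m (g + g') = f \<otimes>\<^sub>m g + f \<otimes>\<^sub>m g'"
    and TensM_scale_left: "f \<in> Hom C X X' \<Longrightarrow> g \<in> Hom C Y Y' \<Longrightarrow>
        Scale C c f \<otimes>\<^sub>m g = Scale C c (f \<otimes>\<^sub>m g)"
    and TensM_scale_right: "f \<in> Hom C X X' \<Longrightarrow> g \<in> Hom C Y Y' \<Longrightarrow>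
        f \<otimes>\<^sub>m Scale C c g = Scale C c (f \<otimes>\<^sub>m g)"
    and Assoc_iso: "iso_mor C ((X \<otimes>\<^sub>o Y) \<otimes>\<^sub>o Z) (X \<otimes>\<^sub>o (Y \<otimes>\<^sub>o Z)) (Assoc C X Y Z)"
    and Assoc_natural: "f \<in> Hom C X X' \<Longrightarrow> g \<in> Hom C Y Y' \<Longrightarrow> h \<in> Hom C Z Z' \<Longrightarrow>
        Assoc C X' Y' Z' \<cdot> ((f \<otimes>\<^sub>m g) \<otimes>\<^sub>m h) = (f \<otimes>\<^sub>m (g \<otimes>\<^sub>m h)) \<cdot> Assoc C X Y Z"
    and LUnit_iso: "iso_mor C (Unit C \<otimes>\<^sub>o X) X (LUnit C X)"
    and LUnit_natural: "f \<in> Hom C X Y \<Longrightarrow> LUnit C Y \<cdot> (Id C (Unit C) \<otimes>\<^sub>m f) = f \<cdot> LUnit C X"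
    and RUnit_iso: "iso_mor C (X \<otimes>\<^sub>o Unit C) X (RUnit C X)"
    and RUnit_natural: "f \<in> Hom C X Y \<Longrightarrow> RUnit C Y \<cdot> (f \<otimes>\<^sub>m Id C (Unit C)) = f \<cdot> RUnit C X"
    and pentagon: "(Id C W \<otimes>\<^sub>m Assoc C X Y Z) \<cdot> Assoc C W (X \<otimes>\<^sub>o Y) Z \<cdot> (Assoc C W X Y \<otimes>\<^sub>m Id C Z) =
        Assoc C W X (Y \<otimes>\<^sub>o Z) \<cdot> Assoc C (W \<otimes>\<^sub>o X) Y Z"
    and triangle: "(Id C X \<otimes>\<^sub>m LUnit C Y) \<cdot> Assoc C X (Unit C) Y = RUnit C X \<otimes>\<^sub>m Id C Y"
    and left_dual: "left_dual C X (Dual C X) (Ev C X) (Coev C X)"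
    and ex_right_dual: "\<exists>R e c. left_dual C R X e c"
    and End_Unit: "Id C (Unit C) \<noteq> 0" "Hom C (Unit C) (Unit C) = range (\<lambda>c. Scale C c (Id C (Unit C)))"


section \<open>Pivotal structures\<close>

text \<open>A pairing \<open>e : A \<otimes> Z \<rightarrow> 1\<close> corresponds to the morphism
  \<open>A \<rightarrow> A \<otimes> (Z \<otimes> Z\<^sup>*) \<rightarrow> (A \<otimes> Z) \<otimes> Z\<^sup>* \<rightarrow> Z\<^sup>*\<close>. Both the dual of a morphism and the isomorphism
  \<open>Y\<^sup>* \<otimes> X\<^sup>* \<rightarrow> (X \<otimes> Y)\<^sup>*\<close> are of this form.\<close>

definition mate :: "('k, 'o, 'm, 'z) tencat_scheme \<Rightarrow> 'o \<Rightarrow> 'o \<Rightarrow> 'm \<Rightarrow> 'm" where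
  "mate C A Z e =
     LUnit C (Dual C Z) \<cdot>\<^bsub>C\<^esub> (e \<otimes>\<^sub>m\<^bsub>C\<^esub> Id C (Dual C Z)) \<cdot>\<^bsub>C\<^esub> Assoc_inv C A Z (Dual C Z) \<cdot>\<^bsub>C\<^esub>
     (Id C A \<otimes>\<^sub>m\<^bsub>C\<^esub> Coev C Z) \<cdot>\<^bsub>C\<^esub> RUnit_inv C A"

definition dual_mor :: "('k, 'o, 'm, 'z) tencat_scheme \<Rightarrow> 'o \<Rightarrow> 'o \<Rightarrow> 'm \<Rightarrow> 'm" where
  "dual_mor C X Y f = mate C (Dual C Y) X (Ev C Y \<cdot>\<^bsub>C\<^esub> (Id C (Dual C Y) \<otimes>\<^sub>m\<^bsub>C\<^esub> f))"

definition Ev_tensor :: "('k, 'o, 'm, 'z) tencat_scheme \<Rightarrow> 'o \<Rightarrow> 'o \<Rightarrow> 'm" where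
  "Ev_tensor C X Y =
     Ev C Y \<cdot>\<^bsub>C\<^esub>
     (Id C (Dual C Y) \<otimes>\<^sub>m\<^bsub>C\<^esub>
        (LUnit C Y \<cdot>\<^bsub>C\<^esub> (Ev C X \<otimes>\<^sub>m\<^bsub>C\<^esub> Id C Y) \<cdot>\<^bsub>C\<^esub> Assoc_inv C (Dual C X) X Y)) \<cdot>\<^bsub>C\<^esub>
     Assoc C (Dual C Y) (Dual C X) (X \<otimes>\<^sub>o\<^bsub>C\<^esub> Y)"

definition dual_tensor :: "('k, 'o, 'm, 'z) tencat_scheme \<Rightarrow> 'o \<Rightarrow> 'o \<Rightarrow> 'm" where
  "dual_tensor C X Y = mate C (Dual C Y \<otimes>\<^sub>o\<^bsub>C\<^esub> Dual C X) (X \<otimes>\<^sub>o\<^bsub>C\<^esub> Y) (Ev_tensor C X Y)"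

text \<open>The tensor structure of the double dual functor is the composite of
  \<open>dual_tensor C (Dual C Y) (Dual C X) : X\<^sup>*\<^sup>* \<otimes> Y\<^sup>*\<^sup>* \<rightarrow> (Y\<^sup>* \<otimes> X\<^sup>*)\<^sup>*\<close> with the inverse of the dual
  of \<open>dual_tensor C X Y\<close>, which goes \<open>(X \<otimes> Y)\<^sup>*\<^sup>* \<rightarrow> (Y\<^sup>* \<otimes> X\<^sup>*)\<^sup>*\<close>. The last clause is compatibility
  of \<open>a\<close> with it, written without the inverse. Compatibility with the units is automatic for
  isomorphisms.\<close>

definition pivotal_structure ::
  "('k, 'o, 'm, 'z) tencat_scheme \<Rightarrow> ('o \<Rightarrow> 'm) \<Rightarrow> bool" where
  "pivotal_structure C a \<longleftrightarrow>
     (\<forall>X. iso_mor C X (Dual C (Dual C X)) (a X)) \<and>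
     (\<forall>X Y. \<forall>f\<in>Hom C X Y.
        a Y \<cdot>\<^bsub>C\<^esub> f = dual_mor C (Dual C Y) (Dual C X) (dual_mor C X Y f) \<cdot>\<^bsub>C\<^esub> a X) \<and>
     (\<forall>X Y. dual_mor C (Dual C Y \<otimes>\<^sub>o\<^bsub>C\<^esub> Dual C X) (Dual C (X \<otimes>\<^sub>o\<^bsub>C\<^esub> Y)) (dual_tensor C X Y)
              \<cdot>\<^bsub>C\<^esub> a (X \<otimes>\<^sub>o\<^bsub>C\<^esub> Y) =
            dual_tensor C (Dual C Y) (Dual C X) \<cdot>\<^bsub>C\<^esub> (a X \<otimes>\<^sub>m\<^bsub>C\<^esub> a Y))"


section \<open>Module categories\<close>

record ('k, 'u, 'n, 'o, 'm) modcat = "('k, 'u, 'n) lincat" +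
  Act :: "'o \<Rightarrow> 'u \<Rightarrow> 'u" (infixr "\<triangleright>\<^sub>o\<index>" 75)
  ActM :: "'m \<Rightarrow> 'n \<Rightarrow> 'n" (infixr "\<triangleright>\<^sub>m\<index>" 75)
  MAssoc :: "'o \<Rightarrow> 'o \<Rightarrow> 'u \<Rightarrow> 'n"
  MUnit :: "'u \<Rightarrow> 'n"

locale module_category = C: finite_tensor_category C + M: locally_finite_category M
  for C :: "('k::field, 'o, 'm::ab_group_add, 'z) tencat_scheme" (structure)
    and M :: "('k, 'u, 'n::ab_group_add, 'o, 'm, 'w) modcat_scheme" +
  assumes ActM_in_Hom: "f \<in> Hom C X Y \<Longrightarrow> g \<in> Hom M U V \<Longrightarrow>
        f \<triangleright>\<^sub>m\<^bsub>M\<^esub> g \<in> Hom M (X \<triangleright>\<^sub>o\<^bsub>M\<^esub> U) (Y \<triangleright>\<^sub>o\<^bsub>M\<^esub> V)"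
    and ActM_Id: "Id C X \<triangleright>\<^sub>m\<^bsub>M\<^esub> Id M U = Id M (X \<triangleright>\<^sub>o\<^bsub>M\<^esub> U)"
    and ActM_Comp: "f \<in> Hom C X Y \<Longrightarrow> f' \<in> Hom C Y Z \<Longrightarrow> g \<in> Hom M U V \<Longrightarrow> g' \<in> Hom M V W \<Longrightarrow>
        (f' \<cdot> f) \<triangleright>\<^sub>m\<^bsub>M\<^esub> (g' \<cdot>\<^bsub>M\<^esub> g) = (f' \<triangleright>\<^sub>m\<^bsub>M\<^esub> g') \<cdot>\<^bsub>M\<^esub> (f \<triangleright>\<^sub>m\<^bsub>M\<^esub> g)"
    and ActM_add_left: "f \<in> Hom C X Y \<Longrightarrow> f' \<in> Hom C X Y \<Longrightarrow> g \<in> Hom M U V \<Longrightarrow>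
        (f + f') \<triangleright>\<^sub>m\<^bsub>M\<^esub> g = f \<triangleright>\<^sub>m\<^bsub>M\<^esub> g + f' \<triangleright>\<^sub>m\<^bsub>M\<^esub> g"
    and ActM_add_right: "f \<in> Hom C X Y \<Longrightarrow> g \<in> Hom M U V \<Longrightarrow> g' \<in> Hom M U V \<Longrightarrow>
        f \<triangleright>\<^sub>m\<^bsub>M\<^esub> (g + g') = f \<triangleright>\<^sub>m\<^bsub>M\<^esub> g + f \<triangleright>\<^sub>m\<^bsub>M\<^esub> g'"
    and ActM_scale_left: "f \<in> Hom C X Y \<Longrightarrow> g \<in> Hom M U V \<Longrightarrow>
        Scale C c f \<triangleright>\<^sub>m\<^bsub>M\<^esub> g = Scale M c (f \<triangleright>\<^sub>m\<^bsub>M\<^esub> g)"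
    and ActM_scale_right: "f \<in> Hom C X Y \<Longrightarrow> g \<in> Hom M U V \<Longrightarrow>
        f \<triangleright>\<^sub>m\<^bsub>M\<^esub> Scale M c g = Scale M c (f \<triangleright>\<^sub>m\<^bsub>M\<^esub> g)"
    and Act_exact: "short_exact C X Y Z f f' \<Longrightarrow>
        short_exact M (X \<triangleright>\<^sub>o\<^bsub>M\<^esub> U) (Y \<triangleright>\<^sub>o\<^bsub>M\<^esub> U) (Z \<triangleright>\<^sub>o\<^bsub>M\<^esub> U) (f \<triangleright>\<^sub>m\<^bsub>M\<^esub> Id M U) (f' \<triangleright>\<^sub>m\<^bsub>M\<^esub> Id M U)"
    and MAssoc_iso: "iso_mor M ((X \<otimes>\<^sub>o Y) \<triangleright>\<^sub>o\<^bsub>M\<^esub> U) (X \<triangleright>\<^sub>o\<^bsub>M\<^esub> (Y \<triangleright>\<^sub>o\<^bsub>M\<^esub> U)) (MAssoc M X Y U)"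
    and MAssoc_natural: "f \<in> Hom C X X' \<Longrightarrow> f' \<in> Hom C Y Y' \<Longrightarrow> h \<in> Hom M U U' \<Longrightarrow>
        MAssoc M X' Y' U' \<cdot>\<^bsub>M\<^esub> ((f \<otimes>\<^sub>m f') \<triangleright>\<^sub>m\<^bsub>M\<^esub> h) = (f \<triangleright>\<^sub>m\<^bsub>M\<^esub> (f' \<triangleright>\<^sub>m\<^bsub>M\<^esub> h)) \<cdot>\<^bsub>M\<^esub> MAssoc M X Y U"
    and MUnit_iso: "iso_mor M (Unit C \<triangleright>\<^sub>o\<^bsub>M\<^esub> U) U (MUnit M U)"
    and MUnit_natural: "h \<in> Hom M U V \<Longrightarrow>
        MUnit M V \<cdot>\<^bsub>M\<^esub> (Id C (Unit C) \<triangleright>\<^sub>m\<^bsub>M\<^esub> h) = h \<cdot>\<^bsub>M\<^esub> MUnit M U"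
    and module_pentagon:
      "(Id C X \<triangleright>\<^sub>m\<^bsub>M\<^esub> MAssoc M Y Z U) \<cdot>\<^bsub>M\<^esub> MAssoc M X (Y \<otimes>\<^sub>o Z) U \<cdot>\<^bsub>M\<^esub> (Assoc C X Y Z \<triangleright>\<^sub>m\<^bsub>M\<^esub> Id M U) =
        MAssoc M X Y (Z \<triangleright>\<^sub>o\<^bsub>M\<^esub> U) \<cdot>\<^bsub>M\<^esub> MAssoc M (X \<otimes>\<^sub>o Y) Z U"
    and module_triangle:
      "(Id C X \<triangleright>\<^sub>m\<^bsub>M\<^esub> MUnit M U) \<cdot>\<^bsub>M\<^esub> MAssoc M X (Unit C) U = RUnit C X \<triangleright>\<^sub>m\<^bsub>M\<^esub> Id M U"

locale semisimple_module_category = module_category C M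
  for C :: "('k::field, 'o, 'm::ab_group_add, 'z) tencat_scheme"
    and M :: "('k, 'u, 'n::ab_group_add, 'o, 'm, 'w) modcat_scheme" +
  assumes semisimple: "semisimple_object M U"

text \<open>\<open>D\<^sub>1\<close> and \<open>D\<^sub>2\<close> are the objects of the two summands in a decomposition of \<open>M\<close> as a direct sum
  of module categories.\<close>

definition decomposes ::
  "('k, 'u, 'n::ab_group_add, 'o, 'm, 'w) modcat_scheme \<Rightarrow> 'u set \<Rightarrow> 'u set \<Rightarrow> bool" where
  "decomposes M D\<^sub>1 D\<^sub>2 \<longleftrightarrow>
     (\<forall>X. \<forall>U\<in>D\<^sub>1. X \<triangleright>\<^sub>o\<^bsub>M\<^esub> U \<in> D\<^sub>1) \<and>
     (\<forall>X. \<forall>U\<in>D\<^sub>2. X \<triangleright>\<^sub>o\<^bsub>M\<^esub> U \<in> D\<^sub>2) \<and>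
     (\<forall>U\<in>D\<^sub>1. \<forall>V\<in>D\<^sub>2. Hom M U V = {0} \<and> Hom M V U = {0}) \<and>
     (\<forall>W. \<exists>U\<in>D\<^sub>1. \<exists>V\<in>D\<^sub>2. biproduct M W U V)"

definition indecomposable :: "('k, 'u, 'n::ab_group_add, 'o, 'm, 'w) modcat_scheme \<Rightarrow> bool" where
  "indecomposable M \<longleftrightarrow>
     (\<exists>U. \<not> zero_object M U) \<and>
     (\<forall>D\<^sub>1 D\<^sub>2. decomposes M D\<^sub>1 D\<^sub>2 \<longrightarrow>
        (\<forall>U\<in>D\<^sub>1. zero_object M U) \<or> (\<forall>U\<in>D\<^sub>2. zero_object M U))"


section \<open>The weak Hopf algebra\<close>

text \<open>The bimodule \<open>F X\<close> is the direct sum over \<open>i, j\<close> of the spaces \<open>Hom (M\<^sub>j, X \<otimes> M\<^sub>i)\<close>; the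
  component of \<open>v\<close> in that summand is \<open>v i j\<close>. Here and below \<open>S\<close> is the family of the simple objects
  \<open>M\<^sub>i\<close>.\<close>

definition Fib :: "('k, 'u, 'n, 'o, 'm, 'w) modcat_scheme \<Rightarrow> ('i \<Rightarrow> 'u) \<Rightarrow> 'o \<Rightarrow> ('i \<Rightarrow> 'i \<Rightarrow> 'n) set" where
  "Fib M S X = {v. \<forall>i j. v i j \<in> Hom M (S j) (X \<triangleright>\<^sub>o\<^bsub>M\<^esub> S i)}"

definition Fib_map ::
  "('k, 'u, 'n, 'o, 'm, 'w) modcat_scheme \<Rightarrow> ('i \<Rightarrow> 'u) \<Rightarrow> 'm \<Rightarrow> ('i \<Rightarrow> 'i \<Rightarrow> 'n) \<Rightarrow> 'i \<Rightarrow> 'i \<Rightarrow> 'n" where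
  "Fib_map M S f v = (\<lambda>i j. (f \<triangleright>\<^sub>m\<^bsub>M\<^esub> Id M (S i)) \<cdot>\<^bsub>M\<^esub> v i j)"

definition Fib_scale ::
  "('k, 'u, 'n, 'o, 'm, 'w) modcat_scheme \<Rightarrow> 'k \<Rightarrow> ('i \<Rightarrow> 'i \<Rightarrow> 'n) \<Rightarrow> 'i \<Rightarrow> 'i \<Rightarrow> 'n" where
  "Fib_scale M c v = (\<lambda>i j. Scale M c (v i j))"

text \<open>An element of \<open>H\<close> is a natural family of endomorphisms of the vector spaces \<open>F X\<close>. To make the
  functions representing it unique they are set to \<open>0\<close> outside \<open>F X\<close>; with this convention \<open>H\<close> is a
  subspace of a function space, with pointwise operations. Only the algebra structure, the bases and
  the antipode of \<open>H\<close> are defined; the coproduct and counit are not used, since duality determines the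
  antipode.\<close>

type_synonym ('o, 'i, 'n) fib_end = "'o \<Rightarrow> ('i \<Rightarrow> 'i \<Rightarrow> 'n) \<Rightarrow> 'i \<Rightarrow> 'i \<Rightarrow> 'n"

definition H_carrier ::
  "('k::field, 'o, 'm, 'z) tencat_scheme \<Rightarrow> ('k, 'u, 'n::ab_group_add, 'o, 'm, 'w) modcat_scheme \<Rightarrow>
   ('i \<Rightarrow> 'u) \<Rightarrow> ('o, 'i, 'n) fib_end set" where
  "H_carrier C M S = {\<eta>.
     (\<forall>X. endo_on (Fib_scale M) (Fib M S X) (\<eta> X)) \<and>
     (\<forall>X v. v \<notin> Fib M S X \<longrightarrow> \<eta> X v = 0) \<and>
     (\<forall>X Y. \<forall>f\<in>Hom C X Y. \<forall>v\<in>Fib M S X. \<eta> Y (Fib_map M S f v) = Fib_map M S f (\<eta> X v))}"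

definition H_scale ::
  "('k, 'u, 'n, 'o, 'm, 'w) modcat_scheme \<Rightarrow> 'k \<Rightarrow> ('o, 'i, 'n) fib_end \<Rightarrow> ('o, 'i, 'n) fib_end" where
  "H_scale M c \<eta> = (\<lambda>X v. Fib_scale M c (\<eta> X v))"

definition H_mult :: "('o, 'i, 'n) fib_end \<Rightarrow> ('o, 'i, 'n) fib_end \<Rightarrow> ('o, 'i, 'n) fib_end"
    (infixl "\<star>" 70) where
  "\<eta> \<star> \<theta> = (\<lambda>X v. \<eta> X (\<theta> X v))"

definition H_one ::
  "('k, 'u, 'n::ab_group_add, 'o, 'm, 'w) modcat_scheme \<Rightarrow> ('i \<Rightarrow> 'u) \<Rightarrow> ('o, 'i, 'n) fib_end" where
  "H_one M S = (\<lambda>X v. if v \<in> Fib M S X then v else 0)"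

definition H_is_inverse ::
  "('k::field, 'o, 'm, 'z) tencat_scheme \<Rightarrow> ('k, 'u, 'n::ab_group_add, 'o, 'm, 'w) modcat_scheme \<Rightarrow>
   ('i \<Rightarrow> 'u) \<Rightarrow> ('o, 'i, 'n) fib_end \<Rightarrow> ('o, 'i, 'n) fib_end \<Rightarrow> bool" where
  "H_is_inverse C M S x y \<longleftrightarrow> x \<in> H_carrier C M S \<and> y \<in> H_carrier C M S \<and>
     x \<star> y = H_one M S \<and> y \<star> x = H_one M S"

definition H_invertible ::
  "('k::field, 'o, 'm, 'z) tencat_scheme \<Rightarrow> ('k, 'u, 'n::ab_group_add, 'o, 'm, 'w) modcat_scheme \<Rightarrow>
   ('i \<Rightarrow> 'u) \<Rightarrow> ('o, 'i, 'n) fib_end \<Rightarrow> bool" where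
  "H_invertible C M S x \<longleftrightarrow> (\<exists>y. H_is_inverse C M S x y)"

definition H_inv ::
  "('k::field, 'o, 'm, 'z) tencat_scheme \<Rightarrow> ('k, 'u, 'n::ab_group_add, 'o, 'm, 'w) modcat_scheme \<Rightarrow>
   ('i \<Rightarrow> 'u) \<Rightarrow> ('o, 'i, 'n) fib_end \<Rightarrow> ('o, 'i, 'n) fib_end" where
  "H_inv C M S x = (THE y. H_is_inverse C M S x y)"

text \<open>The action of \<open>A\<close> on \<open>F X\<close> through the index \<open>j\<close> embeds \<open>A\<close> in \<open>H\<close> with image \<open>A\<^sub>s\<close>. The
  primitive idempotent \<open>e\<^sub>j\<close> is the image of the indicator function of \<open>j\<close>, and \<open>t i\<close> is the
  projection of \<open>source_elem M S t\<close> to the \<open>i\<close>-th summand of \<open>A\<close>.\<close>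

definition source_elem ::
  "('k, 'u, 'n::ab_group_add, 'o, 'm, 'w) modcat_scheme \<Rightarrow> ('i \<Rightarrow> 'u) \<Rightarrow> ('i \<Rightarrow> 'k) \<Rightarrow> ('o, 'i, 'n) fib_end" where
  "source_elem M S t =
     (\<lambda>X v. if v \<in> Fib M S X then (\<lambda>i j. Scale M (t j) (v i j)) else 0)"

text \<open>Evaluation on \<open>F (X\<^sup>*) \<otimes>\<^sub>A F X = F (X\<^sup>* \<otimes> X) \<rightarrow> F 1 = A\<close>, followed by the Frobenius form
  \<open>A \<rightarrow> k\<close>, \<open>e\<^sub>i \<mapsto> 1\<close>, dual to the separability idempotent \<open>\<Sum>\<^sub>i e\<^sub>i \<otimes> e\<^sub>i\<close>. This identifies \<open>F (X\<^sup>*)\<close>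
  with the dual space of \<open>F X\<close>. The component \<open>\<phi> i j : M\<^sub>j \<rightarrow> X\<^sup>* \<otimes> M\<^sub>i\<close> is paired with
  \<open>v j i : M\<^sub>i \<rightarrow> X \<otimes> M\<^sub>j\<close>.\<close>

definition contract ::
  "('k, 'o, 'm, 'z) tencat_scheme \<Rightarrow> ('k, 'u, 'n, 'o, 'm, 'w) modcat_scheme \<Rightarrow> ('i \<Rightarrow> 'u) \<Rightarrow> 'o \<Rightarrow>
   'i \<Rightarrow> 'n \<Rightarrow> 'n \<Rightarrow> 'n" where
  "contract C M S X j p q =
     MUnit M (S j) \<cdot>\<^bsub>M\<^esub> (Ev C X \<triangleright>\<^sub>m\<^bsub>M\<^esub> Id M (S j)) \<cdot>\<^bsub>M\<^esub>
     inv_mor M ((Dual C X \<otimes>\<^sub>o\<^bsub>C\<^esub> X) \<triangleright>\<^sub>o\<^bsub>M\<^esub> S j) (Dual C X \<triangleright>\<^sub>o\<^bsub>M\<^esub> (X \<triangleright>\<^sub>o\<^bsub>M\<^esub> S j)) (MAssoc M (Dual C X) X (S j)) \<cdot>\<^bsub>M\<^esub>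
     (Id C (Dual C X) \<triangleright>\<^sub>m\<^bsub>M\<^esub> q) \<cdot>\<^bsub>M\<^esub> p"

definition Fib_pairing ::
  "('k::field, 'o, 'm, 'z) tencat_scheme \<Rightarrow> ('k, 'u, 'n, 'o, 'm, 'w) modcat_scheme \<Rightarrow> ('i::finite \<Rightarrow> 'u) \<Rightarrow>
   'o \<Rightarrow> ('i \<Rightarrow> 'i \<Rightarrow> 'n) \<Rightarrow> ('i \<Rightarrow> 'i \<Rightarrow> 'n) \<Rightarrow> 'k" where
  "Fib_pairing C M S X \<phi> v = (\<Sum>i\<in>UNIV. \<Sum>j\<in>UNIV.
     (THE c. contract C M S X j (\<phi> i j) (v j i) = Scale M c (Id M (S j))))"

text \<open>The antipode is determined by the action on the dual representation, \<open>\<langle>\<eta> \<phi>, v\<rangle> = \<langle>\<phi>, S(\<eta>) v\<rangle>\<close>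
  for \<open>\<phi> \<in> F (X\<^sup>*) = (F X)\<^sup>*\<close>.\<close>

definition antipode ::
  "('k::field, 'o, 'm, 'z) tencat_scheme \<Rightarrow> ('k, 'u, 'n::ab_group_add, 'o, 'm, 'w) modcat_scheme \<Rightarrow>
   ('i::finite \<Rightarrow> 'u) \<Rightarrow> ('o, 'i, 'n) fib_end \<Rightarrow> ('o, 'i, 'n) fib_end" where
  "antipode C M S \<eta> = (\<lambda>X v. if v \<in> Fib M S X
     then (THE u. u \<in> Fib M S X \<and> (\<forall>\<phi>\<in>Fib M S (Dual C X).
        Fib_pairing C M S X \<phi> u = Fib_pairing C M S X (\<eta> (Dual C X) \<phi>) v))
     else 0)"

text \<open>The canonical isomorphism \<open>F (X\<^sup>*\<^sup>*) \<cong> F (X)\<^sup>*\<^sup>* \<cong> F X\<close>.\<close>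

definition double_dual_iso ::
  "('k::field, 'o, 'm, 'z) tencat_scheme \<Rightarrow> ('k, 'u, 'n, 'o, 'm, 'w) modcat_scheme \<Rightarrow>
   ('i::finite \<Rightarrow> 'u) \<Rightarrow> 'o \<Rightarrow> ('i \<Rightarrow> 'i \<Rightarrow> 'n) \<Rightarrow> 'i \<Rightarrow> 'i \<Rightarrow> 'n" where
  "double_dual_iso C M S X w = (THE u. u \<in> Fib M S X \<and> (\<forall>\<phi>\<in>Fib M S (Dual C X).
     Fib_pairing C M S X \<phi> u = Fib_pairing C M S (Dual C X) w \<phi>))"

definition pivotal_element ::
  "('k::field, 'o, 'm, 'z) tencat_scheme \<Rightarrow> ('k, 'u, 'n::ab_group_add, 'o, 'm, 'w) modcat_scheme \<Rightarrow>
   ('i::finite \<Rightarrow> 'u) \<Rightarrow> ('o \<Rightarrow> 'm) \<Rightarrow> ('o, 'i, 'n) fib_end" where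
  "pivotal_element C M S a = (\<lambda>X v. if v \<in> Fib M S X
     then double_dual_iso C M S X (Fib_map M S (a X) v) else 0)"


section \<open>Matched pivotal structures\<close>

text \<open>\<open>c\<close> is the module functor structure \<open>X \<otimes> U \<rightarrow> X\<^sup>*\<^sup>* \<otimes> U = X \<otimes> U\<close> of \<open>\<chi>(a, M)\<close> on the identity
  functor. The identification \<open>X\<^sup>*\<^sup>* \<otimes> U = X \<otimes> U\<close> comes from the double dual of bimodules, so on
  \<open>Hom (M\<^sub>j, X \<otimes> M\<^sub>i)\<close> composition with \<open>c\<close> is the map \<open>F X \<rightarrow> F (X\<^sup>*\<^sup>*) \<cong> F X\<close>; naturality in \<open>U\<close> then
  determines \<open>c\<close> on all objects.\<close>

definition chi_structure ::
  "('k::field, 'o, 'm, 'z) tencat_scheme \<Rightarrow> ('k, 'u, 'n::ab_group_add, 'o, 'm, 'w) modcat_scheme \<Rightarrow>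
   ('i::finite \<Rightarrow> 'u) \<Rightarrow> ('o \<Rightarrow> 'm) \<Rightarrow> ('o \<Rightarrow> 'u \<Rightarrow> 'n) \<Rightarrow> bool" where
  "chi_structure C M S a c \<longleftrightarrow>
     (\<forall>X U. c X U \<in> Hom M (X \<triangleright>\<^sub>o\<^bsub>M\<^esub> U) (X \<triangleright>\<^sub>o\<^bsub>M\<^esub> U)) \<and>
     (\<forall>X U V. \<forall>h\<in>Hom M U V. c X V \<cdot>\<^bsub>M\<^esub> (Id C X \<triangleright>\<^sub>m\<^bsub>M\<^esub> h) = (Id C X \<triangleright>\<^sub>m\<^bsub>M\<^esub> h) \<cdot>\<^bsub>M\<^esub> c X U) \<and>
     (\<forall>X. \<forall>v\<in>Fib M S X.
        (\<lambda>i j. c X (S i) \<cdot>\<^bsub>M\<^esub> v i j) = double_dual_iso C M S X (Fib_map M S (a X) v))"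

text \<open>An isomorphism from the identity functor with the trivial module structure, which is the unit
  object of \<open>Fun\<^sub>C (M, M)\<close>, to the identity functor with module structure \<open>c\<close>.\<close>

definition iso_to_unit_module_functor ::
  "('k, 'o, 'm, 'z) tencat_scheme \<Rightarrow> ('k, 'u, 'n, 'o, 'm, 'w) modcat_scheme \<Rightarrow>
   ('o \<Rightarrow> 'u \<Rightarrow> 'n) \<Rightarrow> ('u \<Rightarrow> 'n) \<Rightarrow> bool" where
  "iso_to_unit_module_functor C M c \<theta> \<longleftrightarrow>
     (\<forall>U. iso_mor M U U (\<theta> U)) \<and>
     (\<forall>U V. \<forall>h\<in>Hom M U V. \<theta> V \<cdot>\<^bsub>M\<^esub> h = h \<cdot>\<^bsub>M\<^esub> \<theta> U) \<and>
     (\<forall>X U. c X U \<cdot>\<^bsub>M\<^esub> \<theta> (X \<triangleright>\<^sub>o\<^bsub>M\<^esub> U) = Id C X \<triangleright>\<^sub>m\<^bsub>M\<^esub> \<theta> U)"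

definition matched ::
  "('k::field, 'o, 'm, 'z) tencat_scheme \<Rightarrow> ('k, 'u, 'n::ab_group_add, 'o, 'm, 'w) modcat_scheme \<Rightarrow>
   ('i::finite \<Rightarrow> 'u) \<Rightarrow> ('o \<Rightarrow> 'm) \<Rightarrow> bool" where
  "matched C M S a \<longleftrightarrow> (\<exists>c \<theta>. chi_structure C M S a c \<and> iso_to_unit_module_functor C M c \<theta>)"

text \<open>\<open>y \<in> A\<^sub>s\<close>, given by its coordinates \<open>t\<close>, is invertible and \<open>g\<^sub>a = y S(y)\<^sup>-\<^sup>1\<close>.\<close>

definition pivotal_factor ::
  "('k::field, 'o, 'm, 'z) tencat_scheme \<Rightarrow> ('k, 'u, 'n::ab_group_add, 'o, 'm, 'w) modcat_scheme \<Rightarrow>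
   ('i::finite \<Rightarrow> 'u) \<Rightarrow> ('o \<Rightarrow> 'm) \<Rightarrow> ('i \<Rightarrow> 'k) \<Rightarrow> bool" where
  "pivotal_factor C M S a t \<longleftrightarrow>
     H_invertible C M S (source_elem M S t) \<and>
     pivotal_element C M S a =
       source_elem M S t \<star> H_inv C M S (antipode C M S (source_elem M S t))"

definition cartan_matrix ::
  "('k::field, 'o, 'm::ab_group_add, 'z) lincat_scheme \<Rightarrow> ('j \<Rightarrow> 'o) \<Rightarrow> 'j \<Rightarrow> 'j \<Rightarrow> nat" where
  "cartan_matrix C P q r = hom_dim C (P q) (P r)"

text \<open>\<open>fusion_coeff M R S r i j\<close> is \<open>N\<^sub>r\<^sub>i\<^sup>j\<close>, the dimension of \<open>Hom (X\<^sub>r \<otimes> M\<^sub>i, M\<^sub>j)\<close>.\<close>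

definition fusion_coeff ::
  "('k::field, 'u, 'n::ab_group_add, 'o, 'm, 'w) modcat_scheme \<Rightarrow> ('j \<Rightarrow> 'o) \<Rightarrow> ('i \<Rightarrow> 'u) \<Rightarrow>
   'j \<Rightarrow> 'i \<Rightarrow> 'i \<Rightarrow> nat" where
  "fusion_coeff M R S r i j = hom_dim M (R r \<triangleright>\<^sub>o\<^bsub>M\<^esub> S i) (S j)"

end

theory Submission
  imports Defs
begin

text \<open>Why the theorem holds.

  \<^emph>\<open>The square of the antipode.\<close> The antipode is the adjoint for the pairing of \<open>F (X\<^sup>*)\<close> with \<open>F X\<close>, so
  \<open>S\<^sup>2\<close> moves \<open>\<eta>\<close> across this pairing twice, from \<open>X\<close> to \<open>X\<^sup>*\<^sup>*\<close>: if \<open>D : F (X\<^sup>*\<^sup>*) \<rightarrow> F X\<close> is the canonical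
  isomorphism, then \<open>S\<^sup>2(\<eta>)\<^sub>X D = D \<eta>\<close>, where \<open>\<eta>\<close> on the right acts on \<open>F (X\<^sup>*\<^sup>*)\<close>
  (\<open>antipode_square_double_dual\<close>). Naturality of \<open>\<eta>\<close> along \<open>a\<^sub>X\<close> turns this into
  \<open>S\<^sup>2(\<eta>) g = g \<eta>\<close> for \<open>g = D F(a)\<close> (\<open>antipode_square_pivotal\<close>). The pairing is perfect for two
  reasons: rigidity identifies \<open>Hom (M\<^sub>i, X \<otimes> M\<^sub>j)\<close> with \<open>Hom (X\<^sup>* \<otimes> M\<^sub>i, M\<^sub>j)\<close>
  (\<open>ev_transpose_coev_transpose\<close> and its converse), and in a semisimple category composition pairs
  \<open>Hom (U, M\<^sub>j)\<close> perfectly with \<open>Hom (M\<^sub>j, U)\<close> (\<open>functional_represented\<close>,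
  \<open>semisimple_nondegenerate\<close>).

  \<^emph>\<open>The pivotal element.\<close> An isomorphism from the unit module functor to \<open>\<chi>(a, M)\<close> is given by a nonzero
  scalar \<open>\<theta>\<^sub>i\<close> for each simple object \<open>M\<^sub>i\<close>, and compatibility with the module structures says that
  \<open>g\<close> acts on \<open>Hom (M\<^sub>j, X \<otimes> M\<^sub>i)\<close> as \<open>\<theta>\<^sub>i / \<theta>\<^sub>j\<close> (\<open>matched_pivotal_element\<close>). An element \<open>y\<close> of \<open>A\<^sub>s\<close>
  with coordinates \<open>m\<close> acts there as \<open>m\<^sub>j\<close>, and \<open>S(y)\<close> as \<open>m\<^sub>i\<close>, so \<open>m = 1 / \<theta>\<close> solves
  \<open>g = y S(y)\<^sup>-\<^sup>1\<close>, and any solution makes \<open>g\<close> act as \<open>m\<^sub>j / m\<^sub>i\<close>.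

  \<^emph>\<open>Eigenvalues and multiplicities.\<close> Write \<open>F\<^sub>i\<^sub>j X\<close> for \<open>Hom (M\<^sub>j, X \<otimes> M\<^sub>i)\<close>. Conjugation by \<open>g\<close> multiplies
  a natural transformation \<open>F\<^sub>l\<^sub>k \<rightarrow> F\<^sub>i\<^sub>j\<close> by \<open>(m\<^sub>j / m\<^sub>i) (m\<^sub>l / m\<^sub>k)\<close>, so it remains to count these. The functor
  \<open>F\<^sub>i\<^sub>j\<close> is exact and sends \<open>X\<^sub>q\<close> to a space of dimension \<open>N\<^sub>q\<^sub>i\<^sup>j\<close>; lifting a basis of that space to the
  projective cover \<open>P\<^sub>q\<close> gives a natural map from the sum of \<open>N\<^sub>q\<^sub>i\<^sup>j\<close> copies of \<open>Hom (P\<^sub>q, -)\<close>, over all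
  \<open>q\<close>, to \<open>F\<^sub>i\<^sub>j\<close>. It is bijective on simple objects, hence on all objects by the five lemma
  (\<open>ex_generators\<close>). By the Yoneda lemma the transformations \<open>F\<^sub>l\<^sub>k \<rightarrow> F\<^sub>i\<^sub>j\<close> are the sum over \<open>r\<close> of \<open>N\<^sub>r\<^sub>l\<^sup>k\<close>
  copies of \<open>F\<^sub>i\<^sub>j P\<^sub>r\<close>, whose dimension is \<open>\<Sum>\<^sub>q N\<^sub>q\<^sub>i\<^sup>j C\<^sub>q\<^sub>r\<close> by the same isomorphism at \<open>P\<^sub>r\<close>. The resulting
  basis of \<open>H\<close> (\<open>elementary_basis\<close>) consists of eigenvectors of \<open>S\<^sup>2\<close>.\<close>

section \<open>Characteristic polynomials from eigenbases\<close>

text \<open>Bases are indexed families: the characteristic polynomial of an operator with an eigenbasis is then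
  a product over the index set, in which multiplicities can be counted.\<close>

definition family_basis ::
  "('k::field \<Rightarrow> 'v::ab_group_add \<Rightarrow> 'v) \<Rightarrow> 'v set \<Rightarrow> 'x set \<Rightarrow> ('x \<Rightarrow> 'v) \<Rightarrow> bool" where
  "family_basis sc V I e \<longleftrightarrow> finite I \<and> e ` I \<subseteq> V \<and>
     (\<forall>v\<in>V. \<exists>\<alpha>. v = (\<Sum>x\<in>I. sc (\<alpha> x) (e x))) \<and>
     (\<forall>\<alpha>. (\<Sum>x\<in>I. sc (\<alpha> x) (e x)) = 0 \<longrightarrow> (\<forall>x\<in>I. \<alpha> x = 0))"

lemma family_basis_mem: "family_basis sc V I e \<Longrightarrow> x \<in> I \<Longrightarrow> e x \<in> V"
  and family_basis_expand: "family_basis sc V I e \<Longrightarrow> v \<in> V \<Longrightarrow> \<exists>\<alpha>. v = (\<Sum>x\<in>I. sc (\<alpha> x) (e x))"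
  and family_basis_unique:
    "family_basis sc V I e \<Longrightarrow> (\<Sum>x\<in>I. sc (\<alpha> x) (e x)) = 0 \<Longrightarrow> x \<in> I \<Longrightarrow> \<alpha> x = 0"
  by (simp_all add: family_basis_def image_subset_iff)

context vector_space
begin

lemma family_basis_inj_on:
  assumes "family_basis scale V I e"
  shows "inj_on e I"
proof (rule inj_onI, rule ccontr)
  fix x y assume xy: "x \<in> I" "y \<in> I" "e x = e y" "x \<noteq> y"
  let ?\<alpha> = "\<lambda>z. if z = x then 1 else if z = y then -1 else (0::'a)"
  have fin: "finite I" using assms by (simp add: family_basis_def)
  have "(\<Sum>z\<in>I. scale (?\<alpha> z) (e z)) = (\<Sum>z\<in>{x,y}. scale (?\<alpha> z) (e z))"
    by (rule sum.mono_neutral_right) (use fin xy in auto)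
  also have "\<dots> = 0" using xy by simp
  finally have "?\<alpha> x = 0" by (rule family_basis_unique[OF assms]) (rule xy(1))
  then show False by simp
qed

lemma family_basis_independent:
  assumes "family_basis scale V I e"
  shows "independent (e ` I)"
proof -
  have fin: "finite I" using assms by (simp add: family_basis_def)
  have inj: "inj_on e I" by (rule family_basis_inj_on[OF assms])
  show ?thesis
  proof
    assume "dependent (e ` I)"
    then obtain u v where u: "v \<in> e ` I" "u v \<noteq> 0" "(\<Sum>w\<in>e ` I. scale (u w) w) = 0"
      using dependent_finite[of "e ` I"] fin by auto
    then have "(\<Sum>x\<in>I. scale (u (e x)) (e x)) = 0"
      by (simp add: sum.reindex[OF inj])
    then have "u (e x) = 0" if "x \<in> I" for x
      by (rule family_basis_unique[OF assms _ that, where \<alpha> = "u \<circ> e", unfolded o_def])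
    then show False using u by auto
  qed
qed

lemma family_basis_span:
  assumes "family_basis scale V I e" "subspace V"
  shows "span (e ` I) = V"
proof
  show "span (e ` I) \<subseteq> V"
    using assms by (intro span_minimal) (auto simp: family_basis_def)
  show "V \<subseteq> span (e ` I)"
  proof
    fix v assume "v \<in> V"
    then obtain \<alpha> where "v = (\<Sum>x\<in>I. scale (\<alpha> x) (e x))"
      using family_basis_expand[OF assms(1)] by blast
    then show "v \<in> span (e ` I)"
      by (simp add: span_sum span_scale span_base)
  qed
qed

lemma family_basis_dim:
  assumes "family_basis scale V I e" "subspace V"
  shows "dim V = card I"
  using dim_eq_card[of "e ` I" V] family_basis_span[OF assms] family_basis_independent[OF assms(1)]
    card_image[OF family_basis_inj_on[OF assms(1)]] assms(2)
  by (metis span_eq_iff)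

lemma independent_imp_family_basis:
  assumes "finite I" "inj_on e I" "independent (e ` I)" "span (e ` I) = V"
  shows "family_basis scale V I e"
  unfolding family_basis_def
proof (intro conjI ballI allI impI)
  show "e ` I \<subseteq> V" using assms(4) span_superset by blast
  fix v assume "v \<in> V"
  then obtain u where "v = (\<Sum>w\<in>e ` I. scale (u w) w)"
    using assms(4) span_finite[of "e ` I"] assms(1) by auto
  then show "\<exists>\<alpha>. v = (\<Sum>x\<in>I. scale (\<alpha> x) (e x))"
    by (intro exI[of _ "u \<circ> e"]) (simp add: sum.reindex[OF assms(2)])
next
  fix \<alpha> x assume eq: "(\<Sum>x\<in>I. scale (\<alpha> x) (e x)) = 0" and x: "x \<in> I"
  have "(\<Sum>w\<in>e ` I. scale (\<alpha> (the_inv_into I e w)) w) = 0"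
    using eq by (simp add: sum.reindex[OF assms(2)] the_inv_into_f_f[OF assms(2)])
  then have "\<alpha> (the_inv_into I e (e x)) = 0"
    by (intro independentD[OF assms(3) _ subset_refl, where u = "\<lambda>w. \<alpha> (the_inv_into I e w)"])
      (use assms(1) x in auto)
  then show "\<alpha> x = 0" using x by (simp add: the_inv_into_f_f[OF assms(2)])
qed (use assms in auto)

lemma finite_dim_family_basis:
  assumes "subspace V" "finite_dim scale V"
  shows "\<exists>h. family_basis scale V {..<dim V} h"
proof -
  obtain B where B: "B \<subseteq> V" "independent B" "V \<subseteq> span B" "card B = dim V"
    by (rule basis_exists)
  obtain F where F: "finite F" "V \<subseteq> span F" using assms(2) unfolding finite_dim_def by blast
  have fin: "finite B"
    using independent_span_bound[OF F(1) B(2)] B(1) F(2) by auto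
  obtain h where h: "bij_betw h {..<card B} B"
    using ex_bij_betw_nat_finite[OF fin] by (auto simp: atLeast0LessThan)
  have im: "h ` {..<card B} = B" and inj: "inj_on h {..<card B}"
    using h by (auto simp: bij_betw_def)
  have "span B = V"
    using B(1,3) assms(1) by (metis span_minimal subset_antisym)
  then have "family_basis scale V {..<card B} h"
    by (intro independent_imp_family_basis) (use im inj B in auto)
  then show ?thesis using B(4) by auto
qed

lemma family_basis_finite_dim:
  assumes "family_basis scale V I e"
  shows "finite_dim scale V"
  unfolding finite_dim_def
proof (intro exI conjI)
  show "finite (e ` I)" using assms by (auto simp: family_basis_def)
  show "V \<subseteq> span (e ` I)"
  proof
    fix v assume "v \<in> V"
    then obtain \<alpha> where "v = (\<Sum>x\<in>I. scale (\<alpha> x) (e x))"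
      using family_basis_expand[OF assms(1)] by blast
    then show "v \<in> span (e ` I)"
      by (simp add: span_sum span_scale span_base)
  qed
qed

text \<open>A coordinate function for a basis that extends \<open>h\<close> and a basis of \<open>W\<close>.\<close>

lemma separating_functional:
  assumes "subspace W" "h \<notin> W"
  shows "\<exists>\<phi>. (\<forall>x y. \<phi> (x + y) = \<phi> x + \<phi> y) \<and> (\<forall>c x. \<phi> (scale c x) = c * \<phi> x) \<and>
    (\<forall>w\<in>W. \<phi> w = 0) \<and> \<phi> h = 1"
proof -
  obtain B where B: "B \<subseteq> W" "independent B" "W \<subseteq> span B" "card B = dim W"
    by (rule basis_exists)
  have spanB: "span B = W"
    using span_minimal[OF B(1) assms(1)] B(3) by (rule subset_antisym)
  have ind: "independent (insert h B)"
    using independent_insertI[OF _ B(2)] assms(2) spanB by simp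
  define E where "E = extend_basis (insert h B)"
  have E: "independent E" "span E = UNIV" "insert h B \<subseteq> E"
    unfolding E_def
    by (rule independent_extend_basis[OF ind], rule span_extend_basis[OF ind],
        rule extend_basis_superset[OF ind])
  define \<phi> where "\<phi> = (\<lambda>x. representation E x h)"
  have "\<phi> w = 0" if "w \<in> W" for w
  proof -
    have "representation E w = representation B w"
      using E spanB that by (intro representation_extend) simp_all
    moreover have "representation B w h = 0"
      using representation_ne_zero[of B w h] assms(2) B(1) by blast
    ultimately show ?thesis by (simp add: \<phi>_def)
  qed
  moreover have "\<phi> h = 1" using representation_basis[OF E(1)] E(3) by (simp add: \<phi>_def)
  moreover have "\<phi> (x + y) = \<phi> x + \<phi> y" "\<phi> (scale c x) = c * \<phi> x" for x y c
    using E(1,2) by (simp_all add: \<phi>_def representation_add representation_scale)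
  ultimately show ?thesis by blast
qed

end

lemma endo_on_sum:
  assumes "vector_space sc" "Modules.module.subspace sc V" "endo_on sc V T" "finite I" "\<And>x. x \<in> I \<Longrightarrow> e x \<in> V"
  shows "T (\<Sum>x\<in>I. sc (\<alpha> x) (e x)) = (\<Sum>x\<in>I. sc (\<alpha> x) (T (e x)))"
proof -
  interpret vector_space sc by fact
  have 0: "T 0 = 0"
  proof -
    have "T (sc 0 0) = sc 0 (T 0)"
      using assms(2,3) subspace_0 unfolding endo_on_def by blast
    then show ?thesis by simp
  qed
  show ?thesis using assms(4,5)
  proof (induction I rule: finite_induct)
    case (insert x I)
    have "sc (\<alpha> x) (e x) \<in> V" "(\<Sum>x\<in>I. sc (\<alpha> x) (e x)) \<in> V" "e x \<in> V"
      using insert assms(2) by (auto intro!: subspace_sum subspace_scale)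
    then show ?case using insert assms(3) by (simp add: endo_on_def)
  qed (simp add: 0)
qed

text \<open>The matrix of \<open>T\<close> has an eigenvalue because the field is algebraically closed, and its eigenvector
  is the coordinate vector of an eigenvector of \<open>T\<close>.\<close>

lemma endo_on_has_eigenvector:
  fixes sc :: "'k::alg_closed_field \<Rightarrow> 'v::ab_group_add \<Rightarrow> 'v"
  assumes vs: "vector_space sc" and sub: "Modules.module.subspace sc V" and fd: "finite_dim sc V"
    and T: "endo_on sc V T" and w: "w \<in> V" "w \<noteq> 0"
  shows "\<exists>c. \<exists>v\<in>V. v \<noteq> 0 \<and> T v = sc c v"
proof -
  interpret vector_space sc by fact
  let ?n = "dim V"
  obtain h where h: "family_basis sc V {..<?n} h" using finite_dim_family_basis[OF sub fd] by blast
  have hV: "h s \<in> V" if "s < ?n" for s using h that by (auto simp: family_basis_def)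
  have n: "?n > 0"
  proof (rule ccontr)
    assume "\<not> ?n > 0"
    then have "\<forall>v\<in>V. v = 0" using h by (simp add: family_basis_def)
    then show False using w by blast
  qed
  have "T (h c) \<in> V" if "c < ?n" for c using T hV[OF that] by (simp add: endo_on_def)
  then have "\<forall>c. \<exists>\<alpha>. c < ?n \<longrightarrow> T (h c) = (\<Sum>r<?n. sc (\<alpha> r) (h r))"
    using family_basis_expand[OF h] by blast
  then obtain a where a: "\<And>c. c < ?n \<Longrightarrow> T (h c) = (\<Sum>r<?n. sc (a c r) (h r))" by metis
  define A where "A = mat ?n ?n (\<lambda>(r, c). a c r)"
  have A: "A \<in> carrier_mat ?n ?n" by (simp add: A_def)
  have "degree (char_poly A) = ?n" using degree_monic_char_poly[OF A] by simp
  then obtain c where "poly (char_poly A) c = 0"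
    using n alg_closed_imp_poly_has_root[of "char_poly A"] by auto
  then have "eigenvalue A c" using eigenvalue_root_char_poly[OF A] by simp
  then obtain x where x: "x \<in> carrier_vec ?n" "x \<noteq> 0\<^sub>v ?n" "A *\<^sub>v x = c \<cdot>\<^sub>v x"
    using A unfolding eigenvalue_def eigenvector_def by auto
  let ?v = "\<Sum>s<?n. sc (x $ s) (h s)"
  have "?v \<in> V" using hV sub by (intro subspace_sum subspace_scale) auto
  moreover have "?v \<noteq> 0"
  proof
    assume "?v = 0"
    then have "\<forall>s<?n. x $ s = 0" using family_basis_unique[OF h, where \<alpha> = "\<lambda>s. x $ s"] by simp
    then have "x = 0\<^sub>v ?n" using x(1) by (intro eq_vecI) auto
    then show False using x(2) by simp
  qed
  moreover have "T ?v = sc c ?v"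
  proof -
    have "T ?v = (\<Sum>s<?n. sc (x $ s) (T (h s)))"
      by (rule endo_on_sum[OF vs sub T]) (use hV in auto)
    also have "\<dots> = (\<Sum>s<?n. \<Sum>r<?n. sc (x $ s * a s r) (h r))"
      by (intro sum.cong refl) (simp add: a scale_sum_right)
    also have "\<dots> = (\<Sum>r<?n. \<Sum>s<?n. sc (x $ s * a s r) (h r))" by (rule sum.swap)
    also have "\<dots> = (\<Sum>r<?n. sc (\<Sum>s<?n. x $ s * a s r) (h r))" by (simp add: scale_sum_left)
    also have "\<dots> = (\<Sum>r<?n. sc (c * x $ r) (h r))"
    proof (intro sum.cong refl)
      fix r assume r: "r \<in> {..<?n}"
      have "(A *\<^sub>v x) $ r = (\<Sum>s<?n. x $ s * a s r)"
        using r x(1) by (simp add: A_def scalar_prod_def atLeast0LessThan mult.commute)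
      then show "sc (\<Sum>s<?n. x $ s * a s r) (h r) = sc (c * x $ r) (h r)"
        using x(1,3) r by simp
    qed
    also have "\<dots> = sc c ?v" by (simp add: scale_sum_right)
    finally show ?thesis .
  qed
  ultimately show ?thesis by blast
qed

text \<open>For any basis \<open>bs\<close>, the matrix that expresses the eigenvectors in \<open>bs\<close> conjugates the matrix of \<open>T\<close>
  to a diagonal one.\<close>

lemma has_char_poly_eigenbasis:
  assumes vs: "vector_space sc" and sub: "Modules.module.subspace sc V"
    and T: "endo_on sc V T" and e: "family_basis sc V I e"
    and eig: "\<And>x. x \<in> I \<Longrightarrow> T (e x) = sc (l x) (e x)"
  shows "has_char_poly sc V T (\<Prod>x\<in>I. [:- l x, 1:])"
  unfolding has_char_poly_def
proof (intro conjI allI impI)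
  interpret vector_space sc by fact
  show "finite_dim sc V" by (rule family_basis_finite_dim[OF e])
  fix bs assume bs: "ordered_basis sc V bs"
  let ?n = "length bs" and ?B = "set bs"
  have ind: "independent ?B" and span: "span ?B = V" and dist: "distinct bs"
    using bs by (auto simp: ordered_basis_def)
  have "?n = dim V"
    using dim_eq_card[of ?B V] ind span dist sub by (metis span_eq_iff distinct_card)
  then have card: "card I = ?n" using family_basis_dim[OF e sub] by simp
  have finI: "finite I" using e by (simp add: family_basis_def)
  obtain g where g: "bij_betw g {..<?n} I"
    using ex_bij_betw_nat_finite[OF finI] card by (auto simp: atLeast0LessThan)
  have gI: "g c \<in> I" if "c < ?n" for c using g that by (auto simp: bij_betw_def)
  have eV: "e (g c) \<in> V" if "c < ?n" for c using e gI[OF that] by (auto simp: family_basis_def)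
  have bV: "bs ! c \<in> V" if "c < ?n" for c
    using that span span_superset nth_mem by blast
  let ?rep = "\<lambda>v r. representation ?B v (bs ! r)"
  have nth: "bij_betw ((!) bs) {..<?n} ?B" using dist by (simp add: bij_betw_nth)
  have expand: "v = (\<Sum>r<?n. sc (?rep v r) (bs ! r))" if "v \<in> V" for v
  proof -
    have "v = (\<Sum>b\<in>?B. sc (representation ?B v b) b)"
      using sum_representation_eq[OF ind, of v ?B] that span by simp
    also have "\<dots> = (\<Sum>r<?n. sc (?rep v r) (bs ! r))"
      using sum.reindex_bij_betw[OF nth, of "\<lambda>b. sc (representation ?B v b) b"] by simp
    finally show ?thesis .
  qed
  have rep_sum: "?rep (\<Sum>s<?n. sc (\<alpha> s) (f s)) r = (\<Sum>s<?n. \<alpha> s * ?rep (f s) r)"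
    if "\<And>s. s < ?n \<Longrightarrow> f s \<in> V" for \<alpha> f r
  proof -
    have "representation ?B (\<Sum>s<?n. sc (\<alpha> s) (f s)) (bs ! r)
        = (\<Sum>s<?n. representation ?B (sc (\<alpha> s) (f s)) (bs ! r))"
      using that sub span by (subst representation_sum[OF ind]) (auto intro!: subspace_scale)
    also have "\<dots> = (\<Sum>s<?n. \<alpha> s * ?rep (f s) r)"
      by (intro sum.cong refl) (use that span ind in \<open>simp add: representation_scale\<close>)
    finally show ?thesis .
  qed
  have "\<forall>c. \<exists>\<alpha>. c < ?n \<longrightarrow> bs ! c = (\<Sum>s<?n. sc (\<alpha> s) (e (g s)))"
  proof (intro allI)
    fix c
    show "\<exists>\<alpha>. c < ?n \<longrightarrow> bs ! c = (\<Sum>s<?n. sc (\<alpha> s) (e (g s)))"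
    proof (cases "c < ?n")
      case True
      then obtain \<alpha> where "bs ! c = (\<Sum>x\<in>I. sc (\<alpha> x) (e x))"
        using family_basis_expand[OF e] bV by blast
      also have "\<dots> = (\<Sum>s<?n. sc (\<alpha> (g s)) (e (g s)))"
        using sum.reindex_bij_betw[OF g, of "\<lambda>x. sc (\<alpha> x) (e x)"] by simp
      finally show ?thesis by (intro exI[of _ "\<alpha> \<circ> g"]) simp
    qed auto
  qed
  then obtain q where q: "\<And>c. c < ?n \<Longrightarrow> bs ! c = (\<Sum>s<?n. sc (q c s) (e (g s)))" by metis
  let ?A = "matrix_on sc bs T"
  let ?P = "mat ?n ?n (\<lambda>(r, c). ?rep (e (g c)) r)"
  let ?Q = "mat ?n ?n (\<lambda>(r, c). q c r)"
  let ?D = "mat ?n ?n (\<lambda>(r, c). if r = c then l (g c) else 0)"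
  have carr: "?A \<in> carrier_mat ?n ?n" "?P \<in> carrier_mat ?n ?n" "?Q \<in> carrier_mat ?n ?n"
    "?D \<in> carrier_mat ?n ?n" by (auto simp: matrix_on_def)
  have PQ: "?P * ?Q = 1\<^sub>m ?n"
  proof (rule eq_matI)
    fix r c assume "r < dim_row (1\<^sub>m ?n :: 'a mat)" "c < dim_col (1\<^sub>m ?n :: 'a mat)"
    then have rc: "r < ?n" "c < ?n" by auto
    have "(?P * ?Q) $$ (r, c) = (\<Sum>s<?n. q c s * ?rep (e (g s)) r)"
      using rc by (simp add: scalar_prod_def atLeast0LessThan mult.commute)
    also have "\<dots> = ?rep (bs ! c) r" using rep_sum[of "\<lambda>s. e (g s)" "q c" r] eV q rc by simp
    also have "\<dots> = 1\<^sub>m ?n $$ (r, c)"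
      using rc dist by (simp add: representation_basis[OF ind] nth_eq_iff_index_eq eq_commute)
    finally show "(?P * ?Q) $$ (r, c) = 1\<^sub>m ?n $$ (r, c)" .
  qed auto
  have AP: "?A * ?P = ?P * ?D"
  proof (rule eq_matI)
    fix r c assume "r < dim_row (?P * ?D)" "c < dim_col (?P * ?D)"
    then have rc: "r < ?n" "c < ?n" by auto
    have TV: "T (bs ! s) \<in> V" if "s < ?n" for s using T bV that by (auto simp: endo_on_def)
    have "(?A * ?P) $$ (r, c) = (\<Sum>s<?n. ?rep (e (g c)) s * ?rep (T (bs ! s)) r)"
      using rc by (simp add: matrix_on_def scalar_prod_def atLeast0LessThan mult.commute)
    also have "\<dots> = ?rep (\<Sum>s<?n. sc (?rep (e (g c)) s) (T (bs ! s))) r"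
      using TV by (simp add: rep_sum)
    also have "(\<Sum>s<?n. sc (?rep (e (g c)) s) (T (bs ! s))) = T (\<Sum>s<?n. sc (?rep (e (g c)) s) (bs ! s))"
      using bV by (intro endo_on_sum[OF vs sub T, symmetric]) auto
    also have "\<dots> = sc (l (g c)) (e (g c))"
      using expand[OF eV[OF rc(2)]] eig[OF gI[OF rc(2)]] by simp
    also have "?rep (sc (l (g c)) (e (g c))) r = l (g c) * ?rep (e (g c)) r"
      using eV rc span ind by (simp add: representation_scale)
    also have "\<dots> = (?P * ?D) $$ (r, c)"
      using rc by (simp add: scalar_prod_def if_distrib[of "\<lambda>x. _ * x"] sum.delta cong: if_cong)
    finally show "(?A * ?P) $$ (r, c) = (?P * ?D) $$ (r, c)" .
  qed (auto simp: matrix_on_def)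
  have QP: "?Q * ?P = 1\<^sub>m ?n" by (rule mat_mult_left_right_inverse[OF carr(2,3) PQ])
  have "?A = ?A * (?P * ?Q)" by (simp only: PQ right_mult_one_mat[OF carr(1)])
  also have "\<dots> = ?P * ?D * ?Q" by (simp only: AP assoc_mult_mat[OF carr(1,2,3), symmetric])
  finally have "?A = ?P * ?D * ?Q" .
  then have "similar_mat_wit ?A ?D ?P ?Q"
    by (intro similar_mat_witI[OF PQ QP _ carr(1,4,2,3)])
  then have "similar_mat ?A ?D" unfolding similar_mat_def by blast
  then have "char_poly ?A = char_poly ?D" by (rule char_poly_similar)
  also have "\<dots> = (\<Prod>a\<leftarrow>diag_mat ?D. [:- a, 1:])"
    by (rule char_poly_upper_triangular[OF carr(4)]) auto
  also have "diag_mat ?D = map (\<lambda>c. l (g c)) [0..<?n]"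
    unfolding diag_mat_def by (simp cong: map_cong)
  also have "(\<Prod>a\<leftarrow>map (\<lambda>c. l (g c)) [0..<?n]. [:- a, 1:]) = (\<Prod>c<?n. [:- l (g c), 1:])"
    using prod.distinct_set_conv_list[of "[0..<?n]" "\<lambda>c. [:- l (g c), 1:]"]
    by (simp add: o_def atLeast0LessThan)
  also have "\<dots> = (\<Prod>x\<in>I. [:- l x, 1:])"
    using prod.reindex_bij_betw[OF g, of "\<lambda>x. [:- l x, 1:]"] by simp
  finally show "char_poly ?A = (\<Prod>x\<in>I. [:- l x, 1:])" .
qed (use assms in auto)

section \<open>Simple and semisimple objects\<close>

sublocale linear_category \<subseteq> V: vector_space "Scale C"
  by (rule vector_space_Scale)

context linear_category
begin

lemma Hom_zero: "0 \<in> Hom C X Y"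
  and Hom_add: "f \<in> Hom C X Y \<Longrightarrow> g \<in> Hom C X Y \<Longrightarrow> f + g \<in> Hom C X Y"
  and Hom_diff: "f \<in> Hom C X Y \<Longrightarrow> g \<in> Hom C X Y \<Longrightarrow> f - g \<in> Hom C X Y"
  and Hom_scale: "f \<in> Hom C X Y \<Longrightarrow> Scale C c f \<in> Hom C X Y"
  and Hom_sum: "(\<And>x. x \<in> I \<Longrightarrow> F x \<in> Hom C X Y) \<Longrightarrow> sum F I \<in> Hom C X Y"
  using subspace_Hom[of X Y]
  by (simp_all add: V.subspace_0 V.subspace_add V.subspace_diff V.subspace_scale V.subspace_sum)

lemma Comp_zero_left: "f \<in> Hom C X Y \<Longrightarrow> 0 \<cdot> f = 0"
  using Comp_scale_left[of f X Y 0 Y 0] Hom_zero by simp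

lemma Comp_zero_right: "g \<in> Hom C Y Z \<Longrightarrow> g \<cdot> 0 = 0"
  using Comp_scale_right[of 0 Y Y g Z 0] Hom_zero by simp

lemma Comp_diff_left:
  assumes "f \<in> Hom C X Y" "g \<in> Hom C Y Z" "g' \<in> Hom C Y Z"
  shows "(g - g') \<cdot> f = g \<cdot> f - g' \<cdot> f"
  using Comp_add_left[OF assms(1) Hom_diff[OF assms(2,3)] assms(3)] by (simp add: eq_diff_eq)

lemma Comp_diff_right:
  assumes "f \<in> Hom C X Y" "f' \<in> Hom C X Y" "g \<in> Hom C Y Z"
  shows "g \<cdot> (f - f') = g \<cdot> f - g \<cdot> f'"
  using Comp_add_right[OF Hom_diff[OF assms(1,2)] assms(2,3)] by (simp add: eq_diff_eq)

lemma Comp_sum_left: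
  assumes "f \<in> Hom C X Y" "\<And>x. x \<in> I \<Longrightarrow> G x \<in> Hom C Y Z"
  shows "sum G I \<cdot> f = (\<Sum>x\<in>I. G x \<cdot> f)"
proof (cases "finite I")
  case True
  then show ?thesis using assms(2)
    by (induction I rule: finite_induct)
      (simp_all add: Comp_zero_left[OF assms(1)] Comp_add_left[OF assms(1), where Z = Z] Hom_sum)
qed (simp add: Comp_zero_left[OF assms(1)])

lemma Comp_sum_right:
  assumes "\<And>x. x \<in> I \<Longrightarrow> F x \<in> Hom C X Y" "g \<in> Hom C Y Z"
  shows "g \<cdot> sum F I = (\<Sum>x\<in>I. g \<cdot> F x)"
proof (cases "finite I")
  case True
  then show ?thesis using assms(1)
    by (induction I rule: finite_induct)
      (simp_all add: Comp_zero_right[OF assms(2)] Comp_add_right[OF _ _ assms(2), where X = X] Hom_sum)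
qed (simp add: Comp_zero_right[OF assms(2)])

lemma inv_mor:
  assumes "iso_mor C X Y f"
  shows "inv_mor C X Y f \<in> Hom C Y X" "inv_mor C X Y f \<cdot> f = Id C X" "f \<cdot> inv_mor C X Y f = Id C Y"
proof -
  obtain g where f: "f \<in> Hom C X Y" and g: "g \<in> Hom C Y X" "g \<cdot> f = Id C X" "f \<cdot> g = Id C Y"
    using assms unfolding iso_mor_def by blast
  have "h = g" if h: "h \<in> Hom C Y X" "h \<cdot> f = Id C X" for h
  proof -
    have "h = h \<cdot> (f \<cdot> g)" using Comp_Id_right[OF h(1)] g(3) by simp
    also have "\<dots> = g" using Comp_assoc[OF g(1) f h(1)] h(2) Comp_Id_left[OF g(1)] by simp
    finally show ?thesis .
  qed
  with g have "inv_mor C X Y f = g" unfolding inv_mor_def by (intro the_equality conjI) blast+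
  then show "inv_mor C X Y f \<in> Hom C Y X" "inv_mor C X Y f \<cdot> f = Id C X" "f \<cdot> inv_mor C X Y f = Id C Y"
    using g by auto
qed

lemma iso_mor_in_Hom: "iso_mor C X Y f \<Longrightarrow> f \<in> Hom C X Y"
  by (simp add: iso_mor_def)

lemma iso_mor_cancel_left:
  assumes "iso_mor C X Y f" "g \<in> Hom C W X" "f \<cdot> g = 0"
  shows "g = 0"
proof -
  have "g = (inv_mor C X Y f \<cdot> f) \<cdot> g"
    using inv_mor[OF assms(1)] Comp_Id_left[OF assms(2)] by simp
  also have "\<dots> = 0"
    using Comp_assoc[OF assms(2) iso_mor_in_Hom[OF assms(1)] inv_mor(1)[OF assms(1)]] assms(3)
      Comp_zero_right[OF inv_mor(1)[OF assms(1)]] by simp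
  finally show ?thesis .
qed

lemma iso_mor_cancel_right:
  assumes "iso_mor C X Y f" "g \<in> Hom C Y Z" "g \<cdot> f = 0"
  shows "g = 0"
proof -
  have "g = g \<cdot> (f \<cdot> inv_mor C X Y f)"
    using inv_mor[OF assms(1)] Comp_Id_right[OF assms(2)] by simp
  also have "\<dots> = 0"
    using Comp_assoc[OF inv_mor(1)[OF assms(1)] iso_mor_in_Hom[OF assms(1)] assms(2)] assms(3)
      Comp_zero_left[OF inv_mor(1)[OF assms(1)]] by simp
  finally show ?thesis .
qed

lemma Id_eq_zero_imp_zero:
  assumes "Id C X = 0"
  shows "f \<in> Hom C X Y \<Longrightarrow> f = 0" "f \<in> Hom C Y X \<Longrightarrow> f = 0"
  using Comp_Id_right[of f X Y] Comp_zero_right[of f X Y] Comp_Id_left[of f Y X] Comp_zero_left[of f Y X]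
    assms by auto

lemma simple_object_Id_nonzero:
  assumes "simple_object C X"
  shows "Id C X \<noteq> 0"
proof
  assume "Id C X = 0"
  then have "zero_object C X"
    unfolding zero_object_def using Id_eq_zero_imp_zero Hom_zero by blast
  then show False using assms by (simp add: simple_object_def)
qed

lemma mono_morI:
  assumes f: "f \<in> Hom C X Y" and "\<And>W g. g \<in> Hom C W X \<Longrightarrow> f \<cdot> g = 0 \<Longrightarrow> g = 0"
  shows "mono_mor C X Y f"
  unfolding mono_mor_def
proof (intro conjI allI ballI impI f)
  fix W g h assume gh: "g \<in> Hom C W X" "h \<in> Hom C W X" "f \<cdot> g = f \<cdot> h"
  then have "f \<cdot> (g - h) = 0" using Comp_diff_right[OF gh(1,2) f] by simp
  then have "g - h = 0" by (rule assms(2)[OF Hom_diff[OF gh(1,2)]])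
  then show "g = h" by simp
qed

lemma epi_morI:
  assumes f: "f \<in> Hom C X Y" and "\<And>W g. g \<in> Hom C Y W \<Longrightarrow> g \<cdot> f = 0 \<Longrightarrow> g = 0"
  shows "epi_mor C X Y f"
  unfolding epi_mor_def
proof (intro conjI allI ballI impI f)
  fix W g h assume gh: "g \<in> Hom C Y W" "h \<in> Hom C Y W" "g \<cdot> f = h \<cdot> f"
  then have "(g - h) \<cdot> f = 0" using Comp_diff_left[OF f gh(1,2)] by simp
  then have "g - h = 0" by (rule assms(2)[OF Hom_diff[OF gh(1,2)]])
  then show "g = h" by simp
qed

lemma epi_mor_cancel: "epi_mor C X Y f \<Longrightarrow> g \<in> Hom C Y W \<Longrightarrow> g \<cdot> f = 0 \<Longrightarrow> g = 0"
  using Hom_zero Comp_zero_left unfolding epi_mor_def by metis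

lemma is_kernel_factor:
  "is_kernel C X Y f K k \<Longrightarrow> h \<in> Hom C W X \<Longrightarrow> f \<cdot> h = 0 \<Longrightarrow> \<exists>u\<in>Hom C W K. k \<cdot> u = h"
  unfolding is_kernel_def by blast

lemma is_cokernel_factor:
  "is_cokernel C X Y f Q q \<Longrightarrow> h \<in> Hom C Y W \<Longrightarrow> h \<cdot> f = 0 \<Longrightarrow> \<exists>u\<in>Hom C Q W. u \<cdot> q = h"
  unfolding is_cokernel_def by blast

lemma is_kernel_mono:
  assumes "is_kernel C X Y f K k" "f \<in> Hom C X Y"
  shows "mono_mor C K X k"
proof (rule mono_morI)
  show k: "k \<in> Hom C K X" using assms(1) by (simp add: is_kernel_def)
  fix W g assume g: "g \<in> Hom C W K" "k \<cdot> g = 0"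
  have "f \<cdot> 0 = 0" by (rule Comp_zero_right[OF assms(2)])
  then have "\<exists>!u. u \<in> Hom C W K \<and> k \<cdot> u = 0"
    using assms(1) Hom_zero unfolding is_kernel_def by blast
  then show "g = 0" using g Hom_zero[of W K] Comp_zero_right[OF k] by blast
qed

lemma is_cokernel_epi:
  assumes "is_cokernel C X Y f Q q" "f \<in> Hom C X Y"
  shows "epi_mor C Y Q q"
proof (rule epi_morI)
  show q: "q \<in> Hom C Y Q" using assms(1) by (simp add: is_cokernel_def)
  fix W g assume g: "g \<in> Hom C Q W" "g \<cdot> q = 0"
  have "0 \<cdot> f = 0" by (rule Comp_zero_left[OF assms(2)])
  then have "\<exists>!u. u \<in> Hom C Q W \<and> u \<cdot> q = 0"
    using assms(1) Hom_zero unfolding is_cokernel_def by blast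
  then show "g = 0" using g Hom_zero[of Q W] Comp_zero_left[OF q] by blast
qed

end

context abelian_category
begin

text \<open>Schur's lemma comes from two halves, about kernels and about images, that are also needed when the
  other object is not simple.\<close>

lemma nonzero_from_simple_mono:
  assumes "simple_object C X" "f \<in> Hom C X Y" "f \<noteq> 0"
  shows "mono_mor C X Y f"
proof -
  obtain K k where k: "is_kernel C X Y f K k" using ex_kernel[OF assms(2)] by blast
  have kH: "k \<in> Hom C K X" "f \<cdot> k = 0" using k by (auto simp: is_kernel_def)
  have "\<not> iso_mor C K X k" using iso_mor_cancel_right[OF _ assms(2) kH(2)] assms(3) by blast
  then have k0: "k = 0"
    using assms(1) is_kernel_mono[OF k assms(2)] by (auto simp: simple_object_def)
  show ?thesis
  proof (rule mono_morI[OF assms(2)])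
    fix W g assume g: "g \<in> Hom C W X" "f \<cdot> g = 0"
    then obtain u where "u \<in> Hom C W K" "k \<cdot> u = g" using is_kernel_factor[OF k] by blast
    then show "g = 0" using k0 Comp_zero_left by blast
  qed
qed

lemma nonzero_to_simple_epi:
  assumes "simple_object C Y" "f \<in> Hom C X Y" "f \<noteq> 0"
  shows "epi_mor C X Y f"
proof -
  obtain Q q where q: "is_cokernel C X Y f Q q" using ex_cokernel[OF assms(2)] by blast
  have qH: "q \<in> Hom C Y Q" "q \<cdot> f = 0" using q by (auto simp: is_cokernel_def)
  obtain K k where k: "is_kernel C Y Q q K k" using ex_kernel[OF qH(1)] by blast
  have kH: "k \<in> Hom C K Y" "q \<cdot> k = 0" using k by (auto simp: is_kernel_def)
  obtain u where u: "u \<in> Hom C X K" "k \<cdot> u = f" using is_kernel_factor[OF k assms(2) qH(2)] by blast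
  have "k \<noteq> 0" using u assms(3) Comp_zero_left[OF u(1)] by auto
  then have "iso_mor C K Y k"
    using assms(1) is_kernel_mono[OF k qH(1)] by (auto simp: simple_object_def)
  then have q0: "q = 0" using iso_mor_cancel_right[OF _ qH(1) kH(2)] by blast
  show ?thesis
  proof (rule epi_morI[OF assms(2)])
    fix W g assume g: "g \<in> Hom C Y W" "g \<cdot> f = 0"
    then obtain v where "v \<in> Hom C Q W" "v \<cdot> q = g" using is_cokernel_factor[OF q] by blast
    then show "g = 0" using q0 Comp_zero_right by blast
  qed
qed

lemma nonzero_between_simples_iso:
  assumes "simple_object C X" "simple_object C Y" "f \<in> Hom C X Y" "f \<noteq> 0"
  shows "iso_mor C X Y f"
  using assms(2,4) nonzero_from_simple_mono[OF assms(1,3,4)] by (auto simp: simple_object_def)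

end


definition absolutely_simple :: "('k::field, 'o, 'm::ab_group_add, 'z) lincat_scheme \<Rightarrow> 'o \<Rightarrow> bool" where
  "absolutely_simple C X \<longleftrightarrow> simple_object C X \<and> (\<forall>f\<in>Hom C X X. \<exists>c. f = Scale C c (Id C X))"

lemma absolutely_simple_imp_simple: "absolutely_simple C X \<Longrightarrow> simple_object C X"
  by (simp add: absolutely_simple_def)

text \<open>Composition with an endomorphism \<open>f\<close> of a simple object is a linear map of a finite-dimensional
  space, so it has an eigenvector \<open>h\<close>; by Schur's lemma \<open>h\<close> is invertible, and \<open>f\<close> is its eigenvalue.\<close>

lemma simple_imp_absolutely_simple:
  fixes C :: "('k::alg_closed_field, 'o, 'm::ab_group_add, 'z) lincat_scheme" (structure)
  assumes "locally_finite_category C" and X: "simple_object C X"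
  shows "absolutely_simple C X"
  unfolding absolutely_simple_def
proof (intro conjI ballI X)
  interpret locally_finite_category C by fact
  fix f assume f: "f \<in> Hom C X X"
  have "endo_on (Scale C) (Hom C X X) (\<lambda>h. f \<cdot> h)"
    unfolding endo_on_def using Comp_in_Hom[OF _ f] Comp_add_right[OF _ _ f] Comp_scale_right[OF _ f]
    by blast
  then obtain c h where h: "h \<in> Hom C X X" "h \<noteq> 0" "f \<cdot> h = Scale C c h"
    using endo_on_has_eigenvector[OF vector_space_Scale subspace_Hom finite_dim_Hom _ Id_in_Hom
        simple_object_Id_nonzero[OF X]] by blast
  have iso: "iso_mor C X X h" by (rule nonzero_between_simples_iso[OF X X h(1,2)])
  have cI: "Scale C c (Id C X) \<in> Hom C X X" by (rule Hom_scale[OF Id_in_Hom])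
  have "(f - Scale C c (Id C X)) \<cdot> h = 0"
    using Comp_diff_left[OF h(1) f cI] Comp_scale_left[OF h(1) Id_in_Hom] Comp_Id_left[OF h(1)] h(3)
    by simp
  then have "f - Scale C c (Id C X) = 0"
    by (rule iso_mor_cancel_right[OF iso Hom_diff[OF f cI]])
  then show "\<exists>c. f = Scale C c (Id C X)" by (intro exI[of _ c]) simp
qed

text \<open>A decomposition of the \<open>T\<close>-isotypic part of \<open>U\<close>: the inclusions \<open>b s\<close> and projections \<open>b' s\<close> of
  its summands. The last two clauses say that the other summands of \<open>U\<close> are invisible to \<open>T\<close>.\<close>

definition isotypic_decomposition ::
  "('k::field, 'o, 'm::ab_group_add, 'z) lincat_scheme \<Rightarrow> 'o \<Rightarrow> 'o \<Rightarrow> nat \<Rightarrow> (nat \<Rightarrow> 'm) \<Rightarrow> (nat \<Rightarrow> 'm) \<Rightarrow> bool" where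
  "isotypic_decomposition C T U n b b' \<longleftrightarrow>
     (\<forall>s<n. b s \<in> Hom C T U \<and> b' s \<in> Hom C U T) \<and>
     (\<forall>s<n. \<forall>t<n. b' s \<cdot>\<^bsub>C\<^esub> b t = (if s = t then Id C T else 0)) \<and>
     (\<forall>q\<in>Hom C T U. q = (\<Sum>s<n. b s \<cdot>\<^bsub>C\<^esub> (b' s \<cdot>\<^bsub>C\<^esub> q))) \<and>
     (\<forall>p\<in>Hom C U T. p = (\<Sum>s<n. (p \<cdot>\<^bsub>C\<^esub> b s) \<cdot>\<^bsub>C\<^esub> b' s))"

context abelian_category
begin

text \<open>By Schur's lemma a new simple summand \<open>S\<close> of \<open>U\<close> either is isomorphic to \<open>T\<close>, and contributes one
  inclusion and one projection, or has no nonzero morphism from or to \<open>T\<close>.\<close>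

lemma semisimple_isotypic_decomposition:
  assumes "semisimple_object C U" and T: "simple_object C T"
  shows "\<exists>n b b'. isotypic_decomposition C T U n b b'"
  using assms(1)
proof induction
  case (zero X)
  then show ?case
    by (intro exI[of _ 0]) (auto simp: isotypic_decomposition_def zero_object_def)
next
  case (add Y S X)
  obtain n b b' where d: "isotypic_decomposition C T Y n b b'" using add.IH by blast
  have b: "b s \<in> Hom C T Y" "b' s \<in> Hom C Y T" if "s < n" for s
    using d that by (auto simp: isotypic_decomposition_def)
  have bb: "b' s \<cdot> b t = (if s = t then Id C T else 0)" if "s < n" "t < n" for s t
    using d that by (simp add: isotypic_decomposition_def)
  have dq: "q = (\<Sum>s<n. b s \<cdot> (b' s \<cdot> q))" if "q \<in> Hom C T Y" for q
    using d that by (simp add: isotypic_decomposition_def)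
  have dp: "p = (\<Sum>s<n. (p \<cdot> b s) \<cdot> b' s)" if "p \<in> Hom C Y T" for p
    using d that by (simp add: isotypic_decomposition_def)
  obtain i j p q where i: "i \<in> Hom C Y X" and j: "j \<in> Hom C S X" and p: "p \<in> Hom C X Y" and q: "q \<in> Hom C X S"
    and e: "p \<cdot> i = Id C Y" "q \<cdot> j = Id C S" "p \<cdot> j = 0" "q \<cdot> i = 0" "i \<cdot> p + j \<cdot> q = Id C X"
    using add.hyps(3) unfolding biproduct_def by blast
  note ty = i j p q
  have split_in: "h = i \<cdot> (p \<cdot> h) + j \<cdot> (q \<cdot> h)" if h: "h \<in> Hom C T X" for h
    using Comp_add_left[OF h Comp_in_Hom[OF p i] Comp_in_Hom[OF q j]] Comp_Id_left[OF h] e(5)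
      Comp_assoc[OF h p i] Comp_assoc[OF h q j] by simp
  have split_out: "h = (h \<cdot> i) \<cdot> p + (h \<cdot> j) \<cdot> q" if h: "h \<in> Hom C X T" for h
    using Comp_add_right[OF Comp_in_Hom[OF p i] Comp_in_Hom[OF q j] h] Comp_Id_right[OF h] e(5)
      Comp_assoc[OF p i h] Comp_assoc[OF q j h] by simp
  have part_in: "i \<cdot> (p \<cdot> h) = (\<Sum>s<n. (i \<cdot> b s) \<cdot> ((b' s \<cdot> p) \<cdot> h))" if h: "h \<in> Hom C T X" for h
  proof -
    note ph = Comp_in_Hom[OF h p]
    have "i \<cdot> (p \<cdot> h) = i \<cdot> (\<Sum>s<n. b s \<cdot> (b' s \<cdot> (p \<cdot> h)))" using dq[OF ph] by simp
    also have "\<dots> = (\<Sum>s<n. i \<cdot> (b s \<cdot> (b' s \<cdot> (p \<cdot> h))))"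
      by (rule Comp_sum_right[OF _ i, where X = T]) (use Comp_in_Hom[OF Comp_in_Hom[OF ph b(2)] b(1)] in auto)
    also have "\<dots> = (\<Sum>s<n. (i \<cdot> b s) \<cdot> ((b' s \<cdot> p) \<cdot> h))"
    proof (intro sum.cong refl)
      fix s assume "s \<in> {..<n}"
      then have s: "s < n" by simp
      show "i \<cdot> (b s \<cdot> (b' s \<cdot> (p \<cdot> h))) = (i \<cdot> b s) \<cdot> ((b' s \<cdot> p) \<cdot> h)"
        using Comp_assoc[OF h p b(2)[OF s]] Comp_assoc[OF Comp_in_Hom[OF ph b(2)[OF s]] b(1)[OF s] i]
        by simp
    qed
    finally show ?thesis .
  qed
  have part_out: "(h \<cdot> i) \<cdot> p = (\<Sum>s<n. (h \<cdot> (i \<cdot> b s)) \<cdot> (b' s \<cdot> p))" if h: "h \<in> Hom C X T" for h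
  proof -
    note hi = Comp_in_Hom[OF i h]
    have "(h \<cdot> i) \<cdot> p = (\<Sum>s<n. ((h \<cdot> i) \<cdot> b s) \<cdot> b' s) \<cdot> p" using dp[OF hi] by simp
    also have "\<dots> = (\<Sum>s<n. (((h \<cdot> i) \<cdot> b s) \<cdot> b' s) \<cdot> p)"
      by (rule Comp_sum_left[OF p, where Z = T]) (use Comp_in_Hom[OF b(2) Comp_in_Hom[OF b(1) hi]] in auto)
    also have "\<dots> = (\<Sum>s<n. (h \<cdot> (i \<cdot> b s)) \<cdot> (b' s \<cdot> p))"
    proof (intro sum.cong refl)
      fix s assume "s \<in> {..<n}"
      then have s: "s < n" by simp
      show "(((h \<cdot> i) \<cdot> b s) \<cdot> b' s) \<cdot> p = (h \<cdot> (i \<cdot> b s)) \<cdot> (b' s \<cdot> p)"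
        using Comp_assoc[OF p b(2)[OF s] Comp_in_Hom[OF b(1)[OF s] hi]] Comp_assoc[OF b(1)[OF s] i h]
        by simp
    qed
    finally show ?thesis .
  qed
  have ib: "i \<cdot> b s \<in> Hom C T X" "b' s \<cdot> p \<in> Hom C X T" if "s < n" for s
    using Comp_in_Hom[OF b(1)[OF that] i] Comp_in_Hom[OF p b(2)[OF that]] by auto
  have bpib: "(b' s \<cdot> p) \<cdot> (i \<cdot> b t) = (if s = t then Id C T else 0)" if st: "s < n" "t < n" for s t
  proof -
    have "(b' s \<cdot> p) \<cdot> (i \<cdot> b t) = b' s \<cdot> ((p \<cdot> i) \<cdot> b t)"
      using Comp_assoc[OF ib(1)[OF st(2)] p b(2)[OF st(1)]] Comp_assoc[OF b(1)[OF st(2)] i p] by simp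
    then show ?thesis using e(1) Comp_Id_left[OF b(1)[OF st(2)]] bb[OF st] by simp
  qed
  show ?case
  proof (cases "\<exists>\<sigma>\<in>Hom C T S. \<sigma> \<noteq> 0")
    case True
    then obtain \<sigma> where \<sigma>: "\<sigma> \<in> Hom C T S" "\<sigma> \<noteq> 0" by blast
    have iso: "iso_mor C T S \<sigma>" by (rule nonzero_between_simples_iso[OF T add.hyps(2) \<sigma>])
    define \<tau> where "\<tau> = inv_mor C T S \<sigma>"
    have \<tau>: "\<tau> \<in> Hom C S T" "\<tau> \<cdot> \<sigma> = Id C T" "\<sigma> \<cdot> \<tau> = Id C S"
      using inv_mor[OF iso] by (auto simp: \<tau>_def)
    have js: "j \<cdot> \<sigma> \<in> Hom C T X" "\<tau> \<cdot> q \<in> Hom C X T"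
      using Comp_in_Hom[OF \<sigma>(1) j] Comp_in_Hom[OF q \<tau>(1)] by auto
    have o1: "(\<tau> \<cdot> q) \<cdot> (j \<cdot> \<sigma>) = Id C T"
      using Comp_assoc[OF js(1) q \<tau>(1)] Comp_assoc[OF \<sigma>(1) j q] e(2) Comp_Id_left[OF \<sigma>(1)] \<tau>(2)
      by simp
    have o2: "(\<tau> \<cdot> q) \<cdot> (i \<cdot> b t) = 0" if "t < n" for t
      using Comp_assoc[OF ib(1)[OF that] q \<tau>(1)] Comp_assoc[OF b(1)[OF that] i q] e(4)
        Comp_zero_left[OF b(1)[OF that]] Comp_zero_right[OF \<tau>(1)] by simp
    have o3: "(b' s \<cdot> p) \<cdot> (j \<cdot> \<sigma>) = 0" if "s < n" for s
      using Comp_assoc[OF js(1) p b(2)[OF that]] Comp_assoc[OF \<sigma>(1) j p] e(3)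
        Comp_zero_left[OF \<sigma>(1)] Comp_zero_right[OF b(2)[OF that]] by simp
    have last_in: "j \<cdot> (q \<cdot> h) = (j \<cdot> \<sigma>) \<cdot> ((\<tau> \<cdot> q) \<cdot> h)" if h: "h \<in> Hom C T X" for h
      using Comp_assoc[OF h q \<tau>(1)] Comp_assoc[OF Comp_in_Hom[OF Comp_in_Hom[OF h q] \<tau>(1)] \<sigma>(1) j]
        Comp_assoc[OF Comp_in_Hom[OF h q] \<tau>(1) \<sigma>(1)] \<tau>(3) Comp_Id_left[OF Comp_in_Hom[OF h q]]
      by simp
    have last_out: "(h \<cdot> j) \<cdot> q = (h \<cdot> (j \<cdot> \<sigma>)) \<cdot> (\<tau> \<cdot> q)" if h: "h \<in> Hom C X T" for h
      using Comp_assoc[OF \<sigma>(1) j h] Comp_assoc[OF js(2) \<sigma>(1) Comp_in_Hom[OF j h]]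
        Comp_assoc[OF q \<tau>(1) \<sigma>(1)] \<tau>(3) Comp_Id_left[OF q]
      by simp
    let ?c = "\<lambda>s. if s < n then i \<cdot> b s else j \<cdot> \<sigma>" and ?c' = "\<lambda>s. if s < n then b' s \<cdot> p else \<tau> \<cdot> q"
    have "isotypic_decomposition C T X (Suc n) ?c ?c'"
      unfolding isotypic_decomposition_def
    proof (intro conjI allI impI ballI)
      fix h assume h: "h \<in> Hom C T X"
      show "h = (\<Sum>s<Suc n. ?c s \<cdot> (?c' s \<cdot> h))"
        using split_in[OF h] part_in[OF h] last_in[OF h] by simp
    next
      fix h assume h: "h \<in> Hom C X T"
      show "h = (\<Sum>s<Suc n. (h \<cdot> ?c s) \<cdot> ?c' s)"
        using split_out[OF h] part_out[OF h] last_out[OF h] by simp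
    qed (use ib js bpib o1 o2 o3 in \<open>auto simp: less_Suc_eq\<close>)
    then show ?thesis by blast
  next
    case False
    have zero_in: "\<sigma> = 0" if "\<sigma> \<in> Hom C T S" for \<sigma> using False that by blast
    have zero_out: "\<tau> = 0" if "\<tau> \<in> Hom C S T" for \<tau>
    proof (rule ccontr)
      assume "\<tau> \<noteq> 0"
      then have iso: "iso_mor C S T \<tau>" by (rule nonzero_between_simples_iso[OF add.hyps(2) T that])
      have "inv_mor C S T \<tau> = 0" using zero_in inv_mor(1)[OF iso] by blast
      then have "Id C T = 0" using inv_mor(3)[OF iso] Comp_zero_right[OF that] by simp
      then show False using simple_object_Id_nonzero[OF T] by blast
    qed
    have "isotypic_decomposition C T X n (\<lambda>s. i \<cdot> b s) (\<lambda>s. b' s \<cdot> p)"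
      unfolding isotypic_decomposition_def
    proof (intro conjI allI impI ballI)
      fix h assume h: "h \<in> Hom C T X"
      show "h = (\<Sum>s<n. (i \<cdot> b s) \<cdot> ((b' s \<cdot> p) \<cdot> h))"
        using split_in[OF h] part_in[OF h] zero_in[OF Comp_in_Hom[OF h q]] Comp_zero_right[OF j] by simp
    next
      fix h assume h: "h \<in> Hom C X T"
      show "h = (\<Sum>s<n. (h \<cdot> (i \<cdot> b s)) \<cdot> (b' s \<cdot> p))"
        using split_out[OF h] part_out[OF h] zero_out[OF Comp_in_Hom[OF j h]] Comp_zero_left[OF q] by simp
    qed (use ib bpib in auto)
    then show ?thesis by blast
  qed
qed

lemma isotypic_decomposition_bases:
  assumes d: "isotypic_decomposition C T U n b b'" and T: "absolutely_simple C T"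
  shows "family_basis (Scale C) (Hom C T U) {..<n} b" "family_basis (Scale C) (Hom C U T) {..<n} b'"
proof -
  have b: "b s \<in> Hom C T U" "b' s \<in> Hom C U T" if "s < n" for s
    using d that by (auto simp: isotypic_decomposition_def)
  have bb: "b' s \<cdot> b t = (if s = t then Id C T else 0)" if "s < n" "t < n" for s t
    using d that by (simp add: isotypic_decomposition_def)
  have nz: "Id C T \<noteq> 0" using T simple_object_Id_nonzero by (simp add: absolutely_simple_def)
  have scalar: "\<exists>c. f = Scale C c (Id C T)" if "f \<in> Hom C T T" for f
    using T that by (simp add: absolutely_simple_def)
  show "family_basis (Scale C) (Hom C T U) {..<n} b"
    unfolding family_basis_def
  proof (intro conjI ballI allI impI)
    fix q assume q: "q \<in> Hom C T U"
    have "\<forall>s. \<exists>c. s < n \<longrightarrow> b' s \<cdot> q = Scale C c (Id C T)"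
      using scalar Comp_in_Hom[OF q b(2)] by blast
    then obtain c where c: "\<And>s. s < n \<Longrightarrow> b' s \<cdot> q = Scale C (c s) (Id C T)" by metis
    have "q = (\<Sum>s<n. b s \<cdot> (b' s \<cdot> q))" using d q by (simp add: isotypic_decomposition_def)
    also have "\<dots> = (\<Sum>s<n. Scale C (c s) (b s))"
      by (intro sum.cong refl)
        (simp add: c Comp_scale_right[OF Id_in_Hom b(1)] Comp_Id_right[OF b(1)])
    finally show "\<exists>\<alpha>. q = (\<Sum>s<n. Scale C (\<alpha> s) (b s))" by blast
  next
    fix \<alpha> t assume eq: "(\<Sum>s<n. Scale C (\<alpha> s) (b s)) = 0" and "t \<in> {..<n}"
    then have t: "t < n" by simp
    have "0 = b' t \<cdot> (\<Sum>s<n. Scale C (\<alpha> s) (b s))" using eq Comp_zero_right[OF b(2)[OF t]] by simp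
    also have "\<dots> = (\<Sum>s<n. b' t \<cdot> Scale C (\<alpha> s) (b s))"
      by (rule Comp_sum_right[where X = T, OF _ b(2)[OF t]]) (simp add: Hom_scale b(1))
    also have "\<dots> = (\<Sum>s<n. if t = s then Scale C (\<alpha> s) (Id C T) else 0)"
      by (intro sum.cong refl) (simp add: Comp_scale_right[OF b(1) b(2)[OF t]] bb[OF t])
    also have "\<dots> = Scale C (\<alpha> t) (Id C T)" using t by simp
    finally show "\<alpha> t = 0" using nz by simp
  qed (use b in auto)
  show "family_basis (Scale C) (Hom C U T) {..<n} b'"
    unfolding family_basis_def
  proof (intro conjI ballI allI impI)
    fix q assume q: "q \<in> Hom C U T"
    have "\<forall>s. \<exists>c. s < n \<longrightarrow> q \<cdot> b s = Scale C c (Id C T)"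
      using scalar Comp_in_Hom[OF b(1) q] by blast
    then obtain c where c: "\<And>s. s < n \<Longrightarrow> q \<cdot> b s = Scale C (c s) (Id C T)" by metis
    have "q = (\<Sum>s<n. (q \<cdot> b s) \<cdot> b' s)" using d q by (simp add: isotypic_decomposition_def)
    also have "\<dots> = (\<Sum>s<n. Scale C (c s) (b' s))"
      by (intro sum.cong refl)
        (simp add: c Comp_scale_left[OF b(2) Id_in_Hom] Comp_Id_left[OF b(2)])
    finally show "\<exists>\<alpha>. q = (\<Sum>s<n. Scale C (\<alpha> s) (b' s))" by blast
  next
    fix \<alpha> t assume eq: "(\<Sum>s<n. Scale C (\<alpha> s) (b' s)) = 0" and "t \<in> {..<n}"
    then have t: "t < n" by simp
    have "0 = (\<Sum>s<n. Scale C (\<alpha> s) (b' s)) \<cdot> b t" using eq Comp_zero_left[OF b(1)[OF t]] by simp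
    also have "\<dots> = (\<Sum>s<n. Scale C (\<alpha> s) (b' s) \<cdot> b t)"
      by (rule Comp_sum_left[where Z = T, OF b(1)[OF t]]) (simp add: Hom_scale b(2))
    also have "\<dots> = (\<Sum>s<n. if s = t then Scale C (\<alpha> s) (Id C T) else 0)"
      by (intro sum.cong refl) (simp add: Comp_scale_left[OF b(1)[OF t] b(2)] bb[OF _ t])
    also have "\<dots> = Scale C (\<alpha> t) (Id C T)" using t by simp
    finally show "\<alpha> t = 0" using nz by simp
  qed (use b in auto)
qed

lemma hom_dim_to_simple:
  assumes "semisimple_object C U" "absolutely_simple C T"
  shows "hom_dim C U T = hom_dim C T U"
proof -
  obtain n b b' where d: "isotypic_decomposition C T U n b b'"
    using semisimple_isotypic_decomposition[OF assms(1) absolutely_simple_imp_simple[OF assms(2)]] by blast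
  show ?thesis
    unfolding hom_dim_def
    using V.family_basis_dim[OF isotypic_decomposition_bases(1)[OF d assms(2)] subspace_Hom]
      V.family_basis_dim[OF isotypic_decomposition_bases(2)[OF d assms(2)] subspace_Hom] by simp
qed

text \<open>The inclusions and the projections are dual bases for the composition pairing of \<open>Hom C T U\<close>
  with \<open>Hom C U T\<close>. This makes it perfect: it represents all functionals, and it is nondegenerate.\<close>

lemma functional_represented:
  assumes U: "semisimple_object C U" and T: "absolutely_simple C T"
    and add: "\<And>x y. x \<in> Hom C T U \<Longrightarrow> y \<in> Hom C T U \<Longrightarrow> \<phi> (x + y) = \<phi> x + \<phi> y"
    and scale: "\<And>c x. x \<in> Hom C T U \<Longrightarrow> \<phi> (Scale C c x) = c * \<phi> x"
  shows "\<exists>\<psi>\<in>Hom C U T. \<forall>x\<in>Hom C T U. \<psi> \<cdot> x = Scale C (\<phi> x) (Id C T)"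
proof -
  obtain n b b' where d: "isotypic_decomposition C T U n b b'"
    using semisimple_isotypic_decomposition[OF U absolutely_simple_imp_simple[OF T]] by blast
  have b: "b s \<in> Hom C T U" "b' s \<in> Hom C U T" if "s < n" for s
    using d that by (auto simp: isotypic_decomposition_def)
  have bb: "b' s \<cdot> b t = (if s = t then Id C T else 0)" if "s < n" "t < n" for s t
    using d that by (simp add: isotypic_decomposition_def)
  have zero: "\<phi> 0 = 0" using scale[OF Hom_zero, of 0] by simp
  have phi_sum: "\<phi> (\<Sum>s\<in>I. Scale C (\<alpha> s) (b s)) = (\<Sum>s\<in>I. \<alpha> s * \<phi> (b s))"
    if "finite I" "I \<subseteq> {..<n}" for \<alpha> I
    using that
  proof (induction I rule: finite_induct)
    case (insert s I)
    then have "Scale C (\<alpha> s) (b s) \<in> Hom C T U" "(\<Sum>s\<in>I. Scale C (\<alpha> s) (b s)) \<in> Hom C T U"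
      by (auto intro!: Hom_sum Hom_scale b)
    then show ?case using insert by (simp add: add scale b)
  qed (simp add: zero)
  let ?\<psi> = "\<Sum>s<n. Scale C (\<phi> (b s)) (b' s)"
  have "?\<psi> \<cdot> x = Scale C (\<phi> x) (Id C T)" if x: "x \<in> Hom C T U" for x
  proof -
    obtain \<alpha> where \<alpha>: "x = (\<Sum>s<n. Scale C (\<alpha> s) (b s))"
      using family_basis_expand[OF isotypic_decomposition_bases(1)[OF d T] x] by blast
    have bx: "b' s \<cdot> x = Scale C (\<alpha> s) (Id C T)" if s: "s < n" for s
    proof -
      have "b' s \<cdot> x = (\<Sum>t<n. b' s \<cdot> Scale C (\<alpha> t) (b t))"
        unfolding \<alpha> by (rule Comp_sum_right[where X = T, OF _ b(2)[OF s]]) (simp add: Hom_scale b(1))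
      also have "\<dots> = (\<Sum>t<n. if s = t then Scale C (\<alpha> t) (Id C T) else 0)"
        by (intro sum.cong refl) (simp add: Comp_scale_right[OF b(1) b(2)[OF s]] bb[OF s])
      finally show ?thesis using s by simp
    qed
    have "?\<psi> \<cdot> x = (\<Sum>s<n. Scale C (\<phi> (b s)) (b' s) \<cdot> x)"
      by (rule Comp_sum_left[where Z = T, OF x]) (simp add: Hom_scale b(2))
    also have "\<dots> = (\<Sum>s<n. Scale C (\<alpha> s * \<phi> (b s)) (Id C T))"
      by (intro sum.cong refl) (simp add: Comp_scale_left[OF x b(2)] bx mult.commute)
    also have "\<dots> = Scale C (\<phi> x) (Id C T)"
      unfolding \<alpha> by (simp add: phi_sum V.scale_sum_left)
    finally show ?thesis .
  qed
  moreover have "?\<psi> \<in> Hom C U T" by (rule Hom_sum) (simp add: Hom_scale b(2))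
  ultimately show ?thesis by blast
qed

lemma semisimple_nondegenerate:
  assumes "semisimple_object C U" "simple_object C T" "\<psi> \<in> Hom C U T"
    and "\<And>x. x \<in> Hom C T U \<Longrightarrow> \<psi> \<cdot> x = 0"
  shows "\<psi> = 0"
proof -
  obtain n b b' where d: "isotypic_decomposition C T U n b b'"
    using semisimple_isotypic_decomposition[OF assms(1,2)] by blast
  have b: "b s \<in> Hom C T U" "b' s \<in> Hom C U T" if "s < n" for s
    using d that by (auto simp: isotypic_decomposition_def)
  have "\<psi> = (\<Sum>s<n. (\<psi> \<cdot> b s) \<cdot> b' s)" using d assms(3) by (simp add: isotypic_decomposition_def)
  also have "\<dots> = 0"
    by (intro sum.neutral) (simp add: assms(4) b Comp_zero_left[OF b(2)])
  finally show ?thesis .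
qed

text \<open>If the maps \<open>T \<rightarrow> Z\<close> that factor through \<open>g\<close> missed some \<open>h\<close>, a functional separating \<open>h\<close> from
  them would be composition with a nonzero \<open>\<psi> : Z \<rightarrow> T\<close> such that \<open>\<psi> \<cdot> g = 0\<close>.\<close>

lemma simple_lifts_along_epi:
  assumes Y: "semisimple_object C Y" and Z: "semisimple_object C Z" and T: "absolutely_simple C T"
    and g: "epi_mor C Y Z g" and h: "h \<in> Hom C T Z"
  shows "\<exists>h'\<in>Hom C T Y. g \<cdot> h' = h"
proof (rule ccontr)
  assume contr: "\<not> (\<exists>h'\<in>Hom C T Y. g \<cdot> h' = h)"
  have gH: "g \<in> Hom C Y Z" using g by (simp add: epi_mor_def)
  have T': "simple_object C T" by (rule absolutely_simple_imp_simple[OF T])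
  let ?W = "(\<lambda>x. g \<cdot> x) ` Hom C T Y"
  have "V.subspace ?W"
  proof (rule V.subspaceI)
    show "0 \<in> ?W" 
      by (intro image_eqI[of _ _ 0]) (simp_all add: Comp_zero_right[OF gH] Hom_zero)
    fix x y assume "x \<in> ?W" "y \<in> ?W"
    then obtain x' y' where "x = g \<cdot> x'" "y = g \<cdot> y'" "x' \<in> Hom C T Y" "y' \<in> Hom C T Y" by auto
    then show "x + y \<in> ?W"
      by (intro image_eqI[of _ _ "x' + y'"]) (simp_all add: Comp_add_right[OF _ _ gH] Hom_add)
  next
    fix c x assume "x \<in> ?W"
    then obtain x' where "x = g \<cdot> x'" "x' \<in> Hom C T Y" by auto
    then show "Scale C c x \<in> ?W"
      by (intro image_eqI[of _ _ "Scale C c x'"]) (simp_all add: Comp_scale_right[OF _ gH] Hom_scale)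
  qed
  moreover have "h \<notin> ?W" using contr by blast
  ultimately obtain \<phi> where sep: "(\<forall>x y. \<phi> (x + y) = \<phi> x + \<phi> y) \<and> (\<forall>c x. \<phi> (Scale C c x) = c * \<phi> x) \<and>
      (\<forall>w\<in>?W. \<phi> w = 0) \<and> \<phi> h = 1"
    by (rule V.separating_functional[THEN exE])
  then have \<phi>: "\<phi> (x + y) = \<phi> x + \<phi> y" "\<phi> (Scale C c x) = c * \<phi> x"
    "w \<in> ?W \<Longrightarrow> \<phi> w = 0" "\<phi> h = 1" for x y c w by auto
  obtain \<psi> where \<psi>: "\<psi> \<in> Hom C Z T" "\<And>x. x \<in> Hom C T Z \<Longrightarrow> \<psi> \<cdot> x = Scale C (\<phi> x) (Id C T)"
    using functional_represented[OF Z T \<phi>(1) \<phi>(2)] by blast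
  have "\<psi> \<cdot> g = 0"
  proof (rule semisimple_nondegenerate[OF Y T' Comp_in_Hom[OF gH \<psi>(1)]])
    fix x assume x: "x \<in> Hom C T Y"
    show "(\<psi> \<cdot> g) \<cdot> x = 0"
      using Comp_assoc[OF x gH \<psi>(1)] \<psi>(2)[OF Comp_in_Hom[OF x gH]] \<phi>(3) x by simp
  qed
  then have "\<psi> = 0" by (rule epi_mor_cancel[OF g \<psi>(1)])
  then have "Id C T = 0" using \<psi>(2)[OF h] \<phi>(4) Comp_zero_left[OF h] by simp
  then show False using simple_object_Id_nonzero[OF T'] by blast
qed

end

section \<open>Projective covers\<close>

context abelian_category
begin

text \<open>An epimorphism is the cokernel of some \<open>g\<close>, and \<open>g\<close> factors through its kernel.\<close>

lemma epi_short_exact: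
  assumes p: "epi_mor C P X p"
  shows "\<exists>K k. short_exact C K P X k p"
proof -
  have pH: "p \<in> Hom C P X" using p by (simp add: epi_mor_def)
  obtain K k where k: "is_kernel C P X p K k" using ex_kernel[OF pH] by blast
  have kH: "k \<in> Hom C K P" "p \<cdot> k = 0" using k by (simp_all add: is_kernel_def)
  obtain Z g where g: "g \<in> Hom C Z P" "is_cokernel C Z P g X p" using epi_normal[OF p] by blast
  have "p \<cdot> g = 0" using g(2) by (simp add: is_cokernel_def)
  then obtain w where w: "w \<in> Hom C Z K" "k \<cdot> w = g" using is_kernel_factor[OF k g(1)] by blast
  have "is_cokernel C K P k X p"
    unfolding is_cokernel_def
  proof (intro conjI allI ballI impI pH kH(2))
    fix W h assume h: "h \<in> Hom C P W" "h \<cdot> k = 0"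
    have "h \<cdot> g = 0" using Comp_assoc[OF w(1) kH(1) h(1)] w(2) h(2) Comp_zero_left[OF w(1)] by simp
    then show "\<exists>!u. u \<in> Hom C X W \<and> u \<cdot> p = h"
      using g(2) h(1) unfolding is_cokernel_def by blast
  qed
  then show ?thesis using k kH(1) pH unfolding short_exact_def by blast
qed

text \<open>The kernel of a nonzero \<open>f : P \<rightarrow> Y\<close> is a proper subobject of \<open>P\<close>, so it is contained in the
  kernel of the cover \<open>p\<close>; as \<open>f\<close> is the cokernel of its kernel, \<open>p\<close> factors through \<open>f\<close>.\<close>

lemma projective_cover_factor:
  assumes ess: "\<And>Q h. h \<in> Hom C Q P \<Longrightarrow> epi_mor C Q X (p \<cdot> h) \<Longrightarrow> epi_mor C Q P h"
    and p: "p \<in> Hom C P X" and X: "simple_object C X" and Y: "simple_object C Y"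
    and f: "f \<in> Hom C P Y" "f \<noteq> 0"
  shows "\<exists>u\<in>Hom C Y X. u \<cdot> f = p"
proof -
  obtain K k where k: "is_kernel C P Y f K k" using ex_kernel[OF f(1)] by blast
  have kH: "k \<in> Hom C K P" "f \<cdot> k = 0" using k by (auto simp: is_kernel_def)
  have pk: "p \<cdot> k = 0"
  proof (rule ccontr)
    assume "p \<cdot> k \<noteq> 0"
    then have "epi_mor C K X (p \<cdot> k)" by (rule nonzero_to_simple_epi[OF X Comp_in_Hom[OF kH(1) p]])
    then have "epi_mor C K P k" by (rule ess[OF kH(1)])
    then have "f = 0" using epi_mor_cancel[OF _ f(1) kH(2)] by blast
    then show False using f(2) by blast
  qed
  obtain Z g where g: "g \<in> Hom C Z P" "is_cokernel C Z P g Y f"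
    using epi_normal[OF nonzero_to_simple_epi[OF Y f]] by blast
  have "f \<cdot> g = 0" using g(2) by (simp add: is_cokernel_def)
  then obtain w where w: "w \<in> Hom C Z K" "k \<cdot> w = g" using is_kernel_factor[OF k g(1)] by blast
  have "p \<cdot> g = 0" using Comp_assoc[OF w(1) kH(1) p] w(2) pk Comp_zero_left[OF w(1)] by simp
  then show ?thesis using is_cokernel_factor[OF g(2) p] by blast
qed

end

section \<open>Duality in a module category\<close>

context linear_category
begin

lemma iso_morI:
  "f \<in> Hom C X Y \<Longrightarrow> g \<in> Hom C Y X \<Longrightarrow> g \<cdot> f = Id C X \<Longrightarrow> f \<cdot> g = Id C Y \<Longrightarrow> iso_mor C X Y f"
  unfolding iso_mor_def by blast

lemma inv_mor_eqI:
  assumes f: "f \<in> Hom C X Y" and g: "g \<in> Hom C Y X" "g \<cdot> f = Id C X" "f \<cdot> g = Id C Y"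
  shows "inv_mor C X Y f = g"
proof -
  note i = inv_mor[OF iso_morI[OF f g]]
  have "inv_mor C X Y f = inv_mor C X Y f \<cdot> (f \<cdot> g)" using Comp_Id_right[OF i(1)] g(3) by simp
  also have "\<dots> = g" using Comp_assoc[OF g(1) f i(1)] i(2) Comp_Id_left[OF g(1)] by simp
  finally show ?thesis .
qed

lemma iso_mor_Comp:
  assumes f: "iso_mor C X Y f" and g: "iso_mor C Y Z g"
  shows "iso_mor C X Z (g \<cdot> f)" "inv_mor C X Z (g \<cdot> f) = inv_mor C X Y f \<cdot> inv_mor C Y Z g"
proof -
  note F = iso_mor_in_Hom[OF f] inv_mor[OF f] and G = iso_mor_in_Hom[OF g] inv_mor[OF g]
  let ?h = "inv_mor C X Y f \<cdot> inv_mor C Y Z g"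
  have gf: "g \<cdot> f \<in> Hom C X Z" by (rule Comp_in_Hom[OF F(1) G(1)])
  have h: "?h \<in> Hom C Z X" by (rule Comp_in_Hom[OF G(2) F(2)])
  have 1: "?h \<cdot> (g \<cdot> f) = Id C X"
    using Comp_assoc[OF gf G(2) F(2)] Comp_assoc[OF F(1) G(1) G(2)] G(3) Comp_Id_left[OF F(1)] F(3)
    by simp
  have 2: "(g \<cdot> f) \<cdot> ?h = Id C Z"
    using Comp_assoc[OF h F(1) G(1)] Comp_assoc[OF G(2) F(2) F(1)] F(4) Comp_Id_left[OF G(2)] G(4)
    by simp
  show "iso_mor C X Z (g \<cdot> f)" by (rule iso_morI[OF gf h 1 2])
  show "inv_mor C X Z (g \<cdot> f) = ?h" by (rule inv_mor_eqI[OF gf h 1 2])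
qed

lemma iso_mor_inv:
  assumes "iso_mor C X Y f"
  shows "iso_mor C Y X (inv_mor C X Y f)" "inv_mor C Y X (inv_mor C X Y f) = f"
  using inv_mor[OF assms] iso_mor_in_Hom[OF assms]
  by (auto intro!: iso_morI[where g = f] inv_mor_eqI)

lemma inverse_square:
  assumes a: "iso_mor C A B a" and b: "iso_mor C A' B' b"
    and f: "f \<in> Hom C A A'" and g: "g \<in> Hom C B B'" and eq: "b \<cdot> f = g \<cdot> a"
  shows "f \<cdot> inv_mor C A B a = inv_mor C A' B' b \<cdot> g"
proof -
  note F = iso_mor_in_Hom[OF a] inv_mor[OF a] and G = iso_mor_in_Hom[OF b] inv_mor[OF b]
  have "f \<cdot> inv_mor C A B a = (inv_mor C A' B' b \<cdot> b) \<cdot> (f \<cdot> inv_mor C A B a)"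
    using G(3) Comp_Id_left[OF Comp_in_Hom[OF F(2) f]] by simp
  also have "\<dots> = inv_mor C A' B' b \<cdot> ((b \<cdot> f) \<cdot> inv_mor C A B a)"
    using Comp_assoc[OF Comp_in_Hom[OF F(2) f] G(1,2)] Comp_assoc[OF F(2) f G(1)] by simp
  also have "\<dots> = inv_mor C A' B' b \<cdot> g"
    using eq Comp_assoc[OF F(2) F(1) g] F(4) Comp_Id_right[OF g] by simp
  finally show ?thesis .
qed

lemma Comp_cong_left:
  assumes "a \<cdot> b = c \<cdot> d" "x \<in> Hom C W X" "b \<in> Hom C X Y" "a \<in> Hom C Y Z" "d \<in> Hom C X Y'" "c \<in> Hom C Y' Z"
  shows "a \<cdot> (b \<cdot> x) = c \<cdot> (d \<cdot> x)"
  using Comp_assoc[OF assms(2,3,4)] Comp_assoc[OF assms(2,5,6)] assms(1) by simp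

lemma Comp_collapse_left:
  assumes "a \<cdot> b = c" "x \<in> Hom C W X" "b \<in> Hom C X Y" "a \<in> Hom C Y Z"
  shows "a \<cdot> (b \<cdot> x) = c \<cdot> x"
  using Comp_assoc[OF assms(2,3,4)] assms(1) by simp

text \<open>The left side is a zigzag composite in a module category, in which the coherence isomorphisms
  \<open>a'\<close>, \<open>b\<close>, \<open>n\<close>, \<open>v\<close> separate the coevaluation \<open>k\<close> from the evaluation \<open>e\<close>. Sliding \<open>k\<close> and \<open>e\<close> past them
  leaves a composite of morphisms that act through \<open>C\<close> only. Both zigzag identities are of this form.\<close>

lemma paste_zigzag:
  assumes ty: "n \<in> Hom C T0 T1" "k \<in> Hom C T1 T2" "a' \<in> Hom C T2 T3" "b \<in> Hom C T3 T4" "e \<in> Hom C T4 T5"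
      "v \<in> Hom C T5 T6"
    and ty': "g1 \<in> Hom C T1 S2" "k1 \<in> Hom C S2 S3" "g \<in> Hom C T2 S3" "a \<in> Hom C S3 S4" "f \<in> Hom C S4 T4"
      "e1 \<in> Hom C S4 S5" "f1 \<in> Hom C S5 T5"
    and sq: "b \<cdot> a' = f \<cdot> (a \<cdot> g)" "g \<cdot> k = k1 \<cdot> g1" "g1 \<cdot> n = l" "e \<cdot> f = f1 \<cdot> e1" "v \<cdot> f1 = r"
  shows "v \<cdot> (e \<cdot> (b \<cdot> (a' \<cdot> (k \<cdot> n)))) = r \<cdot> (e1 \<cdot> (a \<cdot> (k1 \<cdot> l)))"
proof -
  have l: "l \<in> Hom C T0 S2" using Comp_in_Hom[OF ty(1) ty'(1)] sq(3) by simp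
  have w: "k1 \<cdot> l \<in> Hom C T0 S3" by (rule Comp_in_Hom[OF l ty'(2)])
  have kn: "k \<cdot> n \<in> Hom C T0 T2" by (rule Comp_in_Hom[OF ty(1,2)])
  have "b \<cdot> (a' \<cdot> (k \<cdot> n)) = f \<cdot> ((a \<cdot> g) \<cdot> (k \<cdot> n))"
    by (rule Comp_cong_left[OF sq(1) kn ty(3,4) Comp_in_Hom[OF ty'(3,4)] ty'(5)])
  also have "(a \<cdot> g) \<cdot> (k \<cdot> n) = a \<cdot> (g \<cdot> (k \<cdot> n))" by (rule Comp_assoc[OF kn ty'(3,4)])
  also have "g \<cdot> (k \<cdot> n) = k1 \<cdot> (g1 \<cdot> n)" by (rule Comp_cong_left[OF sq(2) ty(1,2) ty'(3,1,2)])
  finally have 1: "b \<cdot> (a' \<cdot> (k \<cdot> n)) = f \<cdot> (a \<cdot> (k1 \<cdot> l))" using sq(3) by simp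
  have aw: "a \<cdot> (k1 \<cdot> l) \<in> Hom C T0 S4" by (rule Comp_in_Hom[OF w ty'(4)])
  have "e \<cdot> (f \<cdot> (a \<cdot> (k1 \<cdot> l))) = f1 \<cdot> (e1 \<cdot> (a \<cdot> (k1 \<cdot> l)))"
    by (rule Comp_cong_left[OF sq(4) aw ty'(5) ty(5) ty'(6,7)])
  moreover have "v \<cdot> (f1 \<cdot> (e1 \<cdot> (a \<cdot> (k1 \<cdot> l)))) = r \<cdot> (e1 \<cdot> (a \<cdot> (k1 \<cdot> l)))"
    by (rule Comp_collapse_left[OF sq(5) Comp_in_Hom[OF aw ty'(6)] ty'(7) ty(6)])
  ultimately show ?thesis using 1 by simp
qed

end

context module_category
begin

abbreviation comp_M (infixr "\<circ>\<^sub>M" 70) where "g \<circ>\<^sub>M f \<equiv> g \<cdot>\<^bsub>M\<^esub> f"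
abbreviation act_obj (infixr "\<rhd>" 75) where "X \<rhd> U \<equiv> X \<triangleright>\<^sub>o\<^bsub>M\<^esub> U"
abbreviation act_mor (infixr "\<triangleright>" 75) where "f \<triangleright> g \<equiv> f \<triangleright>\<^sub>m\<^bsub>M\<^esub> g"
abbreviation massoc_inv where
  "massoc_inv X Y U \<equiv> inv_mor M ((X \<otimes>\<^sub>o Y) \<rhd> U) (X \<rhd> (Y \<rhd> U)) (MAssoc M X Y U)"
abbreviation munit_inv where "munit_inv U \<equiv> inv_mor M (Unit C \<rhd> U) U (MUnit M U)"

lemmas MAssoc_Hom = M.iso_mor_in_Hom[OF MAssoc_iso]
lemmas MUnit_Hom = M.iso_mor_in_Hom[OF MUnit_iso]
lemmas massoc_inv = M.inv_mor[OF MAssoc_iso]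
lemmas munit_inv = M.inv_mor[OF MUnit_iso]

lemma act_Id_left_Comp:
  assumes "f \<in> Hom M U V" "g \<in> Hom M V W"
  shows "Id C X \<triangleright> (g \<circ>\<^sub>M f) = (Id C X \<triangleright> g) \<circ>\<^sub>M (Id C X \<triangleright> f)"
  using ActM_Comp[OF C.Id_in_Hom C.Id_in_Hom assms] C.Comp_Id_left[OF C.Id_in_Hom] by simp

lemma act_Id_right_Comp:
  assumes "f \<in> Hom C X Y" "g \<in> Hom C Y Z"
  shows "(g \<cdot> f) \<triangleright> Id M U = (g \<triangleright> Id M U) \<circ>\<^sub>M (f \<triangleright> Id M U)"
  using ActM_Comp[OF assms M.Id_in_Hom M.Id_in_Hom] M.Comp_Id_left[OF M.Id_in_Hom] by simp

lemma act_interchange: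
  assumes "f \<in> Hom C X Y" "g \<in> Hom M U V"
  shows "(f \<triangleright> Id M V) \<circ>\<^sub>M (Id C X \<triangleright> g) = f \<triangleright> g" "(Id C Y \<triangleright> g) \<circ>\<^sub>M (f \<triangleright> Id M U) = f \<triangleright> g"
  using ActM_Comp[OF C.Id_in_Hom assms(1) assms(2) M.Id_in_Hom] C.Comp_Id_right[OF assms(1)]
    ActM_Comp[OF assms(1) C.Id_in_Hom M.Id_in_Hom assms(2)] C.Comp_Id_left[OF assms(1)]
    M.Comp_Id_left[OF assms(2)] M.Comp_Id_right[OF assms(2)] by simp_all

lemma act_Id_left_Hom: "g \<in> Hom M U V \<Longrightarrow> Id C X \<triangleright> g \<in> Hom M (X \<rhd> U) (X \<rhd> V)"
  by (rule ActM_in_Hom[OF C.Id_in_Hom])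

lemma act_Id_right_Hom: "f \<in> Hom C X Y \<Longrightarrow> f \<triangleright> Id M U \<in> Hom M (X \<rhd> U) (Y \<rhd> U)"
  by (rule ActM_in_Hom[OF _ M.Id_in_Hom])

lemma act_Id_left_iso:
  assumes "iso_mor M U V g"
  shows "iso_mor M (X \<rhd> U) (X \<rhd> V) (Id C X \<triangleright> g)"
    "inv_mor M (X \<rhd> U) (X \<rhd> V) (Id C X \<triangleright> g) = Id C X \<triangleright> inv_mor M U V g"
proof -
  note G = M.iso_mor_in_Hom[OF assms] M.inv_mor[OF assms]
  note * = act_Id_left_Hom[OF G(1), where X = X] act_Id_left_Hom[OF G(2), where X = X]
    act_Id_left_Comp[OF G(1,2), where X = X, symmetric, unfolded G ActM_Id]
    act_Id_left_Comp[OF G(2,1), where X = X, symmetric, unfolded G ActM_Id]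
  show "iso_mor M (X \<rhd> U) (X \<rhd> V) (Id C X \<triangleright> g)" by (rule M.iso_morI[OF *])
  show "inv_mor M (X \<rhd> U) (X \<rhd> V) (Id C X \<triangleright> g) = Id C X \<triangleright> inv_mor M U V g"
    by (rule M.inv_mor_eqI[OF *])
qed

lemma act_Id_right_iso:
  assumes "iso_mor C X Y f"
  shows "iso_mor M (X \<rhd> U) (Y \<rhd> U) (f \<triangleright> Id M U)"
    "inv_mor M (X \<rhd> U) (Y \<rhd> U) (f \<triangleright> Id M U) = inv_mor C X Y f \<triangleright> Id M U"
proof -
  note G = C.iso_mor_in_Hom[OF assms] C.inv_mor[OF assms]
  note * = act_Id_right_Hom[OF G(1), where U = U] act_Id_right_Hom[OF G(2), where U = U]
    act_Id_right_Comp[OF G(1,2), where U = U, symmetric, unfolded G ActM_Id]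
    act_Id_right_Comp[OF G(2,1), where U = U, symmetric, unfolded G ActM_Id]
  show "iso_mor M (X \<rhd> U) (Y \<rhd> U) (f \<triangleright> Id M U)" by (rule M.iso_morI[OF *])
  show "inv_mor M (X \<rhd> U) (Y \<rhd> U) (f \<triangleright> Id M U) = inv_mor C X Y f \<triangleright> Id M U"
    by (rule M.inv_mor_eqI[OF *])
qed

lemma unit_act_faithful:
  assumes f: "f \<in> Hom M U V" and g: "g \<in> Hom M U V" and eq: "Id C (Unit C) \<triangleright> f = Id C (Unit C) \<triangleright> g"
  shows "f = g"
proof -
  have "(f - g) \<circ>\<^sub>M MUnit M U = 0"
    using M.Comp_diff_left[OF MUnit_Hom f g] MUnit_natural[OF f] MUnit_natural[OF g] eq by simp
  then have "f - g = 0" by (rule M.iso_mor_cancel_right[OF MUnit_iso M.Hom_diff[OF f g]])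
  then show ?thesis by simp
qed

text \<open>The unit coherence that is not among the axioms. As tensoring with \<open>1\<close> is faithful it may be
  checked after tensoring with \<open>1\<close>, where it follows from the pentagon and the triangles (Kelly).\<close>

lemma unit_act_coherence: "MUnit M (X \<rhd> V) \<circ>\<^sub>M MAssoc M (Unit C) X V = LUnit C X \<triangleright> Id M V"
proof -
  let ?I = "Unit C" and ?i = "Id C (Unit C)"
  let ?a = "Assoc C ?I ?I X" and ?l = "LUnit C X" and ?r = "RUnit C ?I"
  have l: "?l \<in> Hom C (?I \<otimes>\<^sub>o X) X" by (rule C.iso_mor_in_Hom[OF C.LUnit_iso])
  have r: "?r \<in> Hom C (?I \<otimes>\<^sub>o ?I) ?I" by (rule C.iso_mor_in_Hom[OF C.RUnit_iso])
  have a: "?a \<in> Hom C ((?I \<otimes>\<^sub>o ?I) \<otimes>\<^sub>o X) (?I \<otimes>\<^sub>o ?I \<otimes>\<^sub>o X)" by (rule C.iso_mor_in_Hom[OF C.Assoc_iso])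
  have il: "?i \<otimes>\<^sub>m ?l \<in> Hom C (?I \<otimes>\<^sub>o ?I \<otimes>\<^sub>o X) (?I \<otimes>\<^sub>o X)" by (rule C.TensM_in_Hom[OF C.Id_in_Hom l])
  let ?p = "MUnit M (X \<rhd> V) \<circ>\<^sub>M MAssoc M ?I X V" and ?q = "?l \<triangleright> Id M V"
  have p: "?p \<in> Hom M ((?I \<otimes>\<^sub>o X) \<rhd> V) (X \<rhd> V)" by (rule M.Comp_in_Hom[OF MAssoc_Hom MUnit_Hom])
  have q: "?q \<in> Hom M ((?I \<otimes>\<^sub>o X) \<rhd> V) (X \<rhd> V)" by (rule act_Id_right_Hom[OF l])
  let ?b = "MAssoc M ?I (?I \<otimes>\<^sub>o X) V" and ?c = "?a \<triangleright> Id M V"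
  have c: "?c \<in> Hom M (((?I \<otimes>\<^sub>o ?I) \<otimes>\<^sub>o X) \<rhd> V) ((?I \<otimes>\<^sub>o ?I \<otimes>\<^sub>o X) \<rhd> V)" by (rule act_Id_right_Hom[OF a])
  note bc = M.Comp_in_Hom[OF c MAssoc_Hom]
  note ip = act_Id_left_Hom[OF p, of ?I] and iq = act_Id_left_Hom[OF q, of ?I]
  have "(?i \<triangleright> ?p) \<circ>\<^sub>M (?b \<circ>\<^sub>M ?c)
      = (?i \<triangleright> MUnit M (X \<rhd> V)) \<circ>\<^sub>M ((?i \<triangleright> MAssoc M ?I X V) \<circ>\<^sub>M (?b \<circ>\<^sub>M ?c))"
    using act_Id_left_Comp[OF MAssoc_Hom MUnit_Hom, where X = ?I]
      M.Comp_assoc[OF bc act_Id_left_Hom[OF MAssoc_Hom] act_Id_left_Hom[OF MUnit_Hom]] by simp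
  also have "(?i \<triangleright> MAssoc M ?I X V) \<circ>\<^sub>M (?b \<circ>\<^sub>M ?c) = MAssoc M ?I ?I (X \<rhd> V) \<circ>\<^sub>M MAssoc M (?I \<otimes>\<^sub>o ?I) X V"
    by (rule module_pentagon)
  also have "(?i \<triangleright> MUnit M (X \<rhd> V)) \<circ>\<^sub>M \<dots> = (?r \<triangleright> Id M (X \<rhd> V)) \<circ>\<^sub>M MAssoc M (?I \<otimes>\<^sub>o ?I) X V"
    by (rule M.Comp_collapse_left[OF module_triangle MAssoc_Hom MAssoc_Hom act_Id_left_Hom[OF MUnit_Hom]])
  also have "\<dots> = MAssoc M ?I X V \<circ>\<^sub>M ((?r \<otimes>\<^sub>m Id C X) \<triangleright> Id M V)"
    using MAssoc_natural[OF r C.Id_in_Hom M.Id_in_Hom, of X V] by (simp add: ActM_Id)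
  also have "(?r \<otimes>\<^sub>m Id C X) \<triangleright> Id M V = ((?i \<otimes>\<^sub>m ?l) \<triangleright> Id M V) \<circ>\<^sub>M ?c"
    using act_Id_right_Comp[OF a il] C.triangle[of ?I X] by simp
  also have "MAssoc M ?I X V \<circ>\<^sub>M (((?i \<otimes>\<^sub>m ?l) \<triangleright> Id M V) \<circ>\<^sub>M ?c) = (?i \<triangleright> ?q) \<circ>\<^sub>M (?b \<circ>\<^sub>M ?c)"
    by (rule M.Comp_cong_left[OF MAssoc_natural[OF C.Id_in_Hom l M.Id_in_Hom] c
          act_Id_right_Hom[OF il] MAssoc_Hom MAssoc_Hom iq])
  finally have "(?i \<triangleright> ?p - ?i \<triangleright> ?q) \<circ>\<^sub>M (?b \<circ>\<^sub>M ?c) = 0"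
    using M.Comp_diff_left[OF bc ip iq] by simp
  then have "?i \<triangleright> ?p - ?i \<triangleright> ?q = 0"
    by (rule M.iso_mor_cancel_right[OF M.iso_mor_Comp(1)[OF act_Id_right_iso(1)[OF C.Assoc_iso] MAssoc_iso]
          M.Hom_diff[OF ip iq]])
  then show ?thesis by (intro unit_act_faithful[OF p q]) simp
qed

lemma dual_Hom: "Ev C X \<in> Hom C (Dual C X \<otimes>\<^sub>o X) (Unit C)" "Coev C X \<in> Hom C (Unit C) (X \<otimes>\<^sub>o Dual C X)"
  and dual_zigzag:
    "RUnit C X \<cdot> (Id C X \<otimes>\<^sub>m Ev C X) \<cdot> Assoc C X (Dual C X) X \<cdot> (Coev C X \<otimes>\<^sub>m Id C X) \<cdot> LUnit_inv C X = Id C X"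
    "LUnit C (Dual C X) \<cdot> (Ev C X \<otimes>\<^sub>m Id C (Dual C X)) \<cdot> Assoc_inv C (Dual C X) X (Dual C X) \<cdot>
       (Id C (Dual C X) \<otimes>\<^sub>m Coev C X) \<cdot> RUnit_inv C (Dual C X) = Id C (Dual C X)"
  using C.left_dual[of X] by (simp_all add: left_dual_def)

lemma act_Id_right_Comp5:
  assumes "f1 \<in> Hom C X0 X1" "f2 \<in> Hom C X1 X2" "f3 \<in> Hom C X2 X3" "f4 \<in> Hom C X3 X4" "f5 \<in> Hom C X4 X5"
  shows "(f5 \<triangleright> Id M U) \<circ>\<^sub>M (f4 \<triangleright> Id M U) \<circ>\<^sub>M (f3 \<triangleright> Id M U) \<circ>\<^sub>M (f2 \<triangleright> Id M U) \<circ>\<^sub>M (f1 \<triangleright> Id M U)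
    = (f5 \<cdot> f4 \<cdot> f3 \<cdot> f2 \<cdot> f1) \<triangleright> Id M U"
proof -
  note h2 = C.Comp_in_Hom[OF assms(1,2)]
  note h3 = C.Comp_in_Hom[OF h2 assms(3)]
  note h4 = C.Comp_in_Hom[OF h3 assms(4)]
  show ?thesis
    by (simp add: act_Id_right_Comp[OF assms(1,2)] act_Id_right_Comp[OF h2 assms(3)]
        act_Id_right_Comp[OF h3 assms(4)] act_Id_right_Comp[OF h4 assms(5)])
qed

text \<open>The two zigzag identities of \<open>X\<close> and \<open>X\<^sup>*\<close> remain valid for their actions on \<open>M\<close>. The first of the
  squares to be pasted is the pentagon; the remaining ones are naturality and unit coherence.\<close>

lemma act_zigzag1:
  "(Id C X \<triangleright> MUnit M V) \<circ>\<^sub>M (Id C X \<triangleright> (Ev C X \<triangleright> Id M V)) \<circ>\<^sub>M (Id C X \<triangleright> massoc_inv (Dual C X) X V) \<circ>\<^sub>M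
     MAssoc M X (Dual C X) (X \<rhd> V) \<circ>\<^sub>M (Coev C X \<triangleright> Id M (X \<rhd> V)) \<circ>\<^sub>M munit_inv (X \<rhd> V) = Id M (X \<rhd> V)"
proof -
  let ?D = "Dual C X" and ?I = "Unit C"
  have xe: "Id C X \<otimes>\<^sub>m Ev C X \<in> Hom C (X \<otimes>\<^sub>o ?D \<otimes>\<^sub>o X) (X \<otimes>\<^sub>o ?I)"
    by (rule C.TensM_in_Hom[OF C.Id_in_Hom dual_Hom(1)])
  have kx: "Coev C X \<otimes>\<^sub>m Id C X \<in> Hom C (?I \<otimes>\<^sub>o X) ((X \<otimes>\<^sub>o ?D) \<otimes>\<^sub>o X)"
    by (rule C.TensM_in_Hom[OF dual_Hom(2) C.Id_in_Hom])
  have a: "Assoc C X ?D X \<in> Hom C ((X \<otimes>\<^sub>o ?D) \<otimes>\<^sub>o X) (X \<otimes>\<^sub>o ?D \<otimes>\<^sub>o X)"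
    by (rule C.iso_mor_in_Hom[OF C.Assoc_iso])
  have r: "RUnit C X \<in> Hom C (X \<otimes>\<^sub>o ?I) X" by (rule C.iso_mor_in_Hom[OF C.RUnit_iso])
  have l: "LUnit_inv C X \<in> Hom C X (?I \<otimes>\<^sub>o X)"
    unfolding LUnit_inv_def by (rule C.inv_mor(1)[OF C.LUnit_iso])
  have pent: "(Id C X \<triangleright> massoc_inv ?D X V) \<circ>\<^sub>M MAssoc M X ?D (X \<rhd> V)
     = MAssoc M X (?D \<otimes>\<^sub>o X) V \<circ>\<^sub>M ((Assoc C X ?D X \<triangleright> Id M V) \<circ>\<^sub>M massoc_inv (X \<otimes>\<^sub>o ?D) X V)"
  proof -
    have "(MAssoc M X (?D \<otimes>\<^sub>o X) V \<circ>\<^sub>M (Assoc C X ?D X \<triangleright> Id M V)) \<circ>\<^sub>M massoc_inv (X \<otimes>\<^sub>o ?D) X V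
      = inv_mor M (X \<rhd> ((?D \<otimes>\<^sub>o X) \<rhd> V)) (X \<rhd> ?D \<rhd> (X \<rhd> V)) (Id C X \<triangleright> MAssoc M ?D X V) \<circ>\<^sub>M MAssoc M X ?D (X \<rhd> V)"
      by (rule M.inverse_square[OF MAssoc_iso act_Id_left_iso(1)[OF MAssoc_iso]
          M.Comp_in_Hom[OF act_Id_right_Hom[OF a] MAssoc_Hom] MAssoc_Hom module_pentagon])
    then show ?thesis
      by (simp add: act_Id_left_iso(2)[OF MAssoc_iso]
          M.Comp_assoc[OF massoc_inv(1) act_Id_right_Hom[OF a] MAssoc_Hom])
  qed
  have sq2: "massoc_inv (X \<otimes>\<^sub>o ?D) X V \<circ>\<^sub>M (Coev C X \<triangleright> Id M (X \<rhd> V))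
     = ((Coev C X \<otimes>\<^sub>m Id C X) \<triangleright> Id M V) \<circ>\<^sub>M massoc_inv ?I X V"
    by (rule M.inverse_square[OF MAssoc_iso MAssoc_iso act_Id_right_Hom[OF kx] act_Id_right_Hom[OF dual_Hom(2)],
        OF MAssoc_natural[OF dual_Hom(2) C.Id_in_Hom M.Id_in_Hom, unfolded ActM_Id], symmetric])
  have sq3: "massoc_inv ?I X V \<circ>\<^sub>M munit_inv (X \<rhd> V) = LUnit_inv C X \<triangleright> Id M V"
    using M.iso_mor_Comp(2)[OF MAssoc_iso MUnit_iso, of X V] act_Id_right_iso(2)[OF C.LUnit_iso, of X V]
    by (simp add: unit_act_coherence LUnit_inv_def)
  have sq4: "(Id C X \<triangleright> (Ev C X \<triangleright> Id M V)) \<circ>\<^sub>M MAssoc M X (?D \<otimes>\<^sub>o X) V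
     = MAssoc M X ?I V \<circ>\<^sub>M ((Id C X \<otimes>\<^sub>m Ev C X) \<triangleright> Id M V)"
    by (rule MAssoc_natural[OF C.Id_in_Hom dual_Hom(1) M.Id_in_Hom, symmetric])
  show ?thesis
    by (subst M.paste_zigzag[OF munit_inv(1) act_Id_right_Hom[OF dual_Hom(2)] MAssoc_Hom
          act_Id_left_Hom[OF massoc_inv(1)] act_Id_left_Hom[OF act_Id_right_Hom[OF dual_Hom(1)]]
          act_Id_left_Hom[OF MUnit_Hom] massoc_inv(1) act_Id_right_Hom[OF kx] massoc_inv(1)
          act_Id_right_Hom[OF a] MAssoc_Hom act_Id_right_Hom[OF xe] MAssoc_Hom
          pent sq2 sq3 sq4 module_triangle])
      (simp only: act_Id_right_Comp5[OF l kx a xe r] dual_zigzag(1) ActM_Id)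
qed

lemma act_zigzag2:
  "MUnit M (Dual C X \<rhd> U) \<circ>\<^sub>M (Ev C X \<triangleright> Id M (Dual C X \<rhd> U)) \<circ>\<^sub>M massoc_inv (Dual C X) X (Dual C X \<rhd> U) \<circ>\<^sub>M
     (Id C (Dual C X) \<triangleright> MAssoc M X (Dual C X) U) \<circ>\<^sub>M (Id C (Dual C X) \<triangleright> (Coev C X \<triangleright> Id M U)) \<circ>\<^sub>M
     (Id C (Dual C X) \<triangleright> munit_inv U) = Id M (Dual C X \<rhd> U)"
proof -
  let ?D = "Dual C X" and ?I = "Unit C"
  have ed: "Ev C X \<otimes>\<^sub>m Id C ?D \<in> Hom C ((?D \<otimes>\<^sub>o X) \<otimes>\<^sub>o ?D) (?I \<otimes>\<^sub>o ?D)"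
    by (rule C.TensM_in_Hom[OF dual_Hom(1) C.Id_in_Hom])
  have dk: "Id C ?D \<otimes>\<^sub>m Coev C X \<in> Hom C (?D \<otimes>\<^sub>o ?I) (?D \<otimes>\<^sub>o X \<otimes>\<^sub>o ?D)"
    by (rule C.TensM_in_Hom[OF C.Id_in_Hom dual_Hom(2)])
  have a: "Assoc_inv C ?D X ?D \<in> Hom C (?D \<otimes>\<^sub>o X \<otimes>\<^sub>o ?D) ((?D \<otimes>\<^sub>o X) \<otimes>\<^sub>o ?D)"
    unfolding Assoc_inv_def by (rule C.inv_mor(1)[OF C.Assoc_iso])
  have r: "RUnit_inv C ?D \<in> Hom C ?D (?D \<otimes>\<^sub>o ?I)"
    unfolding RUnit_inv_def by (rule C.inv_mor(1)[OF C.RUnit_iso])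
  have l: "LUnit C ?D \<in> Hom C (?I \<otimes>\<^sub>o ?D) ?D" by (rule C.iso_mor_in_Hom[OF C.LUnit_iso])
  have pent: "massoc_inv ?D X (?D \<rhd> U) \<circ>\<^sub>M (Id C ?D \<triangleright> MAssoc M X ?D U)
     = MAssoc M (?D \<otimes>\<^sub>o X) ?D U \<circ>\<^sub>M ((Assoc_inv C ?D X ?D \<triangleright> Id M U) \<circ>\<^sub>M massoc_inv ?D (X \<otimes>\<^sub>o ?D) U)"
  proof -
    let ?b = "MAssoc M ?D (X \<otimes>\<^sub>o ?D) U" and ?c = "Assoc C ?D X ?D \<triangleright> Id M U"
    note c = C.iso_mor_in_Hom[OF C.Assoc_iso, of ?D X ?D]
    have iso: "iso_mor M (((?D \<otimes>\<^sub>o X) \<otimes>\<^sub>o ?D) \<rhd> U) (?D \<rhd> ((X \<otimes>\<^sub>o ?D) \<rhd> U)) (?b \<circ>\<^sub>M ?c)"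
      by (rule M.iso_mor_Comp(1)[OF act_Id_right_iso(1)[OF C.Assoc_iso] MAssoc_iso])
    have "MAssoc M ?D X (?D \<rhd> U) \<circ>\<^sub>M MAssoc M (?D \<otimes>\<^sub>o X) ?D U = (Id C ?D \<triangleright> MAssoc M X ?D U) \<circ>\<^sub>M (?b \<circ>\<^sub>M ?c)"
      by (rule module_pentagon[symmetric])
    then have "MAssoc M (?D \<otimes>\<^sub>o X) ?D U \<circ>\<^sub>M
        inv_mor M (((?D \<otimes>\<^sub>o X) \<otimes>\<^sub>o ?D) \<rhd> U) (?D \<rhd> ((X \<otimes>\<^sub>o ?D) \<rhd> U)) (?b \<circ>\<^sub>M ?c)
      = massoc_inv ?D X (?D \<rhd> U) \<circ>\<^sub>M (Id C ?D \<triangleright> MAssoc M X ?D U)"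
      by (rule M.inverse_square[OF iso MAssoc_iso MAssoc_Hom act_Id_left_Hom[OF MAssoc_Hom]])
    then show ?thesis
      by (simp add: M.iso_mor_Comp(2)[OF act_Id_right_iso(1)[OF C.Assoc_iso] MAssoc_iso]
          act_Id_right_iso(2)[OF C.Assoc_iso] Assoc_inv_def)
  qed
  have sq2: "massoc_inv ?D (X \<otimes>\<^sub>o ?D) U \<circ>\<^sub>M (Id C ?D \<triangleright> (Coev C X \<triangleright> Id M U))
     = ((Id C ?D \<otimes>\<^sub>m Coev C X) \<triangleright> Id M U) \<circ>\<^sub>M massoc_inv ?D ?I U"
    by (rule M.inverse_square[OF MAssoc_iso MAssoc_iso act_Id_right_Hom[OF dk]
          act_Id_left_Hom[OF act_Id_right_Hom[OF dual_Hom(2)]],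
        OF MAssoc_natural[OF C.Id_in_Hom dual_Hom(2) M.Id_in_Hom], symmetric])
  have sq3: "massoc_inv ?D ?I U \<circ>\<^sub>M (Id C ?D \<triangleright> munit_inv U) = RUnit_inv C ?D \<triangleright> Id M U"
    using M.iso_mor_Comp(2)[OF MAssoc_iso act_Id_left_iso(1)[OF MUnit_iso], of ?D U]
      act_Id_right_iso(2)[OF C.RUnit_iso, of ?D U]
    by (simp add: module_triangle act_Id_left_iso(2)[OF MUnit_iso] RUnit_inv_def)
  have sq4: "(Ev C X \<triangleright> Id M (?D \<rhd> U)) \<circ>\<^sub>M MAssoc M (?D \<otimes>\<^sub>o X) ?D U
     = MAssoc M ?I ?D U \<circ>\<^sub>M ((Ev C X \<otimes>\<^sub>m Id C ?D) \<triangleright> Id M U)"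
    using MAssoc_natural[OF dual_Hom(1) C.Id_in_Hom M.Id_in_Hom] by (simp add: ActM_Id)
  show ?thesis
    by (subst M.paste_zigzag[OF act_Id_left_Hom[OF munit_inv(1)] act_Id_left_Hom[OF act_Id_right_Hom[OF dual_Hom(2)]]
          act_Id_left_Hom[OF MAssoc_Hom] massoc_inv(1) act_Id_right_Hom[OF dual_Hom(1)] MUnit_Hom
          massoc_inv(1) act_Id_right_Hom[OF dk] massoc_inv(1) act_Id_right_Hom[OF a] MAssoc_Hom
          act_Id_right_Hom[OF ed] MAssoc_Hom pent sq2 sq3 sq4 unit_act_coherence])
      (simp only: act_Id_right_Comp5[OF r dk a ed l] dual_zigzag(2) ActM_Id)
qed

text \<open>The adjunction of the actions of \<open>X\<^sup>*\<close> and \<open>X\<close>: mutually inverse maps between \<open>Hom (U, X \<otimes> V)\<close> and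
  \<open>Hom (X\<^sup>* \<otimes> U, V)\<close>.\<close>

definition ev_transpose where
  "ev_transpose X V q =
     MUnit M V \<circ>\<^sub>M (Ev C X \<triangleright> Id M V) \<circ>\<^sub>M massoc_inv (Dual C X) X V \<circ>\<^sub>M (Id C (Dual C X) \<triangleright> q)"

definition coev_transpose where
  "coev_transpose X U p =
     (Id C X \<triangleright> p) \<circ>\<^sub>M MAssoc M X (Dual C X) U \<circ>\<^sub>M (Coev C X \<triangleright> Id M U) \<circ>\<^sub>M munit_inv U"

lemma ev_transpose_Hom:
  assumes "q \<in> Hom M U (X \<rhd> V)" shows "ev_transpose X V q \<in> Hom M (Dual C X \<rhd> U) V"
  unfolding ev_transpose_def
  by (rule M.Comp_in_Hom[OF M.Comp_in_Hom[OF M.Comp_in_Hom[OF act_Id_left_Hom[OF assms] massoc_inv(1)]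
          act_Id_right_Hom[OF dual_Hom(1)]] MUnit_Hom])

lemma coev_transpose_Hom:
  assumes "p \<in> Hom M (Dual C X \<rhd> U) V" shows "coev_transpose X U p \<in> Hom M U (X \<rhd> V)"
  unfolding coev_transpose_def
  by (rule M.Comp_in_Hom[OF M.Comp_in_Hom[OF M.Comp_in_Hom[OF munit_inv(1) act_Id_right_Hom[OF dual_Hom(2)]]
          MAssoc_Hom] act_Id_left_Hom[OF assms]])

text \<open>By naturality \<open>q\<close> slides to the right end of the composite, where it leaves a zigzag behind. In the
  converse \<open>p\<close> slides to the left end.\<close>

lemma coev_transpose_ev_transpose:
  assumes q: "q \<in> Hom M U (X \<rhd> V)"
  shows "coev_transpose X U (ev_transpose X V q) = q"
proof -
  let ?D = "Dual C X" and ?W = "X \<rhd> V" and ?x = "Id C X"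
  let ?c = "?x \<triangleright> MUnit M V" and ?e = "?x \<triangleright> (Ev C X \<triangleright> Id M V)" and ?b = "?x \<triangleright> massoc_inv ?D X V"
  let ?k = "Coev C X \<triangleright> Id M U" and ?k' = "Coev C X \<triangleright> Id M ?W"
  note c = act_Id_left_Hom[OF MUnit_Hom, of X V]
    and e = act_Id_left_Hom[OF act_Id_right_Hom[OF dual_Hom(1)], of X X V]
    and b = act_Id_left_Hom[OF massoc_inv(1), of X ?D X V]
    and k = act_Id_right_Hom[OF dual_Hom(2), of X U] and k' = act_Id_right_Hom[OF dual_Hom(2), of X ?W]
    and dq = act_Id_left_Hom[OF q, of ?D]
  note xdq = act_Id_left_Hom[OF dq, of X]
  let ?r = "MAssoc M X ?D U \<circ>\<^sub>M ?k \<circ>\<^sub>M munit_inv U"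
  note kn = M.Comp_in_Hom[OF munit_inv(1) k] 
  note r = M.Comp_in_Hom[OF kn MAssoc_Hom]
  note b1 = massoc_inv(1)[of ?D X V] and e1 = act_Id_right_Hom[OF dual_Hom(1), of X V]
  note bdq = M.Comp_in_Hom[OF dq b1]
  have "?x \<triangleright> ev_transpose X V q = ?c \<circ>\<^sub>M ?e \<circ>\<^sub>M ?b \<circ>\<^sub>M (?x \<triangleright> (Id C ?D \<triangleright> q))"
    unfolding ev_transpose_def
    by (simp add: act_Id_left_Comp[OF M.Comp_in_Hom[OF bdq e1] MUnit_Hom] act_Id_left_Comp[OF bdq e1]
        act_Id_left_Comp[OF dq b1])
  then have "coev_transpose X U (ev_transpose X V q) = ?c \<circ>\<^sub>M ?e \<circ>\<^sub>M ?b \<circ>\<^sub>M (?x \<triangleright> (Id C ?D \<triangleright> q)) \<circ>\<^sub>M ?r"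
    unfolding coev_transpose_def
    by (simp add: M.Comp_assoc[OF r M.Comp_in_Hom[OF M.Comp_in_Hom[OF xdq b] e] c]
        M.Comp_assoc[OF r M.Comp_in_Hom[OF xdq b] e] M.Comp_assoc[OF r xdq b])
  also have "(?x \<triangleright> (Id C ?D \<triangleright> q)) \<circ>\<^sub>M ?r = MAssoc M X ?D ?W \<circ>\<^sub>M (Id C (X \<otimes>\<^sub>o ?D) \<triangleright> q) \<circ>\<^sub>M ?k \<circ>\<^sub>M munit_inv U"
    using M.Comp_cong_left[OF MAssoc_natural[OF C.Id_in_Hom C.Id_in_Hom q, symmetric] kn MAssoc_Hom xdq _ MAssoc_Hom]
      act_Id_left_Hom[OF q] by (simp add: C.TensM_Id)
  also have "(Id C (X \<otimes>\<^sub>o ?D) \<triangleright> q) \<circ>\<^sub>M ?k \<circ>\<^sub>M munit_inv U = ?k' \<circ>\<^sub>M (Id C (Unit C) \<triangleright> q) \<circ>\<^sub>M munit_inv U"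
    by (rule M.Comp_cong_left[OF _ munit_inv(1) k act_Id_left_Hom[OF q] act_Id_left_Hom[OF q] k'])
      (simp add: act_interchange[OF dual_Hom(2) q])
  also have "(Id C (Unit C) \<triangleright> q) \<circ>\<^sub>M munit_inv U = munit_inv ?W \<circ>\<^sub>M q"
    by (rule M.inverse_square[OF MUnit_iso MUnit_iso act_Id_left_Hom[OF q] q MUnit_natural[OF q]])
  also have "?c \<circ>\<^sub>M ?e \<circ>\<^sub>M ?b \<circ>\<^sub>M MAssoc M X ?D ?W \<circ>\<^sub>M ?k' \<circ>\<^sub>M munit_inv ?W \<circ>\<^sub>M q
      = (?c \<circ>\<^sub>M ?e \<circ>\<^sub>M ?b \<circ>\<^sub>M MAssoc M X ?D ?W \<circ>\<^sub>M ?k' \<circ>\<^sub>M munit_inv ?W) \<circ>\<^sub>M q"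
  proof -
    note h1 = M.Comp_in_Hom[OF munit_inv(1) k']
    note h2 = M.Comp_in_Hom[OF h1 MAssoc_Hom]
    note h3 = M.Comp_in_Hom[OF h2 b]
    note h4 = M.Comp_in_Hom[OF h3 e]
    show ?thesis
      by (simp add: M.Comp_assoc[OF q munit_inv(1) k'] M.Comp_assoc[OF q h1 MAssoc_Hom]
          M.Comp_assoc[OF q h2 b] M.Comp_assoc[OF q h3 e] M.Comp_assoc[OF q h4 c])
  qed
  also have "\<dots> = q" by (simp only: act_zigzag1 M.Comp_Id_left[OF q])
  finally show ?thesis .
qed

lemma ev_transpose_coev_transpose:
  assumes p: "p \<in> Hom M (Dual C X \<rhd> U) V"
  shows "ev_transpose X V (coev_transpose X U p) = p"
proof -
  let ?D = "Dual C X" and ?d = "Id C (Dual C X)"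
  let ?W = "?D \<rhd> U"
  let ?A = "?d \<triangleright> MAssoc M X ?D U" and ?k = "?d \<triangleright> (Coev C X \<triangleright> Id M U)" and ?n = "?d \<triangleright> munit_inv U"
  let ?e = "Ev C X \<triangleright> Id M V" and ?e' = "Ev C X \<triangleright> Id M ?W"
  note A = act_Id_left_Hom[OF MAssoc_Hom, of ?D X ?D U]
    and k = act_Id_left_Hom[OF act_Id_right_Hom[OF dual_Hom(2)], of ?D X U]
    and n = act_Id_left_Hom[OF munit_inv(1), of ?D U]
    and e = act_Id_right_Hom[OF dual_Hom(1), of X V] and e' = act_Id_right_Hom[OF dual_Hom(1), of X ?W]
    and xp = act_Id_left_Hom[OF p, of X] and k1 = act_Id_right_Hom[OF dual_Hom(2), of X U]
  note dxp = act_Id_left_Hom[OF xp, of ?D]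
  note kn1 = M.Comp_in_Hom[OF munit_inv(1) k1]
  note r1 = M.Comp_in_Hom[OF kn1 MAssoc_Hom]
  note kn = M.Comp_in_Hom[OF n k]
  note r = M.Comp_in_Hom[OF kn A]
  let ?r = "?A \<circ>\<^sub>M ?k \<circ>\<^sub>M ?n"
  have "?d \<triangleright> coev_transpose X U p = (?d \<triangleright> (Id C X \<triangleright> p)) \<circ>\<^sub>M ?r"
    unfolding coev_transpose_def
    by (simp add: act_Id_left_Comp[OF r1 xp] act_Id_left_Comp[OF kn1 MAssoc_Hom]
        act_Id_left_Comp[OF munit_inv(1) k1])
  then have "ev_transpose X V (coev_transpose X U p)
      = MUnit M V \<circ>\<^sub>M ?e \<circ>\<^sub>M massoc_inv ?D X V \<circ>\<^sub>M (?d \<triangleright> (Id C X \<triangleright> p)) \<circ>\<^sub>M ?r"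
    unfolding ev_transpose_def by simp
  also have "massoc_inv ?D X V \<circ>\<^sub>M (?d \<triangleright> (Id C X \<triangleright> p)) \<circ>\<^sub>M ?r
      = (Id C (?D \<otimes>\<^sub>o X) \<triangleright> p) \<circ>\<^sub>M massoc_inv ?D X ?W \<circ>\<^sub>M ?r"
  proof (rule M.Comp_cong_left[OF _ r dxp massoc_inv(1) massoc_inv(1) act_Id_left_Hom[OF p]])
    show "massoc_inv ?D X V \<circ>\<^sub>M (?d \<triangleright> (Id C X \<triangleright> p)) = (Id C (?D \<otimes>\<^sub>o X) \<triangleright> p) \<circ>\<^sub>M massoc_inv ?D X ?W"
      by (rule M.inverse_square[OF MAssoc_iso MAssoc_iso act_Id_left_Hom[OF p] dxp, symmetric])
        (use MAssoc_natural[OF C.Id_in_Hom C.Id_in_Hom p, of ?D X] in \<open>simp add: C.TensM_Id\<close>)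
  qed
  also have "?e \<circ>\<^sub>M (Id C (?D \<otimes>\<^sub>o X) \<triangleright> p) \<circ>\<^sub>M massoc_inv ?D X ?W \<circ>\<^sub>M ?r
      = (Id C (Unit C) \<triangleright> p) \<circ>\<^sub>M ?e' \<circ>\<^sub>M massoc_inv ?D X ?W \<circ>\<^sub>M ?r"
    by (rule M.Comp_cong_left[OF _ M.Comp_in_Hom[OF r massoc_inv(1)] act_Id_left_Hom[OF p] e e' act_Id_left_Hom[OF p]])
      (simp add: act_interchange[OF dual_Hom(1) p])
  also have "MUnit M V \<circ>\<^sub>M (Id C (Unit C) \<triangleright> p) \<circ>\<^sub>M ?e' \<circ>\<^sub>M massoc_inv ?D X ?W \<circ>\<^sub>M ?r
      = p \<circ>\<^sub>M MUnit M ?W \<circ>\<^sub>M ?e' \<circ>\<^sub>M massoc_inv ?D X ?W \<circ>\<^sub>M ?r"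
    by (rule M.Comp_cong_left[OF MUnit_natural[OF p] M.Comp_in_Hom[OF M.Comp_in_Hom[OF r massoc_inv(1)] e']
          act_Id_left_Hom[OF p] MUnit_Hom MUnit_Hom p])
  also have "\<dots> = p" by (simp only: act_zigzag2 M.Comp_Id_right[OF p])
  finally show ?thesis .
qed

end

section \<open>The fibre functor and its duality pairing\<close>

lemma sum_apply: "(\<Sum>x\<in>A. f x) y = (\<Sum>x\<in>A. f x y)"
  by (induction A rule: infinite_finite_induct) simp_all

locale fibre_setting = semisimple_module_category C M
  for C :: "('k::alg_closed_field, 'o, 'm::ab_group_add, 'z) tencat_scheme" (structure)
    and M :: "('k, 'u, 'n::ab_group_add, 'o, 'm, 'w) modcat_scheme" +
  fixes S :: "'i::finite \<Rightarrow> 'u"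
  assumes simples_S: "representative_simples M S"
begin

lemma simple_S: "simple_object M (S i)"
  using simples_S by (simp add: representative_simples_def)

lemma absolutely_simple_S: "absolutely_simple M (S i)"
  by (rule simple_imp_absolutely_simple[OF M.locally_finite_category_axioms simple_S])

lemma Id_S_nonzero: "Id M (S i) \<noteq> 0"
  by (rule M.simple_object_Id_nonzero[OF simple_S])

lemma vector_space_Fib_scale: "vector_space (Fib_scale M)"
  by standard
    (simp_all add: Fib_scale_def fun_eq_iff M.V.scale_right_distrib M.V.scale_left_distrib)

sublocale F: vector_space "Fib_scale M"
  by (rule vector_space_Fib_scale)

lemma Fib_scale_apply: "Fib_scale M c v i j = Scale M c (v i j)"
  by (simp add: Fib_scale_def)

lemma Fib_subspace: "F.subspace (Fib M S X)"
  by (rule F.subspaceI) (auto simp: Fib_def Fib_scale_def M.Hom_zero M.Hom_add M.Hom_scale)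

lemmas Fib_zero = F.subspace_0[OF Fib_subspace]
  and Fib_add = F.subspace_add[OF Fib_subspace]
  and Fib_scale_closed = F.subspace_scale[OF Fib_subspace]
  and Fib_sum = F.subspace_sum[OF Fib_subspace]

lemma Fib_component: "v \<in> Fib M S X \<Longrightarrow> v i j \<in> Hom M (S j) (X \<rhd> S i)"
  by (simp add: Fib_def)

lemma Fib_map_apply: "Fib_map M S f v i j = (f \<triangleright> Id M (S i)) \<circ>\<^sub>M v i j"
  by (simp add: Fib_map_def)

lemma Fib_map_closed:
  assumes "f \<in> Hom C X Y" "v \<in> Fib M S X"
  shows "Fib_map M S f v \<in> Fib M S Y"
  using M.Comp_in_Hom[OF Fib_component[OF assms(2)] act_Id_right_Hom[OF assms(1)]]
  by (simp add: Fib_map_def Fib_def)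

definition single :: "'i \<Rightarrow> 'i \<Rightarrow> 'n \<Rightarrow> 'i \<Rightarrow> 'i \<Rightarrow> 'n" where
  "single i j w = (\<lambda>i' j'. if i' = i \<and> j' = j then w else 0)"

lemma single_closed: "w \<in> Hom M (S j) (X \<rhd> S i) \<Longrightarrow> single i j w \<in> Fib M S X"
  by (auto simp: single_def Fib_def M.Hom_zero)

lemma single_add: "single i j (w + w') = single i j w + single i j w'"
  and single_scale: "single i j (Scale M c w) = Fib_scale M c (single i j w)"
  by (auto simp: single_def Fib_scale_def fun_eq_iff)

lemma sum_single: "(\<Sum>i\<in>UNIV. \<Sum>j\<in>UNIV. single i j (v i j)) = v"
proof (intro ext)
  fix a b
  have "(\<Sum>i\<in>UNIV. \<Sum>j\<in>UNIV. single i j (v i j)) a b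
      = (\<Sum>i\<in>UNIV. \<Sum>j\<in>UNIV. if j = b then (if i = a then v i j else 0) else 0)"
    unfolding sum_apply by (intro sum.cong refl) (auto simp: single_def)
  then show "(\<Sum>i\<in>UNIV. \<Sum>j\<in>UNIV. single i j (v i j)) a b = v a b" by simp
qed

definition coef :: "'i \<Rightarrow> 'n \<Rightarrow> 'k" where
  "coef j f = (THE c. f = Scale M c (Id M (S j)))"

lemma coef_scale_Id: "coef j (Scale M c (Id M (S j))) = c"
  unfolding coef_def using Id_S_nonzero[of j] by (intro the_equality) auto

lemma coef:
  assumes "f \<in> Hom M (S j) (S j)"
  shows "f = Scale M (coef j f) (Id M (S j))"
proof -
  obtain c where "f = Scale M c (Id M (S j))"
    using absolutely_simple_S assms by (auto simp: absolutely_simple_def)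
  then show ?thesis by (simp add: coef_scale_Id)
qed

lemma coef_add:
  assumes "f \<in> Hom M (S j) (S j)" "g \<in> Hom M (S j) (S j)"
  shows "coef j (f + g) = coef j f + coef j g"
  using coef[OF assms(1)] coef[OF assms(2)] coef_scale_Id M.V.scale_left_distrib by metis

lemma coef_scale:
  assumes "f \<in> Hom M (S j) (S j)"
  shows "coef j (Scale M c f) = c * coef j f"
  using coef[OF assms] coef_scale_Id M.V.scale_scale by metis

lemma coef_zero: "coef j 0 = 0"
  using coef_scale_Id[of j 0] by simp

lemma ev_transpose_add:
  assumes "q \<in> Hom M U (X \<rhd> V)" "q' \<in> Hom M U (X \<rhd> V)"
  shows "ev_transpose X V (q + q') = ev_transpose X V q + ev_transpose X V q'"
proof -
  note t = massoc_inv(1) act_Id_right_Hom[OF dual_Hom(1)] MUnit_Hom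
  note h = act_Id_left_Hom[OF assms(1)] act_Id_left_Hom[OF assms(2)]
  note b = M.Comp_in_Hom[OF h(1) t(1)] M.Comp_in_Hom[OF h(2) t(1)]
  note e = M.Comp_in_Hom[OF b(1) t(2)] M.Comp_in_Hom[OF b(2) t(2)]
  show ?thesis
    unfolding ev_transpose_def
    by (simp add: ActM_add_right[OF C.Id_in_Hom assms] M.Comp_add_right[OF h t(1)]
        M.Comp_add_right[OF b t(2)] M.Comp_add_right[OF e t(3)])
qed

lemma ev_transpose_scale:
  assumes "q \<in> Hom M U (X \<rhd> V)"
  shows "ev_transpose X V (Scale M c q) = Scale M c (ev_transpose X V q)"
proof -
  note t = massoc_inv(1) act_Id_right_Hom[OF dual_Hom(1)] MUnit_Hom
  note h = act_Id_left_Hom[OF assms]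
  note b = M.Comp_in_Hom[OF h t(1)]
  note e = M.Comp_in_Hom[OF b t(2)]
  show ?thesis
    unfolding ev_transpose_def
    by (simp add: ActM_scale_right[OF C.Id_in_Hom assms] M.Comp_scale_right[OF h t(1)]
        M.Comp_scale_right[OF b t(2)] M.Comp_scale_right[OF e t(3)])
qed

lemma contract_eq:
  assumes p: "p \<in> Hom M (S j) (Dual C X \<rhd> S i)" and q: "q \<in> Hom M (S i) (X \<rhd> S j)"
  shows "contract C M S X j p q = ev_transpose X (S j) q \<circ>\<^sub>M p"
proof -
  note t = massoc_inv(1) act_Id_right_Hom[OF dual_Hom(1)] MUnit_Hom
  note h = act_Id_left_Hom[OF q]
  note b = M.Comp_in_Hom[OF h t(1)]
  note e = M.Comp_in_Hom[OF b t(2)]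
  show ?thesis
    unfolding contract_def ev_transpose_def
    by (simp add: M.Comp_assoc[OF p e t(3)] M.Comp_assoc[OF p b t(2)] M.Comp_assoc[OF p h t(1)])
qed

abbreviation matrix_pairing :: "'o \<Rightarrow> 'i \<Rightarrow> 'n \<Rightarrow> 'n \<Rightarrow> 'k" where
  "matrix_pairing X j p q \<equiv> coef j (ev_transpose X (S j) q \<circ>\<^sub>M p)"

lemma matrix_pairing_Hom:
  "p \<in> Hom M (S j) (Dual C X \<rhd> S i) \<Longrightarrow> q \<in> Hom M (S i) (X \<rhd> S j) \<Longrightarrow>
    ev_transpose X (S j) q \<circ>\<^sub>M p \<in> Hom M (S j) (S j)"
  by (rule M.Comp_in_Hom[OF _ ev_transpose_Hom])

text \<open>In terms of the adjunction the pairing is composition with the transpose of \<open>v\<close>, and therefore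
  inherits nondegeneracy from the composition pairing of \<open>M\<close>.\<close>

lemma Fib_pairing_eq:
  assumes "\<phi> \<in> Fib M S (Dual C X)" "v \<in> Fib M S X"
  shows "Fib_pairing C M S X \<phi> v = (\<Sum>i\<in>UNIV. \<Sum>j\<in>UNIV. matrix_pairing X j (\<phi> i j) (v j i))"
  unfolding Fib_pairing_def coef_def
  by (intro sum.cong refl) (simp add: contract_eq[OF Fib_component[OF assms(1)] Fib_component[OF assms(2)]])

lemma Fib_pairing_add_left:
  assumes "\<phi> \<in> Fib M S (Dual C X)" "\<phi>' \<in> Fib M S (Dual C X)" "v \<in> Fib M S X"
  shows "Fib_pairing C M S X (\<phi> + \<phi>') v = Fib_pairing C M S X \<phi> v + Fib_pairing C M S X \<phi>' v"
proof -
  note f = Fib_component[OF assms(1)] Fib_component[OF assms(2)]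
  note v = Fib_component[OF assms(3)]
  show ?thesis
    by (simp add: Fib_pairing_eq[OF _ assms(3)] assms Fib_add M.Comp_add_right[OF f ev_transpose_Hom[OF v]]
        coef_add[OF matrix_pairing_Hom[OF f(1) v] matrix_pairing_Hom[OF f(2) v]] sum.distrib)
qed

lemma Fib_pairing_scale_left:
  assumes "\<phi> \<in> Fib M S (Dual C X)" "v \<in> Fib M S X"
  shows "Fib_pairing C M S X (Fib_scale M c \<phi>) v = c * Fib_pairing C M S X \<phi> v"
proof -
  note f = Fib_component[OF assms(1)]
  note v = Fib_component[OF assms(2)]
  have "Fib_scale M c \<phi> i j = Scale M c (\<phi> i j)" for i j by (simp add: Fib_scale_def)
  then show ?thesis
    by (simp add: Fib_pairing_eq[OF _ assms(2)] assms Fib_scale_closed M.Comp_scale_right[OF f ev_transpose_Hom[OF v]]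
        coef_scale[OF matrix_pairing_Hom[OF f v]] sum_distrib_left)
qed

lemma Fib_pairing_add_right:
  assumes "\<phi> \<in> Fib M S (Dual C X)" "v \<in> Fib M S X" "v' \<in> Fib M S X"
  shows "Fib_pairing C M S X \<phi> (v + v') = Fib_pairing C M S X \<phi> v + Fib_pairing C M S X \<phi> v'"
proof -
  note f = Fib_component[OF assms(1)]
  note v = Fib_component[OF assms(2)] and v' = Fib_component[OF assms(3)]
  show ?thesis
    by (simp add: Fib_pairing_eq[OF assms(1)] assms Fib_add ev_transpose_add[OF v v']
        M.Comp_add_left[OF f ev_transpose_Hom[OF v] ev_transpose_Hom[OF v']]
        coef_add[OF matrix_pairing_Hom[OF f v] matrix_pairing_Hom[OF f v']] sum.distrib)
qed

lemma Fib_pairing_scale_right: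
  assumes "\<phi> \<in> Fib M S (Dual C X)" "v \<in> Fib M S X"
  shows "Fib_pairing C M S X \<phi> (Fib_scale M c v) = c * Fib_pairing C M S X \<phi> v"
proof -
  note f = Fib_component[OF assms(1)]
  note v = Fib_component[OF assms(2)]
  have "Fib_scale M c v i j = Scale M c (v i j)" for i j by (simp add: Fib_scale_def)
  then show ?thesis
    by (simp add: Fib_pairing_eq[OF assms(1)] assms Fib_scale_closed ev_transpose_scale[OF v]
        M.Comp_scale_left[OF f ev_transpose_Hom[OF v]]
        coef_scale[OF matrix_pairing_Hom[OF f v]] sum_distrib_left)
qed

lemma Fib_pairing_single:
  assumes p: "p \<in> Hom M (S j) (Dual C X \<rhd> S i)" and v: "v \<in> Fib M S X"
  shows "Fib_pairing C M S X (single i j p) v = matrix_pairing X j p (v j i)"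
proof -
  have "matrix_pairing X b (single i j p a b) (v b a)
      = (if b = j then (if a = i then matrix_pairing X j p (v j i) else 0) else 0)" for a b
    by (auto simp: single_def coef_zero M.Comp_zero_right[OF ev_transpose_Hom[OF Fib_component[OF v]]])
  then show ?thesis by (simp add: Fib_pairing_eq[OF single_closed[OF p] v])
qed

lemma Fib_pairing_nondegenerate:
  assumes u: "u \<in> Fib M S X" "u' \<in> Fib M S X"
    and eq: "\<And>\<phi>. \<phi> \<in> Fib M S (Dual C X) \<Longrightarrow> Fib_pairing C M S X \<phi> u = Fib_pairing C M S X \<phi> u'"
  shows "u = u'"
proof (intro ext)
  fix j i
  let ?D = "Dual C X"
  note c = Fib_component[OF u(1), of j i] Fib_component[OF u(2), of j i]
  let ?p = "ev_transpose X (S j) (u j i)" and ?p' = "ev_transpose X (S j) (u' j i)"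
  note p = ev_transpose_Hom[OF c(1)] ev_transpose_Hom[OF c(2)]
  have "?p - ?p' = 0"
  proof (rule M.semisimple_nondegenerate[OF semisimple simple_S M.Hom_diff[OF p]])
    fix x assume x: "x \<in> Hom M (S j) (?D \<rhd> S i)"
    have "matrix_pairing X j x (u j i) = matrix_pairing X j x (u' j i)"
      using eq[OF single_closed[OF x]] Fib_pairing_single[OF x] u by simp
    then have "?p \<circ>\<^sub>M x = ?p' \<circ>\<^sub>M x"
      using coef[OF matrix_pairing_Hom[OF x c(1)]] coef[OF matrix_pairing_Hom[OF x c(2)]] by simp
    then show "(?p - ?p') \<circ>\<^sub>M x = 0" using M.Comp_diff_left[OF x p] by simp
  qed
  then have "?p = ?p'" by simp
  then have "coev_transpose X (S i) ?p = coev_transpose X (S i) ?p'" by (rule arg_cong)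
  then show "u j i = u' j i"
    by (simp only: coev_transpose_ev_transpose[OF c(1)] coev_transpose_ev_transpose[OF c(2)])
qed

text \<open>On the summand \<open>(i, j)\<close> the functional is composition with some \<open>X\<^sup>* \<otimes> M\<^sub>i \<rightarrow> M\<^sub>j\<close>; transposing these
  morphisms gives the components of \<open>u\<close>.\<close>

lemma Fib_pairing_represents:
  assumes add: "\<And>\<phi> \<phi>'. \<phi> \<in> Fib M S (Dual C X) \<Longrightarrow> \<phi>' \<in> Fib M S (Dual C X) \<Longrightarrow> l (\<phi> + \<phi>') = l \<phi> + l \<phi>'"
    and scale: "\<And>c \<phi>. \<phi> \<in> Fib M S (Dual C X) \<Longrightarrow> l (Fib_scale M c \<phi>) = c * l \<phi>"
  shows "\<exists>u\<in>Fib M S X. \<forall>\<phi>\<in>Fib M S (Dual C X). Fib_pairing C M S X \<phi> u = (l \<phi> :: 'k)"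
proof -
  let ?D = "Dual C X"
  have "\<exists>\<psi>\<in>Hom M (?D \<rhd> S i) (S j). \<forall>x\<in>Hom M (S j) (?D \<rhd> S i). \<psi> \<circ>\<^sub>M x = Scale M (l (single i j x)) (Id M (S j))" for i j
    by (rule M.functional_represented[OF semisimple absolutely_simple_S])
      (simp_all add: single_add single_scale add scale single_closed)
  then obtain \<psi> where \<psi>: "\<And>i j. \<psi> i j \<in> Hom M (?D \<rhd> S i) (S j)"
    "\<And>i j x. x \<in> Hom M (S j) (?D \<rhd> S i) \<Longrightarrow> \<psi> i j \<circ>\<^sub>M x = Scale M (l (single i j x)) (Id M (S j))"
    by metis
  define u where "u = (\<lambda>j i. coev_transpose X (S i) (\<psi> i j))"
  have u: "u \<in> Fib M S X" using coev_transpose_Hom[OF \<psi>(1)] by (simp add: Fib_def u_def)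
  have l_sum: "l (sum f A) = (\<Sum>x\<in>A. l (f x))" if "\<And>x. f x \<in> Fib M S ?D" for f and A :: "'i set"
    using finite[of A]
  proof (induction A rule: finite_induct)
    case empty
    have "l 0 = 0" using scale[OF Fib_zero, of 0] by (simp only: F.scale_zero_left mult_zero_left)
    then show ?case by (simp only: sum.empty)
  next
    case (insert x A)
    have "sum f A \<in> Fib M S ?D" by (rule Fib_sum) (rule that)
    then show ?case by (simp only: sum.insert[OF insert.hyps] add[OF that] insert.IH)
  qed
  have "Fib_pairing C M S X \<phi> u = l \<phi>" if \<phi>: "\<phi> \<in> Fib M S ?D" for \<phi>
  proof -
    note f = Fib_component[OF \<phi>]
    note s = single_closed[OF f]
    have "Fib_pairing C M S X \<phi> u = (\<Sum>i\<in>UNIV. \<Sum>j\<in>UNIV. l (single i j (\<phi> i j)))"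
      unfolding Fib_pairing_eq[OF \<phi> u]
      by (simp add: u_def ev_transpose_coev_transpose[OF \<psi>(1)] \<psi>(2)[OF f] coef_scale_Id)
    also have "\<dots> = (\<Sum>i\<in>UNIV. l (\<Sum>j\<in>UNIV. single i j (\<phi> i j)))"
      by (intro sum.cong refl l_sum[symmetric] s)
    also have "\<dots> = l (\<Sum>i\<in>UNIV. \<Sum>j\<in>UNIV. single i j (\<phi> i j))"
      by (intro l_sum[symmetric] Fib_sum s)
    finally show ?thesis by (simp add: sum_single)
  qed
  then show ?thesis using u by blast
qed

lemma Fib_pairing_represents_unique:
  assumes "\<And>\<phi> \<phi>'. \<phi> \<in> Fib M S (Dual C X) \<Longrightarrow> \<phi>' \<in> Fib M S (Dual C X) \<Longrightarrow> l (\<phi> + \<phi>') = l \<phi> + l \<phi>'"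
    and "\<And>c \<phi>. \<phi> \<in> Fib M S (Dual C X) \<Longrightarrow> l (Fib_scale M c \<phi>) = c * l \<phi>"
  defines "r \<equiv> (THE u. u \<in> Fib M S X \<and> (\<forall>\<phi>\<in>Fib M S (Dual C X). Fib_pairing C M S X \<phi> u = l \<phi>))"
  shows "r \<in> Fib M S X" "\<And>\<phi>. \<phi> \<in> Fib M S (Dual C X) \<Longrightarrow> Fib_pairing C M S X \<phi> r = l \<phi>"
proof -
  obtain u where u: "u \<in> Fib M S X" "\<And>\<phi>. \<phi> \<in> Fib M S (Dual C X) \<Longrightarrow> Fib_pairing C M S X \<phi> u = l \<phi>"
    using Fib_pairing_represents[OF assms(1,2)] by blast
  have "r = u"
    unfolding r_def
  proof (rule the_equality)
    show "u \<in> Fib M S X \<and> (\<forall>\<phi>\<in>Fib M S (Dual C X). Fib_pairing C M S X \<phi> u = l \<phi>)" using u by blast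
    fix u' assume u': "u' \<in> Fib M S X \<and> (\<forall>\<phi>\<in>Fib M S (Dual C X). Fib_pairing C M S X \<phi> u' = l \<phi>)"
    show "u' = u"
    proof (rule Fib_pairing_nondegenerate[OF _ u(1)])
      show "u' \<in> Fib M S X" using u' by (rule conjunct1)
      fix \<phi> assume \<phi>: "\<phi> \<in> Fib M S (Dual C X)"
      show "Fib_pairing C M S X \<phi> u' = Fib_pairing C M S X \<phi> u"
        unfolding u(2)[OF \<phi>] by (rule bspec[OF conjunct2[OF u'] \<phi>])
    qed
  qed
  then show "r \<in> Fib M S X" "\<And>\<phi>. \<phi> \<in> Fib M S (Dual C X) \<Longrightarrow> Fib_pairing C M S X \<phi> r = l \<phi>" using u by simp_all
qed

section \<open>The square of the antipode\<close>

lemma antipode: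
  assumes e: "endo_on (Fib_scale M) (Fib M S (Dual C X)) (\<eta> (Dual C X))" and v: "v \<in> Fib M S X"
  shows "antipode C M S \<eta> X v \<in> Fib M S X"
    "\<phi> \<in> Fib M S (Dual C X) \<Longrightarrow>
      Fib_pairing C M S X \<phi> (antipode C M S \<eta> X v) = Fib_pairing C M S X (\<eta> (Dual C X) \<phi>) v"
proof -
  have e': "\<And>\<phi>. \<phi> \<in> Fib M S (Dual C X) \<Longrightarrow> \<eta> (Dual C X) \<phi> \<in> Fib M S (Dual C X)"
    "\<And>\<phi> \<phi>'. \<phi> \<in> Fib M S (Dual C X) \<Longrightarrow> \<phi>' \<in> Fib M S (Dual C X) \<Longrightarrow> \<eta> (Dual C X) (\<phi> + \<phi>') = \<eta> (Dual C X) \<phi> + \<eta> (Dual C X) \<phi>'"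
    "\<And>c \<phi>. \<phi> \<in> Fib M S (Dual C X) \<Longrightarrow> \<eta> (Dual C X) (Fib_scale M c \<phi>) = Fib_scale M c (\<eta> (Dual C X) \<phi>)"
    using e by (auto simp: endo_on_def)
  note r = Fib_pairing_represents_unique[of X "\<lambda>\<phi>. Fib_pairing C M S X (\<eta> (Dual C X) \<phi>) v"]
  show "antipode C M S \<eta> X v \<in> Fib M S X"
    unfolding antipode_def if_P[OF v]
    by (rule r(1)) (simp_all add: e' v Fib_pairing_add_left Fib_pairing_scale_left)
  show "Fib_pairing C M S X \<phi> (antipode C M S \<eta> X v) = Fib_pairing C M S X (\<eta> (Dual C X) \<phi>) v"
    if "\<phi> \<in> Fib M S (Dual C X)"
    unfolding antipode_def if_P[OF v]
    by (rule r(2)) (simp_all add: that e' v Fib_pairing_add_left Fib_pairing_scale_left)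
qed

lemma antipode_eqI:
  assumes e: "endo_on (Fib_scale M) (Fib M S (Dual C X)) (\<eta> (Dual C X))" and v: "v \<in> Fib M S X"
    and u: "u \<in> Fib M S X"
      "\<And>\<phi>. \<phi> \<in> Fib M S (Dual C X) \<Longrightarrow> Fib_pairing C M S X \<phi> u = Fib_pairing C M S X (\<eta> (Dual C X) \<phi>) v"
  shows "antipode C M S \<eta> X v = u"
  by (rule Fib_pairing_nondegenerate[OF antipode(1)[of X \<eta> v, OF e v] u(1)])
    (simp add: antipode(2)[of X \<eta> v, OF e v] u(2))

lemma antipode_endo_on:
  assumes "endo_on (Fib_scale M) (Fib M S (Dual C X)) (\<eta> (Dual C X))"
  shows "endo_on (Fib_scale M) (Fib M S X) (antipode C M S \<eta> X)"
proof -
  note a = antipode[of X \<eta>, OF assms]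
  have e: "\<eta> (Dual C X) \<phi> \<in> Fib M S (Dual C X)" if "\<phi> \<in> Fib M S (Dual C X)" for \<phi>
    using assms that by (simp add: endo_on_def)
  show ?thesis
    unfolding endo_on_def
  proof (intro conjI ballI allI)
    fix v w assume v: "v \<in> Fib M S X" and w: "w \<in> Fib M S X"
    show "antipode C M S \<eta> X (v + w) = antipode C M S \<eta> X v + antipode C M S \<eta> X w"
      by (rule antipode_eqI[of X \<eta>, OF assms Fib_add[OF v w] Fib_add[OF a(1)[OF v] a(1)[OF w]]])
        (simp add: Fib_pairing_add_right v w a e)
  next
    fix c v assume v: "v \<in> Fib M S X"
    show "antipode C M S \<eta> X (Fib_scale M c v) = Fib_scale M c (antipode C M S \<eta> X v)"
      by (rule antipode_eqI[of X \<eta>, OF assms Fib_scale_closed[OF v] Fib_scale_closed[OF a(1)[OF v]]])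
        (simp add: Fib_pairing_scale_right v a e)
  qed (rule a(1))
qed

lemma double_dual_iso:
  assumes w: "w \<in> Fib M S (Dual C (Dual C X))"
  shows "double_dual_iso C M S X w \<in> Fib M S X"
    "\<phi> \<in> Fib M S (Dual C X) \<Longrightarrow>
      Fib_pairing C M S X \<phi> (double_dual_iso C M S X w) = Fib_pairing C M S (Dual C X) w \<phi>"
  unfolding double_dual_iso_def
  by (rule Fib_pairing_represents_unique[of X "\<lambda>\<phi>. Fib_pairing C M S (Dual C X) w \<phi>"];
      simp add: w Fib_pairing_add_right Fib_pairing_scale_right)+

text \<open>Moving \<open>\<eta>\<close> across the pairing twice leads from \<open>X\<close> to \<open>X\<^sup>*\<^sup>*\<close>.\<close>

lemma antipode_square_double_dual:
  assumes e: "\<And>Y. endo_on (Fib_scale M) (Fib M S Y) (\<eta> Y)" and w: "w \<in> Fib M S (Dual C (Dual C X))"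
  shows "antipode C M S (antipode C M S \<eta>) X (double_dual_iso C M S X w)
    = double_dual_iso C M S X (\<eta> (Dual C (Dual C X)) w)"
proof -
  let ?D = "Dual C X" and ?s = "antipode C M S \<eta>"
  have ew: "\<eta> (Dual C ?D) w \<in> Fib M S (Dual C ?D)" using e w by (simp add: endo_on_def)
  have es: "endo_on (Fib_scale M) (Fib M S ?D) (?s ?D)" by (rule antipode_endo_on) (rule e)
  note a = antipode[of ?D \<eta>, OF e]
  show ?thesis
  proof (rule antipode_eqI[of X ?s, OF es double_dual_iso(1)[OF w] double_dual_iso(1)[OF ew]])
    fix \<phi> assume \<phi>: "\<phi> \<in> Fib M S ?D"
    have "Fib_pairing C M S X (?s ?D \<phi>) (double_dual_iso C M S X w) = Fib_pairing C M S ?D w (?s ?D \<phi>)"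
      by (rule double_dual_iso(2)[OF w a(1)[OF \<phi>]])
    also have "\<dots> = Fib_pairing C M S ?D (\<eta> (Dual C ?D) w) \<phi>" by (rule a(2)[OF \<phi> w])
    also have "\<dots> = Fib_pairing C M S X \<phi> (double_dual_iso C M S X (\<eta> (Dual C ?D) w))"
      by (rule double_dual_iso(2)[OF ew \<phi>, symmetric])
    finally show "Fib_pairing C M S X \<phi> (double_dual_iso C M S X (\<eta> (Dual C ?D) w))
      = Fib_pairing C M S X (?s ?D \<phi>) (double_dual_iso C M S X w)" by simp
  qed
qed

lemma H_carrier_D:
  assumes "\<eta> \<in> H_carrier C M S"
  shows "endo_on (Fib_scale M) (Fib M S X) (\<eta> X)" "v \<notin> Fib M S X \<Longrightarrow> \<eta> X v = 0"
    "f \<in> Hom C X Y \<Longrightarrow> v \<in> Fib M S X \<Longrightarrow> \<eta> Y (Fib_map M S f v) = Fib_map M S f (\<eta> X v)"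
    "v \<in> Fib M S X \<Longrightarrow> \<eta> X v \<in> Fib M S X"
    "v \<in> Fib M S X \<Longrightarrow> w \<in> Fib M S X \<Longrightarrow> \<eta> X (v + w) = \<eta> X v + \<eta> X w"
    "v \<in> Fib M S X \<Longrightarrow> \<eta> X (Fib_scale M c v) = Fib_scale M c (\<eta> X v)"
  using assms by (auto simp: H_carrier_def endo_on_def)

lemma H_carrier_zero: "\<eta> \<in> H_carrier C M S \<Longrightarrow> \<eta> X 0 = 0"
  using H_carrier_D(6)[OF _ Fib_zero, of \<eta> X 0] by simp

text \<open>The previous lemma for \<open>w = F(a\<^sub>X) v\<close>, with \<open>\<eta>\<close> moved through \<open>F(a\<^sub>X)\<close> by naturality.\<close>

lemma antipode_square_pivotal:
  assumes \<eta>: "\<eta> \<in> H_carrier C M S" and a: "a X \<in> Hom C X (Dual C (Dual C X))" and v: "v \<in> Fib M S X"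
  shows "antipode C M S (antipode C M S \<eta>) X (pivotal_element C M S a X v)
    = pivotal_element C M S a X (\<eta> X v)"
  using antipode_square_double_dual[of \<eta>, OF H_carrier_D(1)[OF \<eta>] Fib_map_closed[OF a v]]
    H_carrier_D(3)[OF \<eta> a v] H_carrier_D(4)[OF \<eta> v] v
  by (simp add: pivotal_element_def)

text \<open>The subalgebra generated by both bases of \<open>H\<close>: its elements act by scalars on the summands
  \<open>Hom (M\<^sub>j, X \<otimes> M\<^sub>i)\<close>.\<close>

definition base_elem :: "('i \<Rightarrow> 'i \<Rightarrow> 'k) \<Rightarrow> ('o, 'i, 'n) fib_end" where
  "base_elem t = (\<lambda>X v. if v \<in> Fib M S X then (\<lambda>i j. Scale M (t i j) (v i j)) else 0)"

lemma base_elem_closed: "v \<in> Fib M S X \<Longrightarrow> base_elem t X v \<in> Fib M S X"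
  by (simp add: base_elem_def Fib_def M.Hom_scale)

lemma base_elem_apply: "v \<in> Fib M S X \<Longrightarrow> base_elem t X v i j = Scale M (t i j) (v i j)"
  by (simp add: base_elem_def)

lemma base_elem_in_H: "base_elem t \<in> H_carrier C M S"
  unfolding H_carrier_def mem_Collect_eq
proof (intro conjI allI ballI impI)
  show "endo_on (Fib_scale M) (Fib M S X) (base_elem t X)" for X
    unfolding endo_on_def
  proof (intro conjI ballI allI)
    fix v w assume "v \<in> Fib M S X" "w \<in> Fib M S X"
    then show "base_elem t X (v + w) = base_elem t X v + base_elem t X w"
      by (intro ext) (simp add: base_elem_apply Fib_add M.V.scale_right_distrib)
  next
    fix c v assume "v \<in> Fib M S X"
    then show "base_elem t X (Fib_scale M c v) = Fib_scale M c (base_elem t X v)"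
      by (intro ext) (simp add: base_elem_apply Fib_scale_closed Fib_scale_apply mult.commute)
  qed (rule base_elem_closed)
  show "base_elem t X v = 0" if "v \<notin> Fib M S X" for X v using that by (simp add: base_elem_def)
  fix X Y f v assume f: "f \<in> Hom C X Y" and v: "v \<in> Fib M S X"
  show "base_elem t Y (Fib_map M S f v) = Fib_map M S f (base_elem t X v)"
    by (intro ext)
      (simp add: base_elem_apply Fib_map_closed[OF f v] v Fib_map_apply
        M.Comp_scale_right[OF Fib_component[OF v] act_Id_right_Hom[OF f]])
qed

lemma base_elem_mult: "base_elem s \<star> base_elem t = base_elem (\<lambda>i j. s i j * t i j)"
proof (intro ext)
  fix X v i j
  show "(base_elem s \<star> base_elem t) X v i j = base_elem (\<lambda>i j. s i j * t i j) X v i j"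
    using base_elem_closed[of v X t] Fib_zero[of X]
    by (cases "v \<in> Fib M S X") (simp_all add: H_mult_def base_elem_def)
qed

lemma H_one_eq: "H_one M S = base_elem (\<lambda>i j. 1)"
  by (simp add: H_one_def base_elem_def fun_eq_iff)

lemma H_one_mult:
  assumes "\<eta> \<in> H_carrier C M S"
  shows "H_one M S \<star> \<eta> = \<eta>" "\<eta> \<star> H_one M S = \<eta>"
proof -
  show "H_one M S \<star> \<eta> = \<eta>"
  proof (intro ext)
    fix X v i j
    show "(H_one M S \<star> \<eta>) X v i j = \<eta> X v i j"
      using H_carrier_D(2,4)[OF assms, of v X] Fib_zero
      by (cases "v \<in> Fib M S X") (simp_all add: H_mult_def H_one_def)
  qed
  show "\<eta> \<star> H_one M S = \<eta>"
  proof (intro ext)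
    fix X v i j
    show "(\<eta> \<star> H_one M S) X v i j = \<eta> X v i j"
      using H_carrier_D(2)[OF assms, of v X] H_carrier_zero[OF assms]
      by (cases "v \<in> Fib M S X") (simp_all add: H_mult_def H_one_def)
  qed
qed

lemma H_mult_assoc: "(x \<star> y) \<star> z = x \<star> (y \<star> z)"
  by (simp add: H_mult_def)

lemma H_inv_eqI:
  assumes "H_is_inverse C M S x y"
  shows "H_inv C M S x = y"
  unfolding H_inv_def
proof (rule the_equality)
  show "H_is_inverse C M S x y" by (rule assms)
  fix z assume z: "H_is_inverse C M S x z"
  have xyz: "y \<star> x = H_one M S" "x \<star> z = H_one M S" "y \<in> H_carrier C M S" "z \<in> H_carrier C M S"
    using assms z by (simp_all add: H_is_inverse_def)
  have "z = (y \<star> x) \<star> z" by (simp only: xyz(1) H_one_mult(1)[OF xyz(4)])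
  also have "\<dots> = y" by (simp only: H_mult_assoc xyz(2) H_one_mult(2)[OF xyz(3)])
  finally show "z = y" .
qed

lemma base_elem_inverse:
  assumes "\<And>i j. t i j \<noteq> 0"
  shows "H_is_inverse C M S (base_elem t) (base_elem (\<lambda>i j. inverse (t i j)))"
  unfolding H_is_inverse_def using assms by (simp add: base_elem_in_H base_elem_mult H_one_eq)

lemma source_elem_eq: "source_elem M S t = base_elem (\<lambda>i j. t j)"
  by (simp add: source_elem_def base_elem_def)

lemma antipode_source_elem: "antipode C M S (source_elem M S t) = base_elem (\<lambda>i j. t i)"
proof (intro ext)
  fix X v a b
  show "antipode C M S (source_elem M S t) X v a b = base_elem (\<lambda>i j. t i) X v a b"
  proof (cases "v \<in> Fib M S X")
    case v: True
    have "antipode C M S (base_elem (\<lambda>i j. t j)) X v = base_elem (\<lambda>i j. t i) X v"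
    proof (rule antipode_eqI[of X "base_elem (\<lambda>i j. t j)" v, OF H_carrier_D(1)[OF base_elem_in_H] v base_elem_closed[OF v]])
      fix \<phi> assume \<phi>: "\<phi> \<in> Fib M S (Dual C X)"
      note f = Fib_component[OF \<phi>] and c = Fib_component[OF v]
      show "Fib_pairing C M S X \<phi> (base_elem (\<lambda>i j. t i) X v)
        = Fib_pairing C M S X (base_elem (\<lambda>i j. t j) (Dual C X) \<phi>) v"
        by (simp add: Fib_pairing_eq[OF \<phi> base_elem_closed[OF v]] Fib_pairing_eq[OF base_elem_closed[OF \<phi>] v]
            base_elem_apply[OF \<phi>] base_elem_apply[OF v] ev_transpose_scale[OF c]
            M.Comp_scale_left[OF f ev_transpose_Hom[OF c]] M.Comp_scale_right[OF f ev_transpose_Hom[OF c]])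
    qed
    then show ?thesis by (simp add: source_elem_eq)
  next
    case False
    then show ?thesis by (simp add: antipode_def base_elem_def)
  qed
qed

text \<open>The component of \<open>\<chi>(a, M) \<cong> 1\<close> at the simple object \<open>M\<^sub>i\<close> is a scalar \<open>\<theta>\<^sub>i\<close>. Compatibility with the
  module structures says that \<open>c X (M\<^sub>i)\<close> is \<open>\<theta>\<^sub>i / \<theta>\<^sub>j\<close> on the \<open>M\<^sub>j\<close>-isotypic part of \<open>X \<otimes> M\<^sub>i\<close>.\<close>

lemma matched_pivotal_element:
  assumes "matched C M S a"
  shows "\<exists>\<theta>. (\<forall>i. \<theta> i \<noteq> 0) \<and> pivotal_element C M S a = base_elem (\<lambda>i j. \<theta> i / \<theta> j)"
proof -
  obtain c \<Theta> where c: "chi_structure C M S a c" and \<Theta>: "iso_to_unit_module_functor C M c \<Theta>"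
    using assms unfolding matched_def by blast
  have cH: "c X U \<in> Hom M (X \<rhd> U) (X \<rhd> U)" for X U using c by (simp add: chi_structure_def)
  have iso: "iso_mor M U U (\<Theta> U)" and nat: "h \<in> Hom M U V \<Longrightarrow> \<Theta> V \<circ>\<^sub>M h = h \<circ>\<^sub>M \<Theta> U"
    and mod: "c X U \<circ>\<^sub>M \<Theta> (X \<rhd> U) = Id C X \<triangleright> \<Theta> U" for U V h X
    using \<Theta> by (auto simp: iso_to_unit_module_functor_def)
  define \<theta> where "\<theta> = (\<lambda>i. coef i (\<Theta> (S i)))"
  have \<theta>: "\<Theta> (S i) = Scale M (\<theta> i) (Id M (S i))" for i
    unfolding \<theta>_def by (rule coef[OF M.iso_mor_in_Hom[OF iso]])
  have nz: "\<theta> i \<noteq> 0" for i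
  proof
    assume "\<theta> i = 0"
    then have "\<Theta> (S i) = 0" using \<theta>[of i] by simp
    then have "Id M (S i) = 0"
      using M.inv_mor(3)[OF iso[of "S i"]] M.Comp_zero_left[OF M.inv_mor(1)[OF iso[of "S i"]]] by simp
    then show False using Id_S_nonzero by blast
  qed
  have key: "c X (S i) \<circ>\<^sub>M v = Scale M (\<theta> i / \<theta> j) v" if v: "v \<in> Hom M (S j) (X \<rhd> S i)" for X i j v
  proof -
    have "Scale M (\<theta> j) (c X (S i) \<circ>\<^sub>M v) = c X (S i) \<circ>\<^sub>M (v \<circ>\<^sub>M \<Theta> (S j))"
      by (simp add: \<theta> M.Comp_scale_right[OF M.Id_in_Hom v] M.Comp_Id_right[OF v] M.Comp_scale_right[OF v cH])
    also have "\<dots> = c X (S i) \<circ>\<^sub>M (\<Theta> (X \<rhd> S i) \<circ>\<^sub>M v)" using nat[OF v] by simp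
    also have "\<dots> = (Id C X \<triangleright> \<Theta> (S i)) \<circ>\<^sub>M v"
      by (rule M.Comp_collapse_left[OF mod v M.iso_mor_in_Hom[OF iso] cH])
    also have "\<dots> = Scale M (\<theta> i) v"
      by (simp add: \<theta> ActM_scale_right[OF C.Id_in_Hom M.Id_in_Hom] ActM_Id M.Comp_scale_left[OF v M.Id_in_Hom]
          M.Comp_Id_left[OF v])
    finally have "Scale M (inverse (\<theta> j)) (Scale M (\<theta> j) (c X (S i) \<circ>\<^sub>M v))
      = Scale M (inverse (\<theta> j)) (Scale M (\<theta> i) v)" by simp
    then show ?thesis using nz[of j] by (simp add: field_simps)
  qed
  have "pivotal_element C M S a = base_elem (\<lambda>i j. \<theta> i / \<theta> j)"
  proof (intro ext)
    fix X v i j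
    show "pivotal_element C M S a X v i j = base_elem (\<lambda>i j. \<theta> i / \<theta> j) X v i j"
    proof (cases "v \<in> Fib M S X")
      case v: True
      have "pivotal_element C M S a X v = (\<lambda>i j. c X (S i) \<circ>\<^sub>M v i j)"
        using c v by (simp add: chi_structure_def pivotal_element_def)
      then show ?thesis using key[OF Fib_component[OF v]] v by (simp add: base_elem_def)
    next
      case False
      then show ?thesis by (simp add: pivotal_element_def base_elem_def)
    qed
  qed
  then show ?thesis using nz by blast
qed

text \<open>As \<open>g\<close> is invertible, every vector of \<open>F X\<close> has the form \<open>g v\<close> required by
  \<open>antipode_square_pivotal\<close>.\<close>

lemma base_elem_conj_antipode_square:
  assumes \<eta>: "\<eta> \<in> H_carrier C M S" and a: "\<And>X. a X \<in> Hom C X (Dual C (Dual C X))"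
    and g: "pivotal_element C M S a = base_elem t" and t: "\<And>i j. t i j \<noteq> 0"
  shows "antipode C M S (antipode C M S \<eta>) = base_elem t \<star> \<eta> \<star> base_elem (\<lambda>i j. inverse (t i j))"
proof (intro ext)
  fix X v i j
  let ?t' = "\<lambda>i j. inverse (t i j)"
  show "antipode C M S (antipode C M S \<eta>) X v i j = (base_elem t \<star> \<eta> \<star> base_elem ?t') X v i j"
  proof (cases "v \<in> Fib M S X")
    case v: True
    have "base_elem t X (base_elem ?t' X v) = v"
      using t by (intro ext) (simp add: base_elem_apply base_elem_closed v)
    then show ?thesis
      using antipode_square_pivotal[of \<eta> a X, OF \<eta> a base_elem_closed[OF v, of ?t']] g by (simp add: H_mult_def)
  next
    case False
    then show ?thesis
      using H_carrier_zero[OF \<eta>] by (simp add: antipode_def H_mult_def base_elem_def)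
  qed
qed

text \<open>The space \<open>Hom (M\<^sub>i, 1 \<otimes> M\<^sub>i)\<close> is nonzero, so an invertible element of \<open>A\<^sub>s\<close> has no zero coordinate.\<close>

lemma pivotal_factorD:
  assumes "pivotal_factor C M S a m"
  shows "m i \<noteq> 0" "pivotal_element C M S a = base_elem (\<lambda>i j. m j / m i)"
proof -
  obtain y where y: "H_is_inverse C M S (source_elem M S m) y"
    using assms unfolding pivotal_factor_def H_invertible_def by blast
  show nz: "m i \<noteq> 0" for i
  proof
    assume mi: "m i = 0"
    let ?v = "single i i (munit_inv (S i))"
    have v: "?v \<in> Fib M S (Unit C)" by (rule single_closed[OF munit_inv(1)])
    have "source_elem M S m (Unit C) ?v = 0"
      unfolding source_elem_eq
      by (intro ext, subst base_elem_apply[OF v]) (auto simp: single_def mi)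
    then have "(y \<star> source_elem M S m) (Unit C) ?v = 0"
      using H_carrier_zero[of y "Unit C"] y unfolding H_mult_def H_is_inverse_def by (simp only:)
    moreover have "y \<star> source_elem M S m = H_one M S" using y by (simp add: H_is_inverse_def)
    ultimately have "H_one M S (Unit C) ?v = 0" by (simp only:)
    then have "?v = 0" using v by (simp add: H_one_def)
    then have "munit_inv (S i) = 0" by (auto simp: single_def fun_eq_iff split: if_splits)
    then have "Id M (S i) = 0" using munit_inv(3)[of "S i"] M.Comp_zero_right[OF MUnit_Hom] by simp
    then show False using Id_S_nonzero by blast
  qed
  have "H_inv C M S (base_elem (\<lambda>i j. m i)) = base_elem (\<lambda>i j. inverse (m i))"
    by (rule H_inv_eqI[OF base_elem_inverse]) (rule nz)
  then show "pivotal_element C M S a = base_elem (\<lambda>i j. m j / m i)"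
    using assms by (simp add: pivotal_factor_def antipode_source_elem)
      (simp add: source_elem_eq base_elem_mult divide_inverse)
qed

lemma pivotal_factorI:
  assumes nz: "\<And>i. m i \<noteq> 0" and g: "pivotal_element C M S a = base_elem (\<lambda>i j. m j / m i)"
  shows "pivotal_factor C M S a m"
proof -
  have "H_inv C M S (base_elem (\<lambda>i j. m i)) = base_elem (\<lambda>i j. inverse (m i))"
    by (rule H_inv_eqI[OF base_elem_inverse]) (rule nz)
  moreover have "H_invertible C M S (source_elem M S m)"
    unfolding H_invertible_def source_elem_eq using base_elem_inverse[of "\<lambda>i j. m j"] nz by blast
  ultimately show ?thesis
    using g by (simp add: pivotal_factor_def antipode_source_elem)
      (simp add: source_elem_eq base_elem_mult divide_inverse)
qed

end

section \<open>Generators of the fibre functor\<close>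

locale weak_hopf_setting = fibre_setting C M S
  for C :: "('k::alg_closed_field, 'o, 'm::ab_group_add, 'z) tencat_scheme" (structure)
    and M :: "('k, 'u, 'n::ab_group_add, 'o, 'm, 'w) modcat_scheme"
    and S :: "'i::finite \<Rightarrow> 'u" +
  fixes R P :: "'j::finite \<Rightarrow> 'o"
  assumes simples_R: "representative_simples C R"
    and cover_P: "projective_cover C (R r) (P r)"
begin

lemma simple_R: "simple_object C (R r)"
  using simples_R by (simp add: representative_simples_def)

text \<open>The maps from \<open>P\<^sub>r\<close> to simple objects: by \<open>projective_cover_factor\<close> the cover \<open>p\<close> factors through every
  nonzero \<open>f : P\<^sub>r \<rightarrow> X\<^sub>q\<close>, by a morphism \<open>X\<^sub>q \<rightarrow> X\<^sub>r\<close>. By Schur's lemma \<open>q = r\<close>, and this morphism is a scalar.\<close>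

lemma cover_maps:
  "\<exists>p. epi_mor C (P r) (R r) p \<and>
    (\<forall>q. \<forall>f\<in>Hom C (P r) (R q). if q = r then \<exists>c. f = Scale C c p else f = 0)"
proof -
  obtain p where p: "epi_mor C (P r) (R r) p"
    "\<forall>Q. \<forall>h\<in>Hom C Q (P r). epi_mor C Q (R r) (p \<cdot> h) \<longrightarrow> epi_mor C Q (P r) h"
    using cover_P[of r] unfolding projective_cover_def by blast
  have pH: "p \<in> Hom C (P r) (R r)" using p(1) by (simp add: epi_mor_def)
  have p0: "p \<noteq> 0"
  proof
    assume "p = 0"
    then have "Id C (R r) \<cdot> p = 0" using C.Comp_zero_right[OF C.Id_in_Hom] by simp
    then have "Id C (R r) = 0" by (rule C.epi_mor_cancel[OF p(1) C.Id_in_Hom])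
    then show False using C.simple_object_Id_nonzero[OF simple_R] by blast
  qed
  have "if q = r then \<exists>c. f = Scale C c p else f = 0" if f: "f \<in> Hom C (P r) (R q)" for q f
  proof (cases "f = 0")
    case True
    have "f = Scale C 0 p" using True by simp
    then show ?thesis using True by auto
  next
    case False
    have ess: "epi_mor C Q (P r) h" if "h \<in> Hom C Q (P r)" "epi_mor C Q (R r) (p \<cdot> h)" for Q h
      using p(2) that by blast
    obtain u where u: "u \<in> Hom C (R q) (R r)" "u \<cdot> f = p"
      using C.projective_cover_factor[OF ess pH simple_R simple_R f False] by blast
    have "u \<noteq> 0" using u(2) p0 C.Comp_zero_left[OF f] by auto
    then have "iso_mor C (R q) (R r) u"
      by (rule C.nonzero_between_simples_iso[OF simple_R simple_R u(1)])
    then have qr: "q = r"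
      using simples_R unfolding representative_simples_def isomorphic_def by blast
    have "absolutely_simple C (R r)"
      by (rule simple_imp_absolutely_simple[OF C.locally_finite_category_axioms simple_R])
    then obtain c where c: "u = Scale C c (Id C (R r))"
      using u(1) qr unfolding absolutely_simple_def by blast
    have cf: "Scale C c f = p"
      using u(2) c qr f C.Comp_scale_left[OF _ C.Id_in_Hom] C.Comp_Id_left by metis
    have "c \<noteq> 0" using cf p0 by auto
    have "Scale C (inverse c) p = Scale C (inverse c) (Scale C c f)" by (simp only: cf)
    also have "\<dots> = f" using \<open>c \<noteq> 0\<close> by simp
    finally have "f = Scale C (inverse c) p" by simp
    then show ?thesis using qr by auto
  qed
  then show ?thesis using p(1) by blast
qed

abbreviation N where "N \<equiv> fusion_coeff M R S"

definition combination :: "'i \<Rightarrow> 'i \<Rightarrow> ('j \<Rightarrow> nat \<Rightarrow> 'n) \<Rightarrow> ('j \<Rightarrow> nat \<Rightarrow> 'm) \<Rightarrow> 'n" where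
  "combination i j u f = (\<Sum>q\<in>UNIV. \<Sum>s<N q i j. (f q s \<triangleright> Id M (S i)) \<circ>\<^sub>M u q s)"

definition generator_family :: "'i \<Rightarrow> 'i \<Rightarrow> ('j \<Rightarrow> nat \<Rightarrow> 'n) \<Rightarrow> bool" where
  "generator_family i j u \<longleftrightarrow> (\<forall>q. \<forall>s<N q i j. u q s \<in> Hom M (S j) (P q \<rhd> S i))"

text \<open>By the Yoneda lemma the elements \<open>u q s\<close> define a natural map from the sum over \<open>q\<close> and \<open>s\<close> of the
  spaces \<open>Hom (P\<^sub>q, X)\<close> to \<open>Hom (M\<^sub>j, X \<otimes> M\<^sub>i)\<close>. It is to be bijective at \<open>X\<close>.\<close>

definition expands :: "'i \<Rightarrow> 'i \<Rightarrow> ('j \<Rightarrow> nat \<Rightarrow> 'n) \<Rightarrow> 'o \<Rightarrow> bool" where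
  "expands i j u X \<longleftrightarrow>
     (\<forall>v\<in>Hom M (S j) (X \<rhd> S i). \<exists>f. (\<forall>q s. f q s \<in> Hom C (P q) X) \<and> v = combination i j u f) \<and>
     (\<forall>f. (\<forall>q s. f q s \<in> Hom C (P q) X) \<longrightarrow> combination i j u f = 0 \<longrightarrow> (\<forall>q. \<forall>s<N q i j. f q s = 0))"

context
  fixes i j :: 'i and u :: "'j \<Rightarrow> nat \<Rightarrow> 'n"
  assumes u: "generator_family i j u"
begin

lemma generator_Hom: "s < N q i j \<Longrightarrow> u q s \<in> Hom M (S j) (P q \<rhd> S i)"
  using u by (simp add: generator_family_def)

lemma combination_Hom:
  assumes "\<And>q s. f q s \<in> Hom C (P q) X"
  shows "combination i j u f \<in> Hom M (S j) (X \<rhd> S i)"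
proof -
  have "(f q s \<triangleright> Id M (S i)) \<circ>\<^sub>M u q s \<in> Hom M (S j) (X \<rhd> S i)" if "s < N q i j" for q s
    by (rule M.Comp_in_Hom[OF generator_Hom[OF that] act_Id_right_Hom[OF assms]])
  then show ?thesis unfolding combination_def by (intro M.Hom_sum) simp
qed

lemma combination_add:
  assumes "\<And>q s. f q s \<in> Hom C (P q) X" "\<And>q s. g q s \<in> Hom C (P q) X"
  shows "combination i j u (\<lambda>q s. f q s + g q s) = combination i j u f + combination i j u g"
proof -
  have "combination i j u (\<lambda>q s. f q s + g q s) = (\<Sum>q\<in>UNIV. \<Sum>s<N q i j.
      (f q s \<triangleright> Id M (S i)) \<circ>\<^sub>M u q s + (g q s \<triangleright> Id M (S i)) \<circ>\<^sub>M u q s)"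
    unfolding combination_def
    by (intro sum.cong refl)
      (simp add: ActM_add_left[OF assms M.Id_in_Hom]
        M.Comp_add_left[OF generator_Hom act_Id_right_Hom[OF assms(1)] act_Id_right_Hom[OF assms(2)]])
  then show ?thesis by (simp add: combination_def sum.distrib)
qed

lemma combination_comp:
  assumes "\<And>q s. f q s \<in> Hom C (P q) X" and h: "h \<in> Hom C X Y"
  shows "combination i j u (\<lambda>q s. h \<cdot> f q s) = (h \<triangleright> Id M (S i)) \<circ>\<^sub>M combination i j u f"
proof -
  note hH = act_Id_right_Hom[OF h, of "S i"]
  have fu: "(f q s \<triangleright> Id M (S i)) \<circ>\<^sub>M u q s \<in> Hom M (S j) (X \<rhd> S i)" if "s < N q i j" for q s
    by (rule M.Comp_in_Hom[OF generator_Hom[OF that] act_Id_right_Hom[OF assms(1)]])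
  have "(h \<triangleright> Id M (S i)) \<circ>\<^sub>M combination i j u f
      = (\<Sum>q\<in>UNIV. (h \<triangleright> Id M (S i)) \<circ>\<^sub>M (\<Sum>s<N q i j. (f q s \<triangleright> Id M (S i)) \<circ>\<^sub>M u q s))"
    unfolding combination_def by (intro M.Comp_sum_right[where X = "S j", OF _ hH] M.Hom_sum) (simp add: fu)
  also have "\<dots> = (\<Sum>q\<in>UNIV. \<Sum>s<N q i j. (h \<triangleright> Id M (S i)) \<circ>\<^sub>M (f q s \<triangleright> Id M (S i)) \<circ>\<^sub>M u q s)"
    by (intro sum.cong refl M.Comp_sum_right[where X = "S j", OF _ hH]) (simp add: fu)
  also have "\<dots> = combination i j u (\<lambda>q s. h \<cdot> f q s)"
    unfolding combination_def
    by (intro sum.cong refl)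
      (simp add: act_Id_right_Comp[OF assms(1) h] M.Comp_assoc[OF generator_Hom act_Id_right_Hom[OF assms(1)] hH])
  finally show ?thesis by simp
qed

lemma combination_cong:
  "(\<And>q s. s < N q i j \<Longrightarrow> f q s = g q s) \<Longrightarrow> combination i j u f = combination i j u g"
  unfolding combination_def by (intro sum.cong refl) simp

lemma expands_ex:
  assumes "expands i j u X" "v \<in> Hom M (S j) (X \<rhd> S i)"
  obtains f where "\<And>q s. f q s \<in> Hom C (P q) X" "v = combination i j u f"
  using assms unfolding expands_def by blast

lemma expands_unique:
  "expands i j u X \<Longrightarrow> (\<And>q s. f q s \<in> Hom C (P q) X) \<Longrightarrow> combination i j u f = 0 \<Longrightarrow> s < N q i j \<Longrightarrow> f q s = 0"
  unfolding expands_def by blast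

lemma expandsI:
  assumes "\<And>v. v \<in> Hom M (S j) (X \<rhd> S i) \<Longrightarrow> \<exists>f. (\<forall>q s. f q s \<in> Hom C (P q) X) \<and> v = combination i j u f"
    and "\<And>f q s. (\<And>q s. f q s \<in> Hom C (P q) X) \<Longrightarrow> combination i j u f = 0 \<Longrightarrow> s < N q i j \<Longrightarrow> f q s = 0"
  shows "expands i j u X"
  unfolding expands_def using assms by blast

lemma expands_iso:
  assumes X: "expands i j u X" and h: "iso_mor C X Y h"
  shows "expands i j u Y"
proof -
  note H = C.iso_mor_in_Hom[OF h] C.inv_mor[OF h]
  let ?h' = "inv_mor C X Y h"
  show ?thesis
  proof (rule expandsI)
    fix v assume v: "v \<in> Hom M (S j) (Y \<rhd> S i)"
    obtain f where f: "\<And>q s. f q s \<in> Hom C (P q) X" "(?h' \<triangleright> Id M (S i)) \<circ>\<^sub>M v = combination i j u f"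
      using expands_ex[OF X M.Comp_in_Hom[OF v act_Id_right_Hom[OF H(2)]]] by metis
    have "combination i j u (\<lambda>q s. h \<cdot> f q s) = (h \<triangleright> Id M (S i)) \<circ>\<^sub>M (?h' \<triangleright> Id M (S i)) \<circ>\<^sub>M v"
      using combination_comp[where f = f, OF f(1) H(1)] f(2) by simp
    also have "\<dots> = Id M (Y \<rhd> S i) \<circ>\<^sub>M v"
      by (rule M.Comp_collapse_left[OF _ v act_Id_right_Hom[OF H(2)] act_Id_right_Hom[OF H(1)]])
        (simp only: act_Id_right_Comp[OF H(2,1), symmetric] H(4) ActM_Id)
    also have "\<dots> = v" by (rule M.Comp_Id_left[OF v])
    finally have "v = combination i j u (\<lambda>q s. h \<cdot> f q s)" by simp
    moreover have "h \<cdot> f q s \<in> Hom C (P q) Y" for q s by (rule C.Comp_in_Hom[OF f(1) H(1)])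
    ultimately show "\<exists>f. (\<forall>q s. f q s \<in> Hom C (P q) Y) \<and> v = combination i j u f"
      by (intro exI[of _ "\<lambda>q s. h \<cdot> f q s"]) simp
  next
    fix f q s assume f: "\<And>q s. f q s \<in> Hom C (P q) Y" "combination i j u f = 0" "s < N q i j"
    have "combination i j u (\<lambda>q s. ?h' \<cdot> f q s) = 0"
      using combination_comp[where f = f, OF f(1) H(2)] f(2) M.Comp_zero_right[OF act_Id_right_Hom[OF H(2)]] by simp
    then have "?h' \<cdot> f q s = 0"
      by (rule expands_unique[where f = "\<lambda>q s. ?h' \<cdot> f q s", OF X C.Comp_in_Hom[OF f(1) H(2)] _ f(3)])
    then show "f q s = 0" by (rule C.iso_mor_cancel_left[OF C.iso_mor_inv(1)[OF h] f(1)])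
  qed
qed

text \<open>The source and the target of the natural map are exact functors, as \<open>P\<^sub>q\<close> is projective and the
  action is exact, so this is an instance of the five lemma.\<close>

lemma expands_extension:
  assumes X: "expands i j u X" and Z: "expands i j u Z" and ex: "short_exact C X Y Z a b"
  shows "expands i j u Y"
proof -
  have aH: "a \<in> Hom C X Y" and bH: "b \<in> Hom C Y Z" and ka: "is_kernel C Y Z b X a"
    and kb: "is_cokernel C X Y a Z b" using ex by (simp_all add: short_exact_def)
  have epi: "epi_mor C Y Z b" by (rule C.is_cokernel_epi[OF kb aH])
  have mono: "mono_mor C X Y a" by (rule C.is_kernel_mono[OF ka bH])
  let ?a = "a \<triangleright> Id M (S i)" and ?b = "b \<triangleright> Id M (S i)"
  have ex': "short_exact M (X \<rhd> S i) (Y \<rhd> S i) (Z \<rhd> S i) ?a ?b" by (rule Act_exact[OF ex])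
  have aM: "?a \<in> Hom M (X \<rhd> S i) (Y \<rhd> S i)" and bM: "?b \<in> Hom M (Y \<rhd> S i) (Z \<rhd> S i)"
    and kaM: "is_kernel M (Y \<rhd> S i) (Z \<rhd> S i) ?b (X \<rhd> S i) ?a"
    using ex' by (simp_all add: short_exact_def)
  have ba: "b \<cdot> a = 0" using ka by (simp add: is_kernel_def)
  have monoM: "mono_mor M (X \<rhd> S i) (Y \<rhd> S i) ?a" by (rule M.is_kernel_mono[OF kaM bM])
  show ?thesis
  proof (rule expandsI)
    fix v assume v: "v \<in> Hom M (S j) (Y \<rhd> S i)"
    obtain h where h: "\<And>q s. h q s \<in> Hom C (P q) Z" "?b \<circ>\<^sub>M v = combination i j u h"
      using expands_ex[OF Z M.Comp_in_Hom[OF v bM]] by metis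
    have "\<exists>e. e \<in> Hom C (P q) Y \<and> b \<cdot> e = h q s" for q s
      using cover_P[of q] epi h(1)[of q s] unfolding projective_cover_def projective_object_def by blast
    then obtain e where e: "\<And>q s. e q s \<in> Hom C (P q) Y" "\<And>q s. b \<cdot> e q s = h q s" by metis
    have ce: "combination i j u e \<in> Hom M (S j) (Y \<rhd> S i)" by (rule combination_Hom) (rule e(1))
    have "?b \<circ>\<^sub>M combination i j u e = combination i j u h"
      using combination_comp[where f = e, OF e(1) bH] e(2) by simp
    then have "?b \<circ>\<^sub>M (v - combination i j u e) = 0"
      using M.Comp_diff_right[OF v ce bM] h(2) by simp
    then obtain w where w: "w \<in> Hom M (S j) (X \<rhd> S i)" "?a \<circ>\<^sub>M w = v - combination i j u e"
      using M.is_kernel_factor[OF kaM M.Hom_diff[OF v ce]] by blast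
    obtain f where f: "\<And>q s. f q s \<in> Hom C (P q) X" "w = combination i j u f"
      using expands_ex[OF X w(1)] by metis
    have af: "a \<cdot> f q s \<in> Hom C (P q) Y" for q s by (rule C.Comp_in_Hom[OF f(1) aH])
    have "combination i j u (\<lambda>q s. e q s + a \<cdot> f q s) = v"
      using combination_add[where f = e and g = "\<lambda>q s. a \<cdot> f q s", OF e(1) af] combination_comp[where f = f, OF f(1) aH] f(2) w(2) by simp
    then show "\<exists>f. (\<forall>q s. f q s \<in> Hom C (P q) Y) \<and> v = combination i j u f"
      by (intro exI[of _ "\<lambda>q s. e q s + a \<cdot> f q s"]) (simp add: C.Hom_add e(1) af)
  next
    fix f q s assume f: "\<And>q s. f q s \<in> Hom C (P q) Y" "combination i j u f = 0" and s: "s < N q i j"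
    have "combination i j u (\<lambda>q s. b \<cdot> f q s) = 0"
      using combination_comp[where f = f, OF f(1) bH] f(2) M.Comp_zero_right[OF bM] by simp
    then have bf: "b \<cdot> f q s = 0" if "s < N q i j" for q s
      by (rule expands_unique[where f = "\<lambda>q s. b \<cdot> f q s", OF Z C.Comp_in_Hom[OF f(1) bH] _ that])
    \<comment> \<open>Outside the summation range \<open>f\<close> need not factor through \<open>a\<close>; any value serves there.\<close>
    have "\<exists>e. e \<in> Hom C (P q) X \<and> (s < N q i j \<longrightarrow> a \<cdot> e = f q s)" for q s
    proof (cases "s < N q i j")
      case True
      then show ?thesis using C.is_kernel_factor[OF ka f(1) bf[OF True]] by blast
    next
      case False
      then show ?thesis using C.Hom_zero by blast
    qed
    then obtain e where e: "\<And>q s. e q s \<in> Hom C (P q) X" "\<And>q s. s < N q i j \<Longrightarrow> a \<cdot> e q s = f q s" by metis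
    have "?a \<circ>\<^sub>M combination i j u e = combination i j u (\<lambda>q s. a \<cdot> e q s)"
      by (rule combination_comp[where f = e, OF e(1) aH, symmetric])
    also have "\<dots> = 0" using combination_cong[where f = "\<lambda>q s. a \<cdot> e q s" and g = f, OF e(2)] f(2) by simp
    finally have "?a \<circ>\<^sub>M combination i j u e = ?a \<circ>\<^sub>M 0" by (simp add: M.Comp_zero_right[OF aM])
    then have "combination i j u e = 0"
      using monoM combination_Hom[where f = e, OF e(1)] M.Hom_zero unfolding mono_mor_def by blast
    then have "e q s = 0" by (rule expands_unique[where f = e, OF X e(1) _ s])
    then show "f q s = 0" using e(2)[OF s] C.Comp_zero_right[OF aH] by simp
  qed
qed

lemma expands_zero:
  assumes "zero_object C X"
  shows "expands i j u X"
proof (rule expandsI)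
  have X0: "Id C X = 0" using assms C.Id_in_Hom unfolding zero_object_def by blast
  have "Id M (X \<rhd> S i) = Scale C 0 (Id C X) \<triangleright> Id M (S i)" by (simp add: ActM_Id[symmetric] X0)
  also have "\<dots> = 0" using ActM_scale_left[OF C.Id_in_Hom M.Id_in_Hom, of 0] by simp
  finally have 0: "Id M (X \<rhd> S i) = 0" .
  fix v assume "v \<in> Hom M (S j) (X \<rhd> S i)"
  then have "v = 0" by (rule M.Id_eq_zero_imp_zero(2)[OF 0])
  moreover have "combination i j u (\<lambda>q s. 0) = 0"
    using M.Id_eq_zero_imp_zero(2)[OF 0 combination_Hom[of "\<lambda>q s. 0" X]] C.Hom_zero by simp
  ultimately show "\<exists>f. (\<forall>q s. f q s \<in> Hom C (P q) X) \<and> v = combination i j u f"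
    using C.Hom_zero by (intro exI[of _ "\<lambda>q s. 0"]) simp
next
  fix f q s assume "\<And>q s. f q s \<in> Hom C (P q) X"
  then have "f q s \<in> Hom C (P q) X" .
  then show "f q s = 0" using assms unfolding zero_object_def by blast
qed

lemma expands_if_simples:
  assumes "\<And>r. expands i j u (R r)"
  shows "expands i j u X"
  using C.finite_length[of X]
proof induction
  case (zero X)
  then show ?case by (rule expands_zero)
next
  case (extend Y T X f g)
  obtain r where "isomorphic C T (R r)"
    using extend.hyps(2) simples_R unfolding representative_simples_def by blast
  then obtain h where h: "iso_mor C T (R r) h" unfolding isomorphic_def by blast
  have "expands i j u T" by (rule expands_iso[OF assms C.iso_mor_inv(1)[OF h]])
  then show ?case by (rule expands_extension[OF extend.IH _ extend.hyps(3)])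
qed

end

text \<open>The generators \<open>u q s\<close> lift a basis of \<open>Hom (M\<^sub>j, X\<^sub>q \<otimes> M\<^sub>i)\<close> along the cover \<open>p q\<close>. At a simple object
  \<open>X\<^sub>r\<close> only the multiples of \<open>p r\<close> occur as coefficients, so there the expansion is the one in that
  basis.\<close>

lemma ex_generators: "\<exists>u. generator_family i j u \<and> (\<forall>X. expands i j u X)"
proof -
  have "\<exists>p. \<forall>r. epi_mor C (P r) (R r) (p r) \<and>
    (\<forall>q. \<forall>f\<in>Hom C (P r) (R q). if q = r then \<exists>c. f = Scale C c (p r) else f = 0)"
    by (intro choice allI cover_maps)
  then obtain p where epi: "\<And>r. epi_mor C (P r) (R r) (p r)"
    and maps: "\<And>q r f. f \<in> Hom C (P r) (R q) \<Longrightarrow> if q = r then \<exists>c. f = Scale C c (p r) else f = 0"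
    by blast
  have pH: "p r \<in> Hom C (P r) (R r)" for r using epi by (simp add: epi_mor_def)
  let ?V = "\<lambda>q. Hom M (S j) (R q \<rhd> S i)"
  have "\<exists>b. family_basis (Scale M) (?V q) {..<N q i j} b" for q
    using M.V.finite_dim_family_basis[OF M.subspace_Hom M.finite_dim_Hom, of "S j" "R q \<rhd> S i"]
      M.hom_dim_to_simple[OF semisimple absolutely_simple_S, of "R q \<rhd> S i" j]
    by (simp add: fusion_coeff_def hom_dim_def)
  then obtain b where b: "\<And>q. family_basis (Scale M) (?V q) {..<N q i j} (b q)" by metis
  have bH: "b q s \<in> ?V q" if "s < N q i j" for q s
    using family_basis_mem[OF b] that by simp
  have lift: "\<exists>w. s < N q i j \<longrightarrow> w \<in> Hom M (S j) (P q \<rhd> S i) \<and> (p q \<triangleright> Id M (S i)) \<circ>\<^sub>M w = b q s" for q s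
  proof (cases "s < N q i j")
    case True
    obtain K k where "short_exact C K (P q) (R q) k (p q)" using C.epi_short_exact[OF epi] by blast
    then have "short_exact M (K \<rhd> S i) (P q \<rhd> S i) (R q \<rhd> S i) (k \<triangleright> Id M (S i)) (p q \<triangleright> Id M (S i))"
      by (rule Act_exact)
    then have "epi_mor M (P q \<rhd> S i) (R q \<rhd> S i) (p q \<triangleright> Id M (S i))"
      unfolding short_exact_def using M.is_cokernel_epi by blast
    then show ?thesis
      using M.simple_lifts_along_epi[OF semisimple semisimple absolutely_simple_S _ bH[OF True]] by blast
  qed simp
  have "\<exists>u. \<forall>q s. s < N q i j \<longrightarrow> u q s \<in> Hom M (S j) (P q \<rhd> S i) \<and> (p q \<triangleright> Id M (S i)) \<circ>\<^sub>M u q s = b q s"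
    by (intro choice allI lift)
  then obtain u where uH: "\<And>q s. s < N q i j \<Longrightarrow> u q s \<in> Hom M (S j) (P q \<rhd> S i)"
    and pu: "\<And>q s. s < N q i j \<Longrightarrow> (p q \<triangleright> Id M (S i)) \<circ>\<^sub>M u q s = b q s" by blast
  have u: "generator_family i j u" using uH by (simp add: generator_family_def)
  have comb: "combination i j u (\<lambda>q s. if q = r then Scale C (c s) (p r) else 0) = (\<Sum>s<N r i j. Scale M (c s) (b r s))"
    for c r
  proof -
    have zero: "0 \<triangleright> Id M (S i) = 0"
      using ActM_scale_left[OF C.Id_in_Hom M.Id_in_Hom, of 0 "P r" "S i"] by simp
    have sc: "(Scale C c (p r) \<triangleright> Id M (S i)) \<circ>\<^sub>M u r s = Scale M c (b r s)" if "s < N r i j" for c s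
      using that by (simp add: ActM_scale_left[OF pH M.Id_in_Hom] M.Comp_scale_left[OF uH act_Id_right_Hom[OF pH]] pu)
    have "combination i j u (\<lambda>q s. if q = r then Scale C (c s) (p r) else 0)
        = (\<Sum>q\<in>UNIV. if q = r then (\<Sum>s<N r i j. Scale M (c s) (b r s)) else 0)"
      unfolding combination_def
      by (intro sum.cong refl) (auto simp: sc zero M.Comp_zero_left[OF uH])
    then show ?thesis by simp
  qed
  have "expands i j u (R r)" for r
  proof (rule expandsI[OF u])
    fix v assume "v \<in> ?V r"
    then obtain c where "v = (\<Sum>s<N r i j. Scale M (c s) (b r s))" using family_basis_expand[OF b] by blast
    then have "v = combination i j u (\<lambda>q s. if q = r then Scale C (c s) (p r) else 0)" by (simp only: comb)
    moreover have "(if q = r then Scale C (c s) (p r) else 0) \<in> Hom C (P q) (R r)" for q s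
      using C.Hom_scale[OF pH] C.Hom_zero by auto
    ultimately show "\<exists>f. (\<forall>q s. f q s \<in> Hom C (P q) (R r)) \<and> v = combination i j u f"
      by (intro exI[of _ "\<lambda>q s. if q = r then Scale C (c s) (p r) else 0"]) blast
  next
    fix f q s assume f: "\<And>q s. f q s \<in> Hom C (P q) (R r)" "combination i j u f = 0" and s: "s < N q i j"
    have "\<exists>c. f r t = Scale C c (p r)" for t using maps[OF f(1)[of r t]] by simp
    then obtain c where c: "\<And>t. f r t = Scale C (c t) (p r)" by metis
    have ff: "f = (\<lambda>q s. if q = r then Scale C (c s) (p r) else 0)"
    proof (intro ext)
      fix q s
      show "f q s = (if q = r then Scale C (c s) (p r) else 0)"
        using maps[OF f(1)[of q s]] c by (cases "q = r") (simp_all split: if_splits)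
    qed
    have "(\<Sum>s<N r i j. Scale M (c s) (b r s)) = 0" using f(2) comb[of r c] by (simp only: ff)
    then have "q = r \<Longrightarrow> c s = 0" using family_basis_unique[OF b] s by blast
    then show "f q s = 0" by (simp add: ff)
  qed
  then show ?thesis using u expands_if_simples[OF u] by blast
qed

end

section \<open>A basis of eigenvectors in the weak Hopf algebra\<close>

context weak_hopf_setting
begin

definition generator :: "'i \<Rightarrow> 'i \<Rightarrow> 'j \<Rightarrow> nat \<Rightarrow> 'n" where
  "generator i j = (SOME u. generator_family i j u \<and> (\<forall>X. expands i j u X))"

lemma generator: "generator_family i j (generator i j)" "expands i j (generator i j) X"
  using someI_ex[OF ex_generators[of i j]] by (auto simp: generator_def)

text \<open>An index \<open>(q, i, j, s)\<close> stands for the \<open>s\<close>-th generator of \<open>F\<^sub>i\<^sub>j\<close> that lives in \<open>F P\<^sub>q\<close>. The generators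
  of all \<open>F\<^sub>i\<^sub>j\<close> together generate \<open>F\<close>.\<close>

definition gen_index :: "('j \<times> 'i \<times> 'i \<times> nat) set" where
  "gen_index = (SIGMA q:UNIV. SIGMA i:UNIV. SIGMA j:UNIV. {..<N q i j})"

definition gen_vec :: "'j \<times> 'i \<times> 'i \<times> nat \<Rightarrow> 'i \<Rightarrow> 'i \<Rightarrow> 'n" where
  "gen_vec = (\<lambda>(q, i, j, s). single i j (generator i j q s))"

lemma finite_gen_index: "finite gen_index"
  by (simp add: gen_index_def)

lemma gen_vec_closed: "x \<in> gen_index \<Longrightarrow> gen_vec x \<in> Fib M S (P (fst x))"
  using generator_Hom[OF generator(1)] by (auto simp: gen_index_def gen_vec_def intro!: single_closed)

lemma Fib_map_add_right:
  assumes "f \<in> Hom C X Y" "v \<in> Fib M S X" "w \<in> Fib M S X"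
  shows "Fib_map M S f (v + w) = Fib_map M S f v + Fib_map M S f w"
  by (intro ext)
    (simp add: Fib_map_apply M.Comp_add_right[OF Fib_component[OF assms(2)] Fib_component[OF assms(3)] act_Id_right_Hom[OF assms(1)]])

lemma Fib_map_scale_right:
  assumes "f \<in> Hom C X Y" "v \<in> Fib M S X"
  shows "Fib_map M S f (Fib_scale M c v) = Fib_scale M c (Fib_map M S f v)"
  by (intro ext)
    (simp add: Fib_map_apply Fib_scale_apply M.Comp_scale_right[OF Fib_component[OF assms(2)] act_Id_right_Hom[OF assms(1)]])

lemma Fib_map_add_left:
  assumes "f \<in> Hom C X Y" "g \<in> Hom C X Y" "v \<in> Fib M S X"
  shows "Fib_map M S (f + g) v = Fib_map M S f v + Fib_map M S g v"
  by (intro ext)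
    (simp add: Fib_map_apply ActM_add_left[OF assms(1,2) M.Id_in_Hom]
      M.Comp_add_left[OF Fib_component[OF assms(3)] act_Id_right_Hom[OF assms(1)] act_Id_right_Hom[OF assms(2)]])

lemma Fib_map_scale_left:
  assumes "f \<in> Hom C X Y" "v \<in> Fib M S X"
  shows "Fib_map M S (Scale C c f) v = Fib_scale M c (Fib_map M S f v)"
  by (intro ext)
    (simp add: Fib_map_apply Fib_scale_apply ActM_scale_left[OF assms(1) M.Id_in_Hom]
      M.Comp_scale_left[OF Fib_component[OF assms(2)] act_Id_right_Hom[OF assms(1)]])

lemma Fib_map_comp:
  assumes "f \<in> Hom C X Y" "g \<in> Hom C Y Z" "v \<in> Fib M S X"
  shows "Fib_map M S (g \<cdot> f) v = Fib_map M S g (Fib_map M S f v)"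
  by (intro ext)
    (simp add: Fib_map_apply act_Id_right_Comp[OF assms(1,2)]
      M.Comp_assoc[OF Fib_component[OF assms(3)] act_Id_right_Hom[OF assms(1)] act_Id_right_Hom[OF assms(2)]])

lemma Fib_map_Id:
  assumes "v \<in> Fib M S X"
  shows "Fib_map M S (Id C X) v = v"
  by (intro ext) (simp add: Fib_map_apply ActM_Id M.Comp_Id_left[OF Fib_component[OF assms]])

lemma Fib_map_zero_left:
  assumes "v \<in> Fib M S X"
  shows "Fib_map M S 0 v = 0"
  using Fib_map_scale_left[OF C.Id_in_Hom assms, of 0] by (simp only: C.V.scale_zero_left F.scale_zero_left)

lemma Fib_map_sum_right:
  assumes "f \<in> Hom C X Y" "\<And>x. x \<in> I \<Longrightarrow> v x \<in> Fib M S X" "finite I"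
  shows "Fib_map M S f (\<Sum>x\<in>I. v x) = (\<Sum>x\<in>I. Fib_map M S f (v x))"
  using assms(3,2)
proof (induction I rule: finite_induct)
  case empty
  have "Fib_map M S f 0 = 0"
    using Fib_map_scale_right[OF assms(1) Fib_zero, of 0] by (simp only: F.scale_zero_left)
  then show ?case by (simp only: sum.empty)
next
  case (insert x I)
  have "v x \<in> Fib M S X" "sum v I \<in> Fib M S X" using insert.prems by (auto intro!: Fib_sum)
  then show ?case using insert by (simp only: sum.insert[OF insert.hyps] Fib_map_add_right[OF assms(1)] insertI2)
qed

lemma Fib_map_sum_left:
  assumes "\<And>x. x \<in> I \<Longrightarrow> f x \<in> Hom C X Y" "v \<in> Fib M S X" "finite I"
  shows "Fib_map M S (\<Sum>x\<in>I. f x) v = (\<Sum>x\<in>I. Fib_map M S (f x) v)"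
  using assms(3,1)
proof (induction I rule: finite_induct)
  case empty
  then show ?case by (simp only: sum.empty Fib_map_zero_left[OF assms(2)])
next
  case (insert x I)
  have "f x \<in> Hom C X Y" "sum f I \<in> Hom C X Y" using insert.prems by (auto intro!: C.Hom_sum)
  then show ?case using insert by (simp only: sum.insert[OF insert.hyps] Fib_map_add_left[OF _ _ assms(2)] insertI2)
qed

lemma sum_gen_index_apply:
  assumes "\<And>x. f x \<in> Hom C (P (fst x)) X"
  shows "(\<Sum>x\<in>gen_index. Fib_map M S (f x) (gen_vec x)) a b = combination a b (generator a b) (\<lambda>q s. f (q, a, b, s))"
proof -
  have summand: "Fib_map M S (f (q, i, j, s)) (gen_vec (q, i, j, s)) a b
      = (if j = b then (if i = a then (f (q, a, b, s) \<triangleright> Id M (S a)) \<circ>\<^sub>M generator a b q s else 0) else 0)"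
    for q i j s
    using M.Comp_zero_right[OF act_Id_right_Hom[OF assms[of "(q, i, j, s)"]]]
    by (auto simp: Fib_map_apply gen_vec_def single_def)
  have inner: "(\<Sum>s<N q i j. Fib_map M S (f (q, i, j, s)) (gen_vec (q, i, j, s)) a b)
      = (if j = b then (if i = a then (\<Sum>s<N q a b. (f (q, a, b, s) \<triangleright> Id M (S a)) \<circ>\<^sub>M generator a b q s) else 0) else 0)"
    for q i j by (simp add: summand)
  have "(\<Sum>x\<in>gen_index. Fib_map M S (f x) (gen_vec x)) a b
      = (\<Sum>q\<in>UNIV. \<Sum>i\<in>UNIV. \<Sum>j\<in>UNIV. \<Sum>s<N q i j. Fib_map M S (f (q, i, j, s)) (gen_vec (q, i, j, s)) a b)"
    unfolding sum_apply gen_index_def by (simp add: sum.Sigma split_def)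
  also have "\<dots> = combination a b (generator a b) (\<lambda>q s. f (q, a, b, s))"
    by (simp add: inner combination_def)
  finally show ?thesis .
qed

text \<open>The functor \<open>F\<close> is isomorphic to the sum of the functors \<open>Hom (P\<^sub>q, -)\<close> over all generators: the
  coefficients of \<open>v\<close> exist and are unique, which makes them linear and natural in \<open>v\<close>.\<close>

lemma Fib_expand:
  assumes v: "v \<in> Fib M S X"
  shows "\<exists>f. (\<forall>x. f x \<in> Hom C (P (fst x)) X) \<and> v = (\<Sum>x\<in>gen_index. Fib_map M S (f x) (gen_vec x))"
proof -
  have "\<exists>f. (\<forall>q s. f q s \<in> Hom C (P q) X) \<and> v i j = combination i j (generator i j) f" for i j
    using expands_ex[OF generator(1) generator(2) Fib_component[OF v, of i j]] by metis
  then have "\<exists>f. \<forall>i j. (\<forall>q s. f i j q s \<in> Hom C (P q) X) \<and> v i j = combination i j (generator i j) (f i j)"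
    by (intro choice allI)
  then obtain f where f: "\<And>i j q s. f i j q s \<in> Hom C (P q) X"
    "\<And>i j. v i j = combination i j (generator i j) (f i j)" by blast
  let ?f = "\<lambda>x. case x of (q, i, j, s) \<Rightarrow> f i j q s"
  have fH: "?f x \<in> Hom C (P (fst x)) X" for x using f(1) by (auto simp: split_def)
  have "v = (\<Sum>x\<in>gen_index. Fib_map M S (?f x) (gen_vec x))"
  proof (intro ext)
    fix i j
    show "v i j = (\<Sum>x\<in>gen_index. Fib_map M S (?f x) (gen_vec x)) i j"
      unfolding sum_gen_index_apply[where f = ?f, OF fH] using f(2)[of i j] by simp
  qed
  then show ?thesis using fH by (intro exI[of _ ?f] conjI allI)
qed

lemma Fib_expand_unique:
  assumes f: "\<And>x. f x \<in> Hom C (P (fst x)) X"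
    and eq: "(\<Sum>x\<in>gen_index. Fib_map M S (f x) (gen_vec x)) = 0" and x: "x \<in> gen_index"
  shows "f x = 0"
proof -
  obtain q i j s where xx: "x = (q, i, j, s)" by (cases x)
  have s: "s < N q i j" using x by (simp add: xx gen_index_def)
  have "combination i j (generator i j) (\<lambda>q s. f (q, i, j, s)) = 0"
    using sum_gen_index_apply[where f = f, OF f, of i j] by (simp add: eq)
  then show ?thesis
    unfolding xx
    by (rule expands_unique[where f = "\<lambda>q s. f (q, i, j, s)", OF generator(1) generator(2)[of i j X] _ _ s, rotated])
      (use f in \<open>metis fst_conv\<close>)
qed

definition coord :: "'o \<Rightarrow> ('i \<Rightarrow> 'i \<Rightarrow> 'n) \<Rightarrow> 'j \<times> 'i \<times> 'i \<times> nat \<Rightarrow> 'm" where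
  "coord X v = (SOME f. (\<forall>x. f x \<in> Hom C (P (fst x)) X) \<and> v = (\<Sum>x\<in>gen_index. Fib_map M S (f x) (gen_vec x)))"

lemma coord:
  assumes "v \<in> Fib M S X"
  shows "coord X v x \<in> Hom C (P (fst x)) X" "(\<Sum>x\<in>gen_index. Fib_map M S (coord X v x) (gen_vec x)) = v"
proof -
  have c: "(\<forall>x. coord X v x \<in> Hom C (P (fst x)) X) \<and> v = (\<Sum>x\<in>gen_index. Fib_map M S (coord X v x) (gen_vec x))"
    unfolding coord_def by (rule someI_ex[OF Fib_expand[OF assms]])
  show "coord X v x \<in> Hom C (P (fst x)) X" by (rule spec[OF conjunct1[OF c]])
  show "(\<Sum>x\<in>gen_index. Fib_map M S (coord X v x) (gen_vec x)) = v" by (rule conjunct2[OF c, symmetric])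
qed

lemma coord_eqI:
  assumes v: "v \<in> Fib M S X" and f: "\<And>x. f x \<in> Hom C (P (fst x)) X"
    and eq: "v = (\<Sum>x\<in>gen_index. Fib_map M S (f x) (gen_vec x))" and x: "x \<in> gen_index"
  shows "coord X v x = f x"
proof -
  have c: "f x \<in> Hom C (P (fst x)) X" "coord X v x \<in> Hom C (P (fst x)) X" for x using f coord(1)[OF v] by auto
  have neg: "Scale C (-1) (f x) \<in> Hom C (P (fst x)) X" for x by (rule C.Hom_scale[OF c(1)])
  have s: "coord X v x + Scale C (-1) (f x) \<in> Hom C (P (fst x)) X" for x
    by (rule C.Hom_add[OF c(2) neg])
  have "(\<Sum>x\<in>gen_index. Fib_map M S (coord X v x + Scale C (-1) (f x)) (gen_vec x))
      = (\<Sum>x\<in>gen_index. Fib_map M S (coord X v x) (gen_vec x) + Fib_scale M (-1) (Fib_map M S (f x) (gen_vec x)))"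
    by (rule sum.cong[OF refl])
      (simp only: Fib_map_add_left[OF c(2) neg gen_vec_closed] Fib_map_scale_left[OF c(1) gen_vec_closed])
  also have "\<dots> = v + Fib_scale M (-1) v"
    by (simp only: sum.distrib F.scale_sum_right[symmetric] coord(2)[OF v] eq[symmetric])
  also have "\<dots> = 0" by (simp only: F.scale_minus_left F.scale_one right_minus)
  finally have "coord X v x + Scale C (-1) (f x) = 0"
    by (rule Fib_expand_unique[where f = "\<lambda>x. coord X v x + Scale C (-1) (f x)", OF s _ x])
  then show ?thesis by simp
qed

lemma coord_add:
  assumes v: "v \<in> Fib M S X" and w: "w \<in> Fib M S X" and x: "x \<in> gen_index"
  shows "coord X (v + w) x = coord X v x + coord X w x"
proof (rule coord_eqI[where f = "\<lambda>x. coord X v x + coord X w x", OF Fib_add[OF v w] _ _ x])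
  show "coord X v x + coord X w x \<in> Hom C (P (fst x)) X" for x
    by (rule C.Hom_add[OF coord(1)[OF v] coord(1)[OF w]])
  have "(\<Sum>x\<in>gen_index. Fib_map M S (coord X v x + coord X w x) (gen_vec x))
      = (\<Sum>x\<in>gen_index. Fib_map M S (coord X v x) (gen_vec x) + Fib_map M S (coord X w x) (gen_vec x))"
    by (rule sum.cong[OF refl]) (simp only: Fib_map_add_left[OF coord(1)[OF v] coord(1)[OF w] gen_vec_closed])
  then show "v + w = (\<Sum>x\<in>gen_index. Fib_map M S (coord X v x + coord X w x) (gen_vec x))"
    by (simp only: sum.distrib coord(2)[OF v] coord(2)[OF w])
qed

lemma coord_Fib_map:
  assumes h: "h \<in> Hom C X Y" and v: "v \<in> Fib M S X" and x: "x \<in> gen_index"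
  shows "coord Y (Fib_map M S h v) x = h \<cdot> coord X v x"
proof (rule coord_eqI[where f = "\<lambda>x. h \<cdot> coord X v x", OF Fib_map_closed[OF h v] _ _ x])
  show "h \<cdot> coord X v x \<in> Hom C (P (fst x)) Y" for x by (rule C.Comp_in_Hom[OF coord(1)[OF v] h])
  have "(\<Sum>x\<in>gen_index. Fib_map M S (h \<cdot> coord X v x) (gen_vec x))
      = (\<Sum>x\<in>gen_index. Fib_map M S h (Fib_map M S (coord X v x) (gen_vec x)))"
    by (rule sum.cong[OF refl]) (simp only: Fib_map_comp[OF coord(1)[OF v] h gen_vec_closed])
  also have "\<dots> = Fib_map M S h (\<Sum>x\<in>gen_index. Fib_map M S (coord X v x) (gen_vec x))"
    by (rule Fib_map_sum_right[OF h _ finite_gen_index, symmetric])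
      (rule Fib_map_closed[OF coord(1)[OF v] gen_vec_closed])
  finally show "Fib_map M S h v = (\<Sum>x\<in>gen_index. Fib_map M S (h \<cdot> coord X v x) (gen_vec x))"
    by (simp only: coord(2)[OF v])
qed

lemma Fib_map_base_elem:
  assumes "f \<in> Hom C X Y" "v \<in> Fib M S X"
  shows "base_elem t Y (Fib_map M S f v) = Fib_map M S f (base_elem t X v)"
  by (rule H_carrier_D(3)[OF base_elem_in_H assms])

definition weight :: "('i \<Rightarrow> 'i \<Rightarrow> 'k) \<Rightarrow> 'j \<times> 'i \<times> 'i \<times> nat \<Rightarrow> 'k" where
  "weight t = (\<lambda>(q, i, j, s). t i j)"

lemma base_elem_gen_vec:
  assumes "x \<in> gen_index"
  shows "base_elem t (P (fst x)) (gen_vec x) = Fib_scale M (weight t x) (gen_vec x)"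
  by (intro ext, subst base_elem_apply[OF gen_vec_closed[OF assms]])
    (auto simp: Fib_scale_apply gen_vec_def weight_def single_def split_def)

lemma coord_base_elem:
  assumes v: "v \<in> Fib M S X" and x: "x \<in> gen_index"
  shows "coord X (base_elem t X v) x = Scale C (weight t x) (coord X v x)"
proof (rule coord_eqI[where f = "\<lambda>x. Scale C (weight t x) (coord X v x)", OF base_elem_closed[OF v] _ _ x])
  show "Scale C (weight t x) (coord X v x) \<in> Hom C (P (fst x)) X" for x
    by (rule C.Hom_scale[OF coord(1)[OF v]])
  have closed: "Fib_map M S (coord X v x) (gen_vec x) \<in> Fib M S X" if "x \<in> gen_index" for x
    by (rule Fib_map_closed[OF coord(1)[OF v] gen_vec_closed[OF that]])
  have one: "(\<Sum>x\<in>I. Fib_scale M 1 (e x)) = (\<Sum>x\<in>I. e x)" for I and e :: "'j \<times> 'i \<times> 'i \<times> nat \<Rightarrow> 'i \<Rightarrow> 'i \<Rightarrow> 'n"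
    by (simp only: F.scale_one)
  have "base_elem t X v = base_elem t X (\<Sum>x\<in>gen_index. Fib_scale M 1 (Fib_map M S (coord X v x) (gen_vec x)))"
    by (simp only: one coord(2)[OF v])
  also have "\<dots> = (\<Sum>x\<in>gen_index. Fib_scale M 1 (base_elem t X (Fib_map M S (coord X v x) (gen_vec x))))"
    by (rule endo_on_sum[OF vector_space_Fib_scale Fib_subspace H_carrier_D(1)[OF base_elem_in_H] finite_gen_index closed])
  also have "\<dots> = (\<Sum>x\<in>gen_index. Fib_map M S (Scale C (weight t x) (coord X v x)) (gen_vec x))"
    by (rule sum.cong[OF refl])
      (simp only: F.scale_one Fib_map_base_elem[OF coord(1)[OF v] gen_vec_closed] base_elem_gen_vec
        Fib_map_scale_right[OF coord(1)[OF v] gen_vec_closed] Fib_map_scale_left[OF coord(1)[OF v] gen_vec_closed])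
  finally show "base_elem t X v = (\<Sum>x\<in>gen_index. Fib_map M S (Scale C (weight t x) (coord X v x)) (gen_vec x))" .
qed

lemma coord_scale:
  assumes v: "v \<in> Fib M S X" and x: "x \<in> gen_index"
  shows "coord X (Fib_scale M c v) x = Scale C c (coord X v x)"
proof -
  have "base_elem (\<lambda>i j. c) X v = Fib_scale M c v"
    by (intro ext) (simp only: base_elem_apply[OF v] Fib_scale_apply)
  then show ?thesis using coord_base_elem[OF v x, of "\<lambda>i j. c"] by (simp add: weight_def split_def)
qed

lemma vector_space_H_scale: "vector_space (H_scale M)"
  by standard
    (simp_all add: H_scale_def Fib_scale_def fun_eq_iff M.V.scale_right_distrib M.V.scale_left_distrib)

sublocale H: vector_space "H_scale M"
  by (rule vector_space_H_scale)

lemma H_scale_apply: "H_scale M c \<eta> X v = Fib_scale M c (\<eta> X v)"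
  by (simp only: H_scale_def)

lemma H_carrierI:
  assumes "\<And>X v. v \<in> Fib M S X \<Longrightarrow> \<eta> X v \<in> Fib M S X"
    and "\<And>X v w. v \<in> Fib M S X \<Longrightarrow> w \<in> Fib M S X \<Longrightarrow> \<eta> X (v + w) = \<eta> X v + \<eta> X w"
    and "\<And>X c v. v \<in> Fib M S X \<Longrightarrow> \<eta> X (Fib_scale M c v) = Fib_scale M c (\<eta> X v)"
    and "\<And>X v. v \<notin> Fib M S X \<Longrightarrow> \<eta> X v = 0"
    and "\<And>X Y f v. f \<in> Hom C X Y \<Longrightarrow> v \<in> Fib M S X \<Longrightarrow> \<eta> Y (Fib_map M S f v) = Fib_map M S f (\<eta> X v)"
  shows "\<eta> \<in> H_carrier C M S"
  unfolding H_carrier_def endo_on_def mem_Collect_eq using assms by blast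

lemma H_add_apply: "(\<eta> + \<theta>) X v = \<eta> X v + \<theta> X v" for \<eta> \<theta> :: "('o, 'i, 'n) fib_end"
  by (simp only: plus_fun_def)

lemma H_carrier_subspace: "H.subspace (H_carrier C M S)"
proof (rule H.subspaceI)
  have "(0 :: ('o, 'i, 'n) fib_end) = base_elem (\<lambda>i j. 0)"
    by (intro ext) (simp add: base_elem_def)
  then show "0 \<in> H_carrier C M S" by (rule ssubst) (rule base_elem_in_H)
  fix \<eta> \<theta> assume e: "\<eta> \<in> H_carrier C M S" and t: "\<theta> \<in> H_carrier C M S"
  show "\<eta> + \<theta> \<in> H_carrier C M S"
  proof (rule H_carrierI; unfold H_add_apply)
    show "\<eta> X v + \<theta> X v \<in> Fib M S X" if "v \<in> Fib M S X" for X v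
      by (rule Fib_add[OF H_carrier_D(4)[OF e that] H_carrier_D(4)[OF t that]])
    show "\<eta> X (v + w) + \<theta> X (v + w) = \<eta> X v + \<theta> X v + (\<eta> X w + \<theta> X w)"
      if "v \<in> Fib M S X" "w \<in> Fib M S X" for X v w
      by (simp only: H_carrier_D(5)[OF e that] H_carrier_D(5)[OF t that] add_ac)
    show "\<eta> X (Fib_scale M c v) + \<theta> X (Fib_scale M c v) = Fib_scale M c (\<eta> X v + \<theta> X v)"
      if "v \<in> Fib M S X" for X c v
      by (simp only: H_carrier_D(6)[OF e that] H_carrier_D(6)[OF t that] F.scale_right_distrib)
    show "\<eta> X v + \<theta> X v = 0" if "v \<notin> Fib M S X" for X v
      by (simp only: H_carrier_D(2)[OF e that] H_carrier_D(2)[OF t that] add_0)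
    show "\<eta> Y (Fib_map M S f v) + \<theta> Y (Fib_map M S f v) = Fib_map M S f (\<eta> X v + \<theta> X v)"
      if "f \<in> Hom C X Y" "v \<in> Fib M S X" for X Y f v
      by (simp only: H_carrier_D(3)[OF e that] H_carrier_D(3)[OF t that]
          Fib_map_add_right[OF that(1) H_carrier_D(4)[OF e that(2)] H_carrier_D(4)[OF t that(2)]])
  qed
next
  fix c \<eta> assume e: "\<eta> \<in> H_carrier C M S"
  show "H_scale M c \<eta> \<in> H_carrier C M S"
  proof (rule H_carrierI; unfold H_scale_apply)
    show "Fib_scale M c (\<eta> X v) \<in> Fib M S X" if "v \<in> Fib M S X" for X v
      by (rule Fib_scale_closed[OF H_carrier_D(4)[OF e that]])
    show "Fib_scale M c (\<eta> X (v + w)) = Fib_scale M c (\<eta> X v) + Fib_scale M c (\<eta> X w)"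
      if "v \<in> Fib M S X" "w \<in> Fib M S X" for X v w
      by (simp only: H_carrier_D(5)[OF e that] F.scale_right_distrib)
    show "Fib_scale M c (\<eta> X (Fib_scale M d v)) = Fib_scale M d (Fib_scale M c (\<eta> X v))"
      if "v \<in> Fib M S X" for X d v
      by (simp only: H_carrier_D(6)[OF e that] F.scale_scale mult.commute)
    show "Fib_scale M c (\<eta> X v) = 0" if "v \<notin> Fib M S X" for X v
      by (simp only: H_carrier_D(2)[OF e that] F.scale_zero_right)
    show "Fib_scale M c (\<eta> Y (Fib_map M S f v)) = Fib_map M S f (Fib_scale M c (\<eta> X v))"
      if "f \<in> Hom C X Y" "v \<in> Fib M S X" for X Y f v
      by (simp only: H_carrier_D(3)[OF e that] Fib_map_scale_right[OF that(1) H_carrier_D(4)[OF e that(2)]])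
  qed
qed

lemma H_mult_closed:
  assumes e: "\<eta> \<in> H_carrier C M S" and t: "\<theta> \<in> H_carrier C M S"
  shows "\<eta> \<star> \<theta> \<in> H_carrier C M S"
proof (rule H_carrierI; unfold H_mult_def)
  show "\<eta> X (\<theta> X v) \<in> Fib M S X" if "v \<in> Fib M S X" for X v
    by (rule H_carrier_D(4)[OF e H_carrier_D(4)[OF t that]])
  show "\<eta> X (\<theta> X (v + w)) = \<eta> X (\<theta> X v) + \<eta> X (\<theta> X w)"
    if "v \<in> Fib M S X" "w \<in> Fib M S X" for X v w
    by (simp only: H_carrier_D(5)[OF t that]
        H_carrier_D(5)[OF e H_carrier_D(4)[OF t that(1)] H_carrier_D(4)[OF t that(2)]])
  show "\<eta> X (\<theta> X (Fib_scale M c v)) = Fib_scale M c (\<eta> X (\<theta> X v))" if "v \<in> Fib M S X" for X c v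
    by (simp only: H_carrier_D(6)[OF t that] H_carrier_D(6)[OF e H_carrier_D(4)[OF t that]])
  show "\<eta> X (\<theta> X v) = 0" if "v \<notin> Fib M S X" for X v
    by (simp only: H_carrier_D(2)[OF t that] H_carrier_zero[OF e])
  show "\<eta> Y (\<theta> Y (Fib_map M S f v)) = Fib_map M S f (\<eta> X (\<theta> X v))"
    if "f \<in> Hom C X Y" "v \<in> Fib M S X" for X Y f v
    by (simp only: H_carrier_D(3)[OF t that] H_carrier_D(3)[OF e that(1) H_carrier_D(4)[OF t that(2)]])
qed

definition hom_basis :: "'j \<Rightarrow> 'j \<Rightarrow> nat \<Rightarrow> 'm" where
  "hom_basis q r = (SOME h. family_basis (Scale C) (Hom C (P q) (P r)) {..<cartan_matrix C P q r} h)"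

lemma hom_basis: "family_basis (Scale C) (Hom C (P q) (P r)) {..<cartan_matrix C P q r} (hom_basis q r)"
  unfolding hom_basis_def cartan_matrix_def hom_dim_def
  by (rule someI_ex[OF C.V.finite_dim_family_basis[OF C.subspace_Hom C.finite_dim_Hom]])

lemma hom_basis_Hom: "d < cartan_matrix C P q r \<Longrightarrow> hom_basis q r d \<in> Hom C (P q) (P r)"
  using family_basis_mem[OF hom_basis] by simp

text \<open>The natural transformation that sends the generator \<open>x\<close> to \<open>F h (gen_vec y)\<close>, where \<open>h\<close> is the
  \<open>d\<close>-th basis element of \<open>Hom (P\<^sub>q, P\<^sub>r)\<close>, and the other generators to \<open>0\<close>.\<close>

definition elementary ::
  "('j \<times> 'i \<times> 'i \<times> nat) \<times> ('j \<times> 'i \<times> 'i \<times> nat) \<times> nat \<Rightarrow> ('o, 'i, 'n) fib_end" where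
  "elementary = (\<lambda>(x, y, d) X v. if v \<in> Fib M S X
     then Fib_map M S (coord X v x \<cdot> hom_basis (fst y) (fst x) d) (gen_vec y) else 0)"

definition elementary_index :: "(('j \<times> 'i \<times> 'i \<times> nat) \<times> ('j \<times> 'i \<times> 'i \<times> nat) \<times> nat) set" where
  "elementary_index = (SIGMA x:gen_index. SIGMA y:gen_index. {..<cartan_matrix C P (fst y) (fst x)})"

lemma elementary_apply:
  "v \<in> Fib M S X \<Longrightarrow> elementary (x, y, d) X v = Fib_map M S (coord X v x \<cdot> hom_basis (fst y) (fst x) d) (gen_vec y)"
  by (simp add: elementary_def)

lemma elementary_in_H:
  assumes "z \<in> elementary_index"
  shows "elementary z \<in> H_carrier C M S"
proof -
  obtain x y d where z: "z = (x, y, d)" by (cases z)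
  have x: "x \<in> gen_index" and y: "y \<in> gen_index" and d: "d < cartan_matrix C P (fst y) (fst x)"
    using assms by (simp_all add: z elementary_index_def)
  note h = hom_basis_Hom[OF d] and g = gen_vec_closed[OF y]
  let ?h = "hom_basis (fst y) (fst x) d"
  have ch: "coord X v x \<cdot> ?h \<in> Hom C (P (fst y)) X" if "v \<in> Fib M S X" for X v
    by (rule C.Comp_in_Hom[OF h coord(1)[OF that]])
  show ?thesis
    unfolding z
  proof (rule H_carrierI)
    show "elementary (x, y, d) X v \<in> Fib M S X" if "v \<in> Fib M S X" for X v
      unfolding elementary_apply[OF that] by (rule Fib_map_closed[OF ch[OF that] g])
    show "elementary (x, y, d) X (v + w) = elementary (x, y, d) X v + elementary (x, y, d) X w"
      if v: "v \<in> Fib M S X" and w: "w \<in> Fib M S X" for X v w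
      by (simp only: elementary_apply[OF v] elementary_apply[OF w] elementary_apply[OF Fib_add[OF v w]]
          coord_add[OF v w x] C.Comp_add_left[OF h coord(1)[OF v] coord(1)[OF w]]
          Fib_map_add_left[OF ch[OF v] ch[OF w] g])
    show "elementary (x, y, d) X (Fib_scale M c v) = Fib_scale M c (elementary (x, y, d) X v)"
      if v: "v \<in> Fib M S X" for X c v
      by (simp only: elementary_apply[OF v] elementary_apply[OF Fib_scale_closed[OF v]] coord_scale[OF v x]
          C.Comp_scale_left[OF h coord(1)[OF v]] Fib_map_scale_left[OF ch[OF v] g])
    show "elementary (x, y, d) X v = 0" if "v \<notin> Fib M S X" for X v
      using that by (simp add: elementary_def)
    show "elementary (x, y, d) Y (Fib_map M S f v) = Fib_map M S f (elementary (x, y, d) X v)"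
      if f: "f \<in> Hom C X Y" and v: "v \<in> Fib M S X" for X Y f v
      by (simp only: elementary_apply[OF v] elementary_apply[OF Fib_map_closed[OF f v]] coord_Fib_map[OF f v x]
          C.Comp_assoc[OF h coord(1)[OF v] f] Fib_map_comp[OF ch[OF v] f g])
  qed
qed

lemma sum_elementary_apply:
  assumes v: "v \<in> Fib M S X"
  defines "b \<equiv> \<lambda>\<alpha> x y. \<Sum>d<cartan_matrix C P (fst y) (fst x). Scale C (\<alpha> (x, y, d)) (hom_basis (fst y) (fst x) d)"
  shows "(\<Sum>z\<in>elementary_index. H_scale M (\<alpha> z) (elementary z)) X v
    = (\<Sum>x\<in>gen_index. Fib_map M S (coord X v x) (\<Sum>y\<in>gen_index. Fib_map M S (b \<alpha> x y) (gen_vec y)))"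
proof -
  have bH: "b \<alpha> x y \<in> Hom C (P (fst y)) (P (fst x))" for x y
    unfolding b_def by (rule C.Hom_sum) (simp add: C.Hom_scale hom_basis_Hom)
  have inner: "(\<Sum>d<cartan_matrix C P (fst y) (fst x). Fib_scale M (\<alpha> (x, y, d)) (elementary (x, y, d) X v))
      = Fib_map M S (coord X v x) (Fib_map M S (b \<alpha> x y) (gen_vec y))"
    if x: "x \<in> gen_index" and y: "y \<in> gen_index" for x y
  proof -
    note c = coord(1)[OF v, of x] and g = gen_vec_closed[OF y]
    let ?h = "hom_basis (fst y) (fst x)"
    have h: "?h d \<in> Hom C (P (fst y)) (P (fst x))" if "d \<in> {..<cartan_matrix C P (fst y) (fst x)}" for d
      using hom_basis_Hom that by simp
    have "(\<Sum>d<cartan_matrix C P (fst y) (fst x). Fib_scale M (\<alpha> (x, y, d)) (elementary (x, y, d) X v))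
        = (\<Sum>d<cartan_matrix C P (fst y) (fst x). Fib_map M S (coord X v x) (Fib_map M S (Scale C (\<alpha> (x, y, d)) (?h d)) (gen_vec y)))"
      by (rule sum.cong[OF refl])
        (simp only: elementary_apply[OF v] Fib_map_comp[OF h c g] Fib_map_scale_left[OF h g]
          Fib_map_scale_right[OF c Fib_map_closed[OF h g]])
    also have "\<dots> = Fib_map M S (coord X v x) (\<Sum>d<cartan_matrix C P (fst y) (fst x). Fib_map M S (Scale C (\<alpha> (x, y, d)) (?h d)) (gen_vec y))"
      by (rule Fib_map_sum_right[OF c _ finite_lessThan, symmetric]) (rule Fib_map_closed[OF C.Hom_scale[OF h] g])
    also have "\<dots> = Fib_map M S (coord X v x) (Fib_map M S (b \<alpha> x y) (gen_vec y))"
      unfolding b_def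
      by (rule arg_cong[where f = "Fib_map M S (coord X v x)"],
          rule Fib_map_sum_left[OF _ g finite_lessThan, symmetric]) (rule C.Hom_scale[OF h])
    finally show ?thesis .
  qed
  have "(\<Sum>z\<in>elementary_index. H_scale M (\<alpha> z) (elementary z)) X v
      = (\<Sum>z\<in>elementary_index. Fib_scale M (\<alpha> z) (elementary z X v))"
    by (simp only: sum_apply H_scale_apply)
  also have "\<dots> = (\<Sum>x\<in>gen_index. \<Sum>y\<in>gen_index. \<Sum>d<cartan_matrix C P (fst y) (fst x).
      Fib_scale M (\<alpha> (x, y, d)) (elementary (x, y, d) X v))"
    unfolding elementary_index_def by (simp add: sum.Sigma finite_gen_index split_def)
  also have "\<dots> = (\<Sum>x\<in>gen_index. \<Sum>y\<in>gen_index. Fib_map M S (coord X v x) (Fib_map M S (b \<alpha> x y) (gen_vec y)))"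
    by (intro sum.cong refl inner)
  also have "\<dots> = (\<Sum>x\<in>gen_index. Fib_map M S (coord X v x) (\<Sum>y\<in>gen_index. Fib_map M S (b \<alpha> x y) (gen_vec y)))"
    by (rule sum.cong[OF refl], rule Fib_map_sum_right[OF coord(1)[OF v] _ finite_gen_index, symmetric])
      (rule Fib_map_closed[OF bH gen_vec_closed])
  finally show ?thesis .
qed

text \<open>The Yoneda lemma. As \<open>\<eta>\<close> is natural, it is determined by its values at the generators \<open>x\<close>; these lie
  in \<open>F P\<^sub>r\<close> and are expanded in the generators \<open>y\<close> with coefficients in \<open>Hom (P\<^sub>q, P\<^sub>r)\<close>.\<close>

lemma elementary_basis: "family_basis (H_scale M) (H_carrier C M S) elementary_index elementary"
  unfolding family_basis_def
proof (intro conjI ballI allI impI)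
  show "finite elementary_index" by (simp add: elementary_index_def finite_gen_index)
  show "elementary ` elementary_index \<subseteq> H_carrier C M S" using elementary_in_H by blast
next
  fix \<eta> assume \<eta>: "\<eta> \<in> H_carrier C M S"
  have e: "\<eta> (P (fst x)) (gen_vec x) \<in> Fib M S (P (fst x))" if "x \<in> gen_index" for x
    by (rule H_carrier_D(4)[OF \<eta> gen_vec_closed[OF that]])
  have "\<exists>\<alpha>. x \<in> gen_index \<longrightarrow> coord (P (fst x)) (\<eta> (P (fst x)) (gen_vec x)) y
    = (\<Sum>d<cartan_matrix C P (fst y) (fst x). Scale C (\<alpha> d) (hom_basis (fst y) (fst x) d))" for x y
    using family_basis_expand[OF hom_basis coord(1)[OF e]] by blast
  then have "\<exists>\<alpha>. \<forall>x y. x \<in> gen_index \<longrightarrow> coord (P (fst x)) (\<eta> (P (fst x)) (gen_vec x)) y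
    = (\<Sum>d<cartan_matrix C P (fst y) (fst x). Scale C (\<alpha> x y d) (hom_basis (fst y) (fst x) d))"
    by (intro choice allI)
  then obtain \<alpha> where \<alpha>: "\<And>x y. x \<in> gen_index \<Longrightarrow> coord (P (fst x)) (\<eta> (P (fst x)) (gen_vec x)) y
    = (\<Sum>d<cartan_matrix C P (fst y) (fst x). Scale C (\<alpha> x y d) (hom_basis (fst y) (fst x) d))" by blast
  let ?\<alpha> = "\<lambda>(x, y, d). \<alpha> x y d"
  let ?s = "\<Sum>z\<in>elementary_index. H_scale M (?\<alpha> z) (elementary z)"
  have sH: "?s \<in> H_carrier C M S"
    by (intro H.subspace_sum[OF H_carrier_subspace] H.subspace_scale[OF H_carrier_subspace] elementary_in_H)
  have "\<eta> = ?s"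
  proof (rule ext, rule ext)
    fix X v
    show "\<eta> X v = ?s X v"
    proof (cases "v \<in> Fib M S X")
      case v: True
      note c = coord(1)[OF v]
      have closed: "Fib_map M S (coord X v x) (gen_vec x) \<in> Fib M S X" if "x \<in> gen_index" for x
        by (rule Fib_map_closed[OF c gen_vec_closed[OF that]])
      have "?s X v = (\<Sum>x\<in>gen_index. Fib_map M S (coord X v x) (\<eta> (P (fst x)) (gen_vec x)))"
        unfolding sum_elementary_apply[OF v] prod.case
        by (rule sum.cong[OF refl]) (simp only: \<alpha>[symmetric] coord(2)[OF e])
      also have "\<dots> = (\<Sum>x\<in>gen_index. Fib_scale M 1 (\<eta> X (Fib_map M S (coord X v x) (gen_vec x))))"
        by (rule sum.cong[OF refl]) (simp only: H_carrier_D(3)[OF \<eta> c gen_vec_closed] F.scale_one)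
      also have "\<dots> = \<eta> X (\<Sum>x\<in>gen_index. Fib_scale M 1 (Fib_map M S (coord X v x) (gen_vec x)))"
        by (rule endo_on_sum[OF vector_space_Fib_scale Fib_subspace H_carrier_D(1)[OF \<eta>] finite_gen_index closed, symmetric])
      also have "\<dots> = \<eta> X v" by (simp only: F.scale_one coord(2)[OF v])
      finally show ?thesis by (rule sym)
    next
      case False
      show ?thesis by (simp only: H_carrier_D(2)[OF \<eta> False] H_carrier_D(2)[OF sH False])
    qed
  qed
  then show "\<exists>\<alpha>. \<eta> = (\<Sum>z\<in>elementary_index. H_scale M (\<alpha> z) (elementary z))" by (rule exI[of _ ?\<alpha>])
next
  fix \<alpha> z assume eq: "(\<Sum>z\<in>elementary_index. H_scale M (\<alpha> z) (elementary z)) = 0" and z: "z \<in> elementary_index"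
  obtain x y d where zz: "z = (x, y, d)" by (cases z)
  have x: "x \<in> gen_index" and y: "y \<in> gen_index" and d: "d < cartan_matrix C P (fst y) (fst x)"
    using z by (simp_all add: zz elementary_index_def)
  let ?b = "\<lambda>x y. \<Sum>d<cartan_matrix C P (fst y) (fst x). Scale C (\<alpha> (x, y, d)) (hom_basis (fst y) (fst x) d)"
  have bH: "?b x y \<in> Hom C (P (fst y)) (P (fst x))" for x y
    by (rule C.Hom_sum) (simp add: C.Hom_scale hom_basis_Hom)
  note g = gen_vec_closed[OF x]
  \<comment> \<open>The generator \<open>x\<close> has coordinates \<open>?\<delta>\<close>, so evaluation at it isolates the terms with first index \<open>x\<close>.\<close>
  let ?\<delta> = "\<lambda>x'. if x' = x then Id C (P (fst x)) else 0"
  have \<delta>H: "?\<delta> x' \<in> Hom C (P (fst x')) (P (fst x))" for x'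
    using C.Id_in_Hom C.Hom_zero by auto
  let ?w = "\<lambda>x. \<Sum>y\<in>gen_index. Fib_map M S (?b x y) (gen_vec y)"
  have wF: "?w x \<in> Fib M S (P (fst x))" for x
    by (rule Fib_sum) (rule Fib_map_closed[OF bH gen_vec_closed])
  have \<delta>_sum: "(\<Sum>x'\<in>gen_index. Fib_map M S (?\<delta> x') (W x')) = W x"
    if W: "\<And>x'. x' \<in> gen_index \<Longrightarrow> W x' \<in> Fib M S (P (fst x'))" for W
  proof -
    have "(\<Sum>x'\<in>gen_index. Fib_map M S (?\<delta> x') (W x')) = (\<Sum>x'\<in>gen_index. if x' = x then W x' else 0)"
    proof (rule sum.cong[OF refl])
      fix x' assume x': "x' \<in> gen_index"
      show "Fib_map M S (?\<delta> x') (W x') = (if x' = x then W x' else 0)"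
      proof (cases "x' = x")
        case True
        then show ?thesis using W[OF x'] by (simp only: refl if_True Fib_map_Id)
      next
        case False
        then show ?thesis using W[OF x'] by (simp only: if_False Fib_map_zero_left)
      qed
    qed
    also have "\<dots> = W x" by (simp only: sum.delta[OF finite_gen_index] x if_True)
    finally show ?thesis .
  qed
  have coord_gen: "coord (P (fst x)) (gen_vec x) x' = ?\<delta> x'" if "x' \<in> gen_index" for x'
    by (rule coord_eqI[where f = ?\<delta>, OF g \<delta>H _ that], rule \<delta>_sum[symmetric]) (rule gen_vec_closed)
  have "0 = (\<Sum>z\<in>elementary_index. H_scale M (\<alpha> z) (elementary z)) (P (fst x)) (gen_vec x)"
    by (simp only: eq zero_fun_def)
  also have "\<dots> = (\<Sum>x'\<in>gen_index. Fib_map M S (?\<delta> x') (?w x'))"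
    unfolding sum_elementary_apply[OF g] by (rule sum.cong[OF refl]) (simp only: coord_gen)
  also have "\<dots> = ?w x" by (rule \<delta>_sum) (rule wF)
  finally have "?w x = 0" by (rule sym)
  then have "?b x y = 0" by (rule Fib_expand_unique[where f = "?b x", OF bH _ y])
  then have "\<alpha> (x, y, d) = 0"
    using family_basis_unique[where \<alpha> = "\<lambda>d. \<alpha> (x, y, d)", OF hom_basis] d by blast
  then show "\<alpha> z = 0" by (simp only: zz)
qed

lemma elementary_conj:
  assumes z: "(x, y, d) \<in> elementary_index"
  shows "base_elem t \<star> elementary (x, y, d) \<star> base_elem t' = H_scale M (weight t y * weight t' x) (elementary (x, y, d))"
proof (rule ext, rule ext)
  have x: "x \<in> gen_index" and y: "y \<in> gen_index" and d: "d < cartan_matrix C P (fst y) (fst x)"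
    using z by (simp_all add: elementary_index_def)
  note h = hom_basis_Hom[OF d] and g = gen_vec_closed[OF y]
  fix X v
  show "(base_elem t \<star> elementary (x, y, d) \<star> base_elem t') X v
    = H_scale M (weight t y * weight t' x) (elementary (x, y, d)) X v"
  proof (cases "v \<in> Fib M S X")
    case v: True
    note ch = C.Comp_in_Hom[OF h coord(1)[OF v]]
    show ?thesis
      by (simp only: H_mult_def H_scale_apply elementary_apply[OF v] elementary_apply[OF base_elem_closed[OF v]]
          coord_base_elem[OF v x] C.Comp_scale_left[OF h coord(1)[OF v]] Fib_map_scale_left[OF ch g]
          H_carrier_D(6)[OF base_elem_in_H Fib_map_closed[OF ch g]] Fib_map_base_elem[OF ch g]
          base_elem_gen_vec[OF y] Fib_map_scale_right[OF ch g] F.scale_scale mult.commute)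
  next
    case False
    have eH: "elementary (x, y, d) \<in> H_carrier C M S" by (rule elementary_in_H[OF z])
    show ?thesis
      by (simp only: H_mult_def H_scale_apply H_carrier_D(2)[OF base_elem_in_H False] H_carrier_zero[OF eH]
          H_carrier_zero[OF base_elem_in_H] H_carrier_D(2)[OF eH False] F.scale_zero_right)
  qed
qed

section \<open>The characteristic polynomial\<close>

lemma prod_gen_index: "(\<Prod>x\<in>gen_index. F x) = (\<Prod>q\<in>UNIV. \<Prod>i\<in>UNIV. \<Prod>j\<in>UNIV. \<Prod>s<N q i j. F (q, i, j, s))"
  for F :: "_ \<Rightarrow> 'k poly"
  unfolding gen_index_def by (simp add: prod.Sigma split_def)

lemma prod_elementary_index:
  "(\<Prod>z\<in>elementary_index. F z)
    = (\<Prod>x\<in>gen_index. \<Prod>y\<in>gen_index. \<Prod>d<cartan_matrix C P (fst y) (fst x). F (x, y, d))"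
  for F :: "_ \<Rightarrow> 'k poly"
  unfolding elementary_index_def by (simp add: prod.Sigma finite_gen_index split_def)

lemma char_poly_index:
  fixes L :: "'i \<Rightarrow> 'i \<Rightarrow> 'i \<Rightarrow> 'i \<Rightarrow> 'k poly"
  shows "(\<Prod>((r, l, k, s), (q, i, j, t), d)\<in>elementary_index. L i j k l)
    = (\<Prod>i\<in>UNIV. \<Prod>j\<in>UNIV. \<Prod>k\<in>UNIV. \<Prod>l\<in>UNIV.
        L i j k l ^ (\<Sum>q\<in>UNIV. \<Sum>r\<in>UNIV. N q i j * cartan_matrix C P q r * N r l k))"
proof -
  let ?c = "cartan_matrix C P"
  have "(\<Prod>((r, l, k, s), (q, i, j, t), d)\<in>elementary_index. L i j k l)
    = (\<Prod>r\<in>UNIV. \<Prod>l\<in>UNIV. \<Prod>k\<in>UNIV. \<Prod>s<N r l k. \<Prod>q\<in>UNIV. \<Prod>i\<in>UNIV. \<Prod>j\<in>UNIV. \<Prod>t<N q i j. \<Prod>d<?c q r. L i j k l)"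
    by (simp only: prod_elementary_index prod_gen_index prod.case fst_conv)
  also have "\<dots> = (\<Prod>r\<in>UNIV. \<Prod>l\<in>UNIV. \<Prod>k\<in>UNIV. \<Prod>q\<in>UNIV. \<Prod>i\<in>UNIV. \<Prod>j\<in>UNIV. L i j k l ^ (N q i j * ?c q r * N r l k))"
    by (simp add: prod_power_distrib power_mult[symmetric] mult_ac)
  also have "\<dots> = (\<Prod>i\<in>UNIV. \<Prod>j\<in>UNIV. \<Prod>k\<in>UNIV. \<Prod>l\<in>UNIV. \<Prod>q\<in>UNIV. \<Prod>r\<in>UNIV. L i j k l ^ (N q i j * ?c q r * N r l k))"
    unfolding prod.cartesian_product
    by (rule prod.reindex_bij_witness[of _ "\<lambda>(i, j, k, l, q, r). (r, l, k, q, i, j)" "\<lambda>(r, l, k, q, i, j). (i, j, k, l, q, r)"])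
      auto
  also have "\<dots> = (\<Prod>i\<in>UNIV. \<Prod>j\<in>UNIV. \<Prod>k\<in>UNIV. \<Prod>l\<in>UNIV.
        L i j k l ^ (\<Sum>q\<in>UNIV. \<Sum>r\<in>UNIV. N q i j * ?c q r * N r l k))"
    by (simp only: power_sum)
  finally show ?thesis .
qed

lemma antipode_square_char_poly:
  assumes a: "\<And>X. a X \<in> Hom C X (Dual C (Dual C X))" and m: "pivotal_factor C M S a m"
  shows "has_char_poly (H_scale M) (H_carrier C M S) (\<lambda>x. antipode C M S (antipode C M S x))
     (\<Prod>i\<in>UNIV. \<Prod>j\<in>UNIV. \<Prod>k\<in>UNIV. \<Prod>l\<in>UNIV. [:- (m j * m l / (m i * m k)), 1:] ^
        (\<Sum>q\<in>UNIV. \<Sum>r\<in>UNIV. N q i j * cartan_matrix C P q r * N r l k))"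
proof -
  note nz = pivotal_factorD(1)[OF m]
  let ?t = "\<lambda>i j. m j / m i"
  let ?t' = "\<lambda>i j. inverse (m j / m i)"
  let ?T = "\<lambda>x. antipode C M S (antipode C M S x)"
  have T: "?T x = base_elem ?t \<star> x \<star> base_elem ?t'" if "x \<in> H_carrier C M S" for x
    by (rule base_elem_conj_antipode_square[OF that a pivotal_factorD(2)[OF m]]) (simp add: nz)
  have endo: "endo_on (H_scale M) (H_carrier C M S) ?T"
    unfolding endo_on_def
  proof (intro conjI ballI allI)
    fix x assume x: "x \<in> H_carrier C M S"
    show "?T x \<in> H_carrier C M S"
      unfolding T[OF x] by (intro H_mult_closed base_elem_in_H x)
    fix y assume y: "y \<in> H_carrier C M S"
    show "?T (x + y) = ?T x + ?T y"
      unfolding T[OF x] T[OF y] T[OF H.subspace_add[OF H_carrier_subspace x y]]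
    proof (rule ext, rule ext)
      fix X v
      let ?v = "base_elem ?t' X v"
      have v: "?v \<in> Fib M S X"
        by (cases "v \<in> Fib M S X") (simp_all only: base_elem_closed H_carrier_D(2)[OF base_elem_in_H] Fib_zero not_False_eq_True)
      show "(base_elem ?t \<star> (x + y) \<star> base_elem ?t') X v
        = (base_elem ?t \<star> x \<star> base_elem ?t' + base_elem ?t \<star> y \<star> base_elem ?t') X v"
        unfolding H_mult_def H_add_apply
        by (rule H_carrier_D(5)[OF base_elem_in_H H_carrier_D(4)[OF x v] H_carrier_D(4)[OF y v]])
    qed
  next
    fix c x assume x: "x \<in> H_carrier C M S"
    show "?T (H_scale M c x) = H_scale M c (?T x)"
      unfolding T[OF x] T[OF H.subspace_scale[OF H_carrier_subspace x]]
    proof (rule ext, rule ext)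
      fix X v
      let ?v = "base_elem ?t' X v"
      have v: "?v \<in> Fib M S X"
        by (cases "v \<in> Fib M S X") (simp_all only: base_elem_closed H_carrier_D(2)[OF base_elem_in_H] Fib_zero not_False_eq_True)
      show "(base_elem ?t \<star> H_scale M c x \<star> base_elem ?t') X v
        = H_scale M c (base_elem ?t \<star> x \<star> base_elem ?t') X v"
        unfolding H_mult_def H_scale_apply
        by (rule H_carrier_D(6)[OF base_elem_in_H H_carrier_D(4)[OF x v]])
    qed
  qed
  define l :: "('j \<times> 'i \<times> 'i \<times> nat) \<times> ('j \<times> 'i \<times> 'i \<times> nat) \<times> nat \<Rightarrow> 'k"
    where "l = (\<lambda>((r, l, k, s), (q, i, j, t), d). m j * m l / (m i * m k))"
  have eig: "?T (elementary z) = H_scale M (l z) (elementary z)" if z: "z \<in> elementary_index" for z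
  proof -
    obtain r l k s q i j t d where zz: "z = ((r, l, k, s), (q, i, j, t), d)" by (cases z) auto
    show ?thesis
      unfolding T[OF elementary_in_H[OF z]] unfolding zz elementary_conj[OF z[unfolded zz]]
      by (simp add: weight_def l_def)
  qed
  have "has_char_poly (H_scale M) (H_carrier C M S) ?T (\<Prod>z\<in>elementary_index. [:- l z, 1:])"
    by (rule has_char_poly_eigenbasis[where T = ?T and e = elementary and l = l,
          OF vector_space_H_scale H_carrier_subspace endo elementary_basis]) (rule eig)
  also have "(\<Prod>z\<in>elementary_index. [:- l z, 1:])
    = (\<Prod>((r, l, k, s), (q, i, j, t), d)\<in>elementary_index. [:- (m j * m l / (m i * m k)), 1:])"
    by (rule prod.cong[OF refl]) (simp add: l_def split_def)
  also note char_poly_index[of "\<lambda>i j k l. [:- (m j * m l / (m i * m k)), 1:]"]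
  finally show ?thesis .
qed

end

text \<open>Both conjuncts about \<open>g\<close> follow from its description by the scalars \<open>\<theta>\<close> of the isomorphism
  \<open>1 \<cong> \<chi>(a, M)\<close>.\<close>

theorem proposition3p1:
  fixes C :: "('k::alg_closed_field, 'o, 'm::ab_group_add) tencat"
    and M :: "('k, 'u, 'n::ab_group_add, 'o, 'm) modcat"
    and R :: "'j::finite \<Rightarrow> 'o" and P :: "'j \<Rightarrow> 'o" and S :: "'i::finite \<Rightarrow> 'u"
    and a :: "'o \<Rightarrow> 'm"
  assumes "finite_tensor_category C"
    and "representative_simples C R"
    and "\<And>r. projective_cover C (R r) (P r)"
    and "semisimple_module_category C M"
    and "indecomposable M"
    and "representative_simples M S"
    and "pivotal_structure C a"
    and "matched C M S a"
  defines "H \<equiv> H_carrier C M S"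
    and "g \<equiv> pivotal_element C M S a"
    and "N \<equiv> fusion_coeff M R S"
  shows "(\<forall>x\<in>H. antipode C M S (antipode C M S x) = g \<star> x \<star> H_inv C M S g) \<and>
    (\<exists>m. pivotal_factor C M S a m) \<and>
    (\<forall>m. pivotal_factor C M S a m \<longrightarrow>
       has_char_poly (H_scale M) H (\<lambda>x. antipode C M S (antipode C M S x))
         (\<Prod>i\<in>UNIV. \<Prod>j\<in>UNIV. \<Prod>k\<in>UNIV. \<Prod>l\<in>UNIV.
            [:- (m j * m l / (m i * m k)), 1:] ^
              (\<Sum>q\<in>UNIV. \<Sum>r\<in>UNIV. N q i j * cartan_matrix C P q r * N r l k)))"
proof -
  interpret semisimple_module_category C M by fact
  interpret weak_hopf_setting C M S R P
    by unfold_locales (rule assms)+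
  have a: "a X \<in> Hom C X (Dual C (Dual C X))" for X
    using \<open>pivotal_structure C a\<close> by (simp add: pivotal_structure_def iso_mor_def)
  obtain \<theta> where \<theta>: "\<And>i. \<theta> i \<noteq> 0" "g = base_elem (\<lambda>i j. \<theta> i / \<theta> j)"
    using matched_pivotal_element[OF \<open>matched C M S a\<close>] unfolding g_def by blast
  have inv: "H_inv C M S g = base_elem (\<lambda>i j. inverse (\<theta> i / \<theta> j))"
    unfolding \<theta>(2) by (rule H_inv_eqI[OF base_elem_inverse]) (simp add: \<theta>(1))
  have "antipode C M S (antipode C M S x) = g \<star> x \<star> H_inv C M S g" if "x \<in> H" for x
    unfolding inv unfolding \<theta>(2)
    by (rule base_elem_conj_antipode_square[OF that[unfolded H_def] a \<theta>(2)[unfolded g_def]]) (simp add: \<theta>(1))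
  moreover have "pivotal_factor C M S a (\<lambda>i. inverse (\<theta> i))"
    by (rule pivotal_factorI) (simp_all add: \<theta>(1) \<theta>(2)[unfolded g_def] field_simps)
  ultimately show ?thesis
    using antipode_square_char_poly[of a, OF a] unfolding H_def N_def by blast
qed

end
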